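(* Let $\Bbbk$ be a field and let $(B_l,\cdot_l,\diamond_l,1_l,\Delta_l,\varepsilon_l)_{l\in I}$ be a family of $2$-bialgebras over $\Bbbk$. Let $\bigoplus_{l\in I}B_l$ be the direct sum coalgebra (the coproduct of the underlying coalgebras), with canonical injections $j_t:B_t\to\bigoplus_{l\in I}B_l$. Let $F=F(\bigoplus_{l\in I}B_l)$, with multiplications $\cdot,\diamond$, unit $1$ and canonical linear map $i:\bigoplus_{l\in I}B_l\to F$, be the free $2$-algebra on the vector space $\bigoplus_{l\in I}B_l$, equipped with its $2$-bialgebra structure described in the context, and put $u_t:=i\circ j_t$ for $t\in I$. Let $J_0\subseteq F$ be the linear span of the elements $$1-u_t(1_t),\qquad u_t(x\cdot_t x')-u_t(x)\cdot u_t(x'),\qquad u_t(x\diamond_t x')-u_t(x)\diamond u_t(x')\qquad (t\in I,\ x,x'\in B_t).$$ For odd $n\geq 1$ let $J_n$ be the ideal of $(F,\cdot,1)$ generated by $J_{n-1}$, for even $n\ge 2$ let $J_n$ be the ideal of $(F,\diamond,1)$ generated by $J_{n-1}$, and let $L:=\bigcup_{n\in\mathbb N}J_n$. Then $L$ is a coideal of $F$ and an ideal for both multiplications, and the quotient $2$-bialgebra $F/L$ (with the maps $B_t\to F/L$ induced by $u_t$) is the coproduct of the family $(B_l)_{l\in I}$ in the category ${}_2\mathrm{Bialg}$ of $2$-bialgebras. If all $B_l$ are cocommutative, the same construction gives the coproduct in the category ${}_2\mathrm{Bialg}^{coc}$ of cocommutative $2$-bialgebras.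
   Context: All structures are linear over a field $\Bbbk$; algebras are unital and associative, coalgebras counital and coassociative. A $2$-algebra is a vector space with two (unital, associative) algebra structures sharing the same unit; morphisms are unit-preserving linear maps respecting both multiplications. The tensor product of two $2$-algebras is a $2$-algebra with componentwise multiplications. A $2$-bialgebra is a coalgebra equipped with two algebra structures sharing the same unit, such that the unit and both multiplications are coalgebra maps; morphisms are the coalgebra maps that are $2$-algebra morphisms. The free $2$-algebra on a vector space $V$ is the $2$-algebra $F(V)$ with a linear map $i:V\to F(V)$ that is universal among linear maps from $V$ to $2$-algebras. If $V$ is a coalgebra with comultiplication $\overline\Delta$ and counit $\overline\varepsilon$, then $F(V)$ is a $2$-bialgebra with $\Delta,\varepsilon$ the unique $2$-algebra morphisms $F(V)\to F(V)\otimes F(V)$ and $F(V)\to\Bbbk$ such that $\Delta\circ i=(i\otimes i)\circ\overline\Delta$ and $\varepsilon\circ i=\overline\varepsilon$. *)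

theory Defs
  imports "HOL-Algebra.Module" "HOL-Algebra.QuotRing"
begin

section \<open>Linear algebra over a field\<close>

text \<open>
  Vector spaces over a field \<open>K\<close> are the library's modules. For a vector space without a
  multiplication, the fields \<open>mult\<close> and \<open>one\<close> of the record are ignored.
\<close>

definition linear_map ::
    "('k, 'q) ring_scheme \<Rightarrow> ('k, 'a, 'm) module_scheme \<Rightarrow> ('k, 'b, 'n) module_scheme
      \<Rightarrow> ('a \<Rightarrow> 'b) \<Rightarrow> bool" where
  "linear_map K V W f \<longleftrightarrow>
     f \<in> carrier V \<rightarrow> carrier W \<and>
     (\<forall>x\<in>carrier V. \<forall>y\<in>carrier V. f (x \<oplus>\<^bsub>V\<^esub> y) = f x \<oplus>\<^bsub>W\<^esub> f y) \<and>
     (\<forall>c\<in>carrier K. \<forall>x\<in>carrier V. f (c \<odot>\<^bsub>V\<^esub> x) = c \<odot>\<^bsub>W\<^esub> f x)"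

definition bilinear_map ::
    "('k, 'q) ring_scheme \<Rightarrow> ('k, 'a, 'l) module_scheme \<Rightarrow> ('k, 'b, 'm) module_scheme
      \<Rightarrow> ('k, 'c, 'n) module_scheme \<Rightarrow> ('a \<Rightarrow> 'b \<Rightarrow> 'c) \<Rightarrow> bool" where
  "bilinear_map K V W U \<beta> \<longleftrightarrow>
     (\<forall>v\<in>carrier V. linear_map K W U (\<beta> v)) \<and>
     (\<forall>w\<in>carrier W. linear_map K V U (\<lambda>v. \<beta> v w))"

definition linear_span ::
    "('k, 'q) ring_scheme \<Rightarrow> ('k, 'a, 'm) module_scheme \<Rightarrow> 'a set \<Rightarrow> 'a set" where
  "linear_span K V S = \<Inter>{N. submodule N K V \<and> S \<subseteq> N}"


section \<open>Tensor products\<close>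

text \<open>
  The tensor product of \<open>V\<close> and \<open>W\<close>, by generators and relations: formal linear expressions in
  symbols \<open>TPure v w\<close>, modulo the smallest congruence satisfying the vector space axioms and making
  \<open>TPure\<close> bilinear.
\<close>

datatype ('k, 'a, 'b) tensor_term =
    TZero
  | TPure 'a 'b
  | TAdd "('k, 'a, 'b) tensor_term" "('k, 'a, 'b) tensor_term"
  | TScale 'k "('k, 'a, 'b) tensor_term"

primrec tensor_wf ::
    "('k, 'q) ring_scheme \<Rightarrow> ('k, 'a, 'm) module_scheme \<Rightarrow> ('k, 'b, 'n) module_scheme
      \<Rightarrow> ('k, 'a, 'b) tensor_term \<Rightarrow> bool" where
  "tensor_wf K V W TZero = True"
| "tensor_wf K V W (TPure v w) = (v \<in> carrier V \<and> w \<in> carrier W)"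
| "tensor_wf K V W (TAdd s t) = (tensor_wf K V W s \<and> tensor_wf K V W t)"
| "tensor_wf K V W (TScale c t) = (c \<in> carrier K \<and> tensor_wf K V W t)"

inductive tensor_eq ::
    "('k, 'q) ring_scheme \<Rightarrow> ('k, 'a, 'm) module_scheme \<Rightarrow> ('k, 'b, 'n) module_scheme
      \<Rightarrow> ('k, 'a, 'b) tensor_term \<Rightarrow> ('k, 'a, 'b) tensor_term \<Rightarrow> bool"
  for K V W where
  refl: "tensor_wf K V W t \<Longrightarrow> tensor_eq K V W t t"
| sym: "tensor_eq K V W s t \<Longrightarrow> tensor_eq K V W t s"
| trans: "tensor_eq K V W r s \<Longrightarrow> tensor_eq K V W s t \<Longrightarrow> tensor_eq K V W r t"
| add_cong: "tensor_eq K V W s s' \<Longrightarrow> tensor_eq K V W t t'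
    \<Longrightarrow> tensor_eq K V W (TAdd s t) (TAdd s' t')"
| scale_cong: "c \<in> carrier K \<Longrightarrow> tensor_eq K V W t t'
    \<Longrightarrow> tensor_eq K V W (TScale c t) (TScale c t')"
| add_assoc: "tensor_wf K V W r \<Longrightarrow> tensor_wf K V W s \<Longrightarrow> tensor_wf K V W t
    \<Longrightarrow> tensor_eq K V W (TAdd (TAdd r s) t) (TAdd r (TAdd s t))"
| add_comm: "tensor_wf K V W s \<Longrightarrow> tensor_wf K V W t
    \<Longrightarrow> tensor_eq K V W (TAdd s t) (TAdd t s)"
| add_zero: "tensor_wf K V W t \<Longrightarrow> tensor_eq K V W (TAdd TZero t) t"
| add_neg: "tensor_wf K V W t
    \<Longrightarrow> tensor_eq K V W (TAdd (TScale (\<ominus>\<^bsub>K\<^esub> \<one>\<^bsub>K\<^esub>) t) t) TZero"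
| scale_add_left: "c \<in> carrier K \<Longrightarrow> d \<in> carrier K \<Longrightarrow> tensor_wf K V W t
    \<Longrightarrow> tensor_eq K V W (TScale (c \<oplus>\<^bsub>K\<^esub> d) t) (TAdd (TScale c t) (TScale d t))"
| scale_add_right: "c \<in> carrier K \<Longrightarrow> tensor_wf K V W s \<Longrightarrow> tensor_wf K V W t
    \<Longrightarrow> tensor_eq K V W (TScale c (TAdd s t)) (TAdd (TScale c s) (TScale c t))"
| scale_scale: "c \<in> carrier K \<Longrightarrow> d \<in> carrier K \<Longrightarrow> tensor_wf K V W t
    \<Longrightarrow> tensor_eq K V W (TScale (c \<otimes>\<^bsub>K\<^esub> d) t) (TScale c (TScale d t))"
| scale_one: "tensor_wf K V W t \<Longrightarrow> tensor_eq K V W (TScale \<one>\<^bsub>K\<^esub> t) t"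
| pure_add_left: "v \<in> carrier V \<Longrightarrow> v' \<in> carrier V \<Longrightarrow> w \<in> carrier W
    \<Longrightarrow> tensor_eq K V W (TPure (v \<oplus>\<^bsub>V\<^esub> v') w) (TAdd (TPure v w) (TPure v' w))"
| pure_add_right: "v \<in> carrier V \<Longrightarrow> w \<in> carrier W \<Longrightarrow> w' \<in> carrier W
    \<Longrightarrow> tensor_eq K V W (TPure v (w \<oplus>\<^bsub>W\<^esub> w')) (TAdd (TPure v w) (TPure v w'))"
| pure_scale_left: "c \<in> carrier K \<Longrightarrow> v \<in> carrier V \<Longrightarrow> w \<in> carrier W
    \<Longrightarrow> tensor_eq K V W (TPure (c \<odot>\<^bsub>V\<^esub> v) w) (TScale c (TPure v w))"
| pure_scale_right: "c \<in> carrier K \<Longrightarrow> v \<in> carrier V \<Longrightarrow> w \<in> carrier W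
    \<Longrightarrow> tensor_eq K V W (TPure v (c \<odot>\<^bsub>W\<^esub> w)) (TScale c (TPure v w))"

definition tensor_class ::
    "('k, 'q) ring_scheme \<Rightarrow> ('k, 'a, 'm) module_scheme \<Rightarrow> ('k, 'b, 'n) module_scheme
      \<Rightarrow> ('k, 'a, 'b) tensor_term \<Rightarrow> ('k, 'a, 'b) tensor_term set" where
  "tensor_class K V W t = {s. tensor_eq K V W t s}"

definition tensor ::
    "('k, 'q) ring_scheme \<Rightarrow> ('k, 'a, 'm) module_scheme \<Rightarrow> ('k, 'b, 'n) module_scheme
      \<Rightarrow> ('k, ('k, 'a, 'b) tensor_term set) module" where
  "tensor K V W =
     \<lparr>carrier = tensor_class K V W ` {t. tensor_wf K V W t},
      mult = undefined, one = undefined,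
      zero = tensor_class K V W TZero,
      add = (\<lambda>X Y. \<Union>s\<in>X. \<Union>t\<in>Y. tensor_class K V W (TAdd s t)),
      smult = (\<lambda>c X. \<Union>t\<in>X. tensor_class K V W (TScale c t))\<rparr>"

definition pure ::
    "('k, 'q) ring_scheme \<Rightarrow> ('k, 'a, 'm) module_scheme \<Rightarrow> ('k, 'b, 'n) module_scheme
      \<Rightarrow> 'a \<Rightarrow> 'b \<Rightarrow> ('k, 'a, 'b) tensor_term set" where
  "pure K V W v w = tensor_class K V W (TPure v w)"

primrec tensor_eval ::
    "('k, 'c, 'n) module_scheme \<Rightarrow> ('a \<Rightarrow> 'b \<Rightarrow> 'c) \<Rightarrow> ('k, 'a, 'b) tensor_term \<Rightarrow> 'c" where
  "tensor_eval U \<beta> TZero = \<zero>\<^bsub>U\<^esub>"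
| "tensor_eval U \<beta> (TPure v w) = \<beta> v w"
| "tensor_eval U \<beta> (TAdd s t) = tensor_eval U \<beta> s \<oplus>\<^bsub>U\<^esub> tensor_eval U \<beta> t"
| "tensor_eval U \<beta> (TScale c t) = c \<odot>\<^bsub>U\<^esub> tensor_eval U \<beta> t"

text \<open>
  For a bilinear \<open>\<beta>\<close>, this is the linear map sending \<open>pure v w\<close> to \<open>\<beta> v w\<close>; see \<open>tensor_universal\<close>
  below.
\<close>

definition tensor_lift ::
    "('k, 'c, 'n) module_scheme \<Rightarrow> ('a \<Rightarrow> 'b \<Rightarrow> 'c) \<Rightarrow> ('k, 'a, 'b) tensor_term set \<Rightarrow> 'c" where
  "tensor_lift U \<beta> X = the_elem (tensor_eval U \<beta> ` X)"

definition tensor_lift2 ::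
    "('k, 'e, 'n) module_scheme \<Rightarrow> ('a \<Rightarrow> 'b \<Rightarrow> 'c \<Rightarrow> 'd \<Rightarrow> 'e)
      \<Rightarrow> ('k, 'a, 'b) tensor_term set \<Rightarrow> ('k, 'c, 'd) tensor_term set \<Rightarrow> 'e" where
  "tensor_lift2 U \<beta> X Y = tensor_lift U (\<lambda>a b. tensor_lift U (\<lambda>c d. \<beta> a b c d) Y) X"

definition tensor_map ::
    "('k, 'q) ring_scheme \<Rightarrow> ('k, 'c, 'm) module_scheme \<Rightarrow> ('k, 'd, 'n) module_scheme
      \<Rightarrow> ('a \<Rightarrow> 'c) \<Rightarrow> ('b \<Rightarrow> 'd) \<Rightarrow> ('k, 'a, 'b) tensor_term set \<Rightarrow> ('k, 'c, 'd) tensor_term set" where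
  "tensor_map K V' W' f g = tensor_lift (tensor K V' W') (\<lambda>v w. pure K V' W' (f v) (g w))"

definition tensor_assoc ::
    "('k, 'q) ring_scheme \<Rightarrow> ('k, 'a, 'l) module_scheme \<Rightarrow> ('k, 'b, 'm) module_scheme
      \<Rightarrow> ('k, 'c, 'n) module_scheme
      \<Rightarrow> ('k, ('k, 'a, 'b) tensor_term set, 'c) tensor_term set
      \<Rightarrow> ('k, 'a, ('k, 'b, 'c) tensor_term set) tensor_term set" where
  "tensor_assoc K U V W =
     (let T = tensor K U (tensor K V W)
      in tensor_lift T (\<lambda>X w. tensor_lift T (\<lambda>u v. pure K U (tensor K V W) u (pure K V W v w)) X))"

definition tensor_swap ::
    "('k, 'q) ring_scheme \<Rightarrow> ('k, 'a, 'm) module_scheme \<Rightarrow> ('k, 'b, 'n) module_scheme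
      \<Rightarrow> ('k, 'a, 'b) tensor_term set \<Rightarrow> ('k, 'b, 'a) tensor_term set" where
  "tensor_swap K V W = tensor_lift (tensor K W V) (\<lambda>v w. pure K W V w v)"


section \<open>2-algebras\<close>

text \<open>The fields \<open>mult\<close> and \<open>one\<close> of the record give the first multiplication and the common unit.\<close>

record ('k, 'a) two_algebra = "('k, 'a) module" +
  dmult :: "'a \<Rightarrow> 'a \<Rightarrow> 'a" (infixl \<open>\<diamondop>\<index>\<close> 70)

definition diamond :: "('k, 'a, 'm) two_algebra_scheme \<Rightarrow> ('k, 'a, 'm) two_algebra_scheme" where
  "diamond A = A\<lparr>mult := dmult A\<rparr>"

text \<open>The library's locale \<^locale>\<open>algebra\<close> is about commutative algebras only.\<close>

locale assoc_algebra = field K + module K A + ring A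
  for K :: "('k, 'q) ring_scheme" and A :: "('k, 'a, 'm) module_scheme" +
  assumes smult_mult_left: "c \<in> carrier K \<Longrightarrow> x \<in> carrier A \<Longrightarrow> y \<in> carrier A
      \<Longrightarrow> (c \<odot>\<^bsub>A\<^esub> x) \<otimes>\<^bsub>A\<^esub> y = c \<odot>\<^bsub>A\<^esub> (x \<otimes>\<^bsub>A\<^esub> y)"
    and smult_mult_right: "c \<in> carrier K \<Longrightarrow> x \<in> carrier A \<Longrightarrow> y \<in> carrier A
      \<Longrightarrow> x \<otimes>\<^bsub>A\<^esub> (c \<odot>\<^bsub>A\<^esub> y) = c \<odot>\<^bsub>A\<^esub> (x \<otimes>\<^bsub>A\<^esub> y)"

definition two_algebra ::
    "('k, 'q) ring_scheme \<Rightarrow> ('k, 'a, 'm) two_algebra_scheme \<Rightarrow> bool" where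
  "two_algebra K A \<longleftrightarrow> assoc_algebra K A \<and> assoc_algebra K (diamond A)"

definition two_algebra_hom ::
    "('k, 'q) ring_scheme \<Rightarrow> ('k, 'a, 'm) two_algebra_scheme \<Rightarrow> ('k, 'b, 'n) two_algebra_scheme
      \<Rightarrow> ('a \<Rightarrow> 'b) \<Rightarrow> bool" where
  "two_algebra_hom K A B f \<longleftrightarrow>
     linear_map K A B f \<and> f \<in> ring_hom A B \<and> f \<in> ring_hom (diamond A) (diamond B)"

definition scalars :: "('k, 'q) ring_scheme \<Rightarrow> ('k, 'k) two_algebra" where
  "scalars K =
     \<lparr>carrier = carrier K, mult = (\<otimes>\<^bsub>K\<^esub>), one = \<one>\<^bsub>K\<^esub>, zero = \<zero>\<^bsub>K\<^esub>, add = (\<oplus>\<^bsub>K\<^esub>),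
      smult = (\<otimes>\<^bsub>K\<^esub>), dmult = (\<otimes>\<^bsub>K\<^esub>)\<rparr>"

definition tensor_two_algebra ::
    "('k, 'q) ring_scheme \<Rightarrow> ('k, 'a, 'm) two_algebra_scheme \<Rightarrow> ('k, 'b, 'n) two_algebra_scheme
      \<Rightarrow> ('k, ('k, 'a, 'b) tensor_term set) two_algebra" where
  "tensor_two_algebra K A B =
     \<lparr>carrier = carrier (tensor K A B),
      mult = tensor_lift2 (tensor K A B) (\<lambda>a b a' b'. pure K A B (a \<otimes>\<^bsub>A\<^esub> a') (b \<otimes>\<^bsub>B\<^esub> b')),
      one = pure K A B \<one>\<^bsub>A\<^esub> \<one>\<^bsub>B\<^esub>,
      zero = \<zero>\<^bsub>tensor K A B\<^esub>,
      add = (\<oplus>\<^bsub>tensor K A B\<^esub>),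
      smult = (\<odot>\<^bsub>tensor K A B\<^esub>),
      dmult = tensor_lift2 (tensor K A B) (\<lambda>a b a' b'. pure K A B (a \<diamondop>\<^bsub>A\<^esub> a') (b \<diamondop>\<^bsub>B\<^esub> b'))\<rparr>"


section \<open>Coalgebras and 2-bialgebras\<close>

locale coalgebra = field K + module K V
  for K :: "('k, 'q) ring_scheme" and V :: "('k, 'a, 'm) module_scheme" +
  fixes \<Delta> :: "'a \<Rightarrow> ('k, 'a, 'a) tensor_term set" and \<epsilon> :: "'a \<Rightarrow> 'k"
  assumes comult_linear: "linear_map K V (tensor K V V) \<Delta>"
    and counit_linear: "linear_map K V (scalars K) \<epsilon>"
    and coassoc: "x \<in> carrier V \<Longrightarrow>
      tensor_assoc K V V V (tensor_map K (tensor K V V) V \<Delta> id (\<Delta> x)) =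
      tensor_map K V (tensor K V V) id \<Delta> (\<Delta> x)"
    and counit_left: "x \<in> carrier V \<Longrightarrow> tensor_lift V (\<lambda>v w. \<epsilon> v \<odot>\<^bsub>V\<^esub> w) (\<Delta> x) = x"
    and counit_right: "x \<in> carrier V \<Longrightarrow> tensor_lift V (\<lambda>v w. \<epsilon> w \<odot>\<^bsub>V\<^esub> v) (\<Delta> x) = x"

definition cocommutative ::
    "('k, 'q) ring_scheme \<Rightarrow> ('k, 'a, 'm) module_scheme \<Rightarrow> ('a \<Rightarrow> ('k, 'a, 'a) tensor_term set)
      \<Rightarrow> bool" where
  "cocommutative K V \<Delta> \<longleftrightarrow> (\<forall>x\<in>carrier V. tensor_swap K V V (\<Delta> x) = \<Delta> x)"

definition coalgebra_hom ::
    "('k, 'q) ring_scheme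
      \<Rightarrow> ('k, 'a, 'm) module_scheme \<Rightarrow> ('a \<Rightarrow> ('k, 'a, 'a) tensor_term set) \<Rightarrow> ('a \<Rightarrow> 'k)
      \<Rightarrow> ('k, 'b, 'n) module_scheme \<Rightarrow> ('b \<Rightarrow> ('k, 'b, 'b) tensor_term set) \<Rightarrow> ('b \<Rightarrow> 'k)
      \<Rightarrow> ('a \<Rightarrow> 'b) \<Rightarrow> bool" where
  "coalgebra_hom K V \<Delta> \<epsilon> V' \<Delta>' \<epsilon>' f \<longleftrightarrow>
     linear_map K V V' f \<and>
     (\<forall>x\<in>carrier V. \<Delta>' (f x) = tensor_map K V' V' f f (\<Delta> x)) \<and>
     (\<forall>x\<in>carrier V. \<epsilon>' (f x) = \<epsilon> x)"

text \<open>The coalgebra structures on \<open>K\<close> and on the tensor product of two coalgebras.\<close>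

definition scalars_comult ::
    "('k, 'q) ring_scheme \<Rightarrow> 'k \<Rightarrow> ('k, 'k, 'k) tensor_term set" where
  "scalars_comult K c = pure K (scalars K) (scalars K) c \<one>\<^bsub>K\<^esub>"

definition tensor_comult ::
    "('k, 'q) ring_scheme \<Rightarrow> ('k, 'a, 'm) module_scheme \<Rightarrow> ('k, 'b, 'n) module_scheme
      \<Rightarrow> ('a \<Rightarrow> ('k, 'a, 'a) tensor_term set) \<Rightarrow> ('b \<Rightarrow> ('k, 'b, 'b) tensor_term set)
      \<Rightarrow> ('k, 'a, 'b) tensor_term set
      \<Rightarrow> ('k, ('k, 'a, 'b) tensor_term set, ('k, 'a, 'b) tensor_term set) tensor_term set" where
  "tensor_comult K V W \<Delta> \<Delta>' =
     (let T = tensor K V W; TT = tensor K T T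
      in tensor_lift TT (\<lambda>v w.
           tensor_lift2 TT (\<lambda>v1 v2 w1 w2. pure K T T (pure K V W v1 w1) (pure K V W v2 w2))
             (\<Delta> v) (\<Delta>' w)))"

definition tensor_counit ::
    "('k, 'q) ring_scheme \<Rightarrow> ('a \<Rightarrow> 'k) \<Rightarrow> ('b \<Rightarrow> 'k) \<Rightarrow> ('k, 'a, 'b) tensor_term set \<Rightarrow> 'k" where
  "tensor_counit K \<epsilon> \<epsilon>' = tensor_lift (scalars K) (\<lambda>v w. \<epsilon> v \<otimes>\<^bsub>K\<^esub> \<epsilon>' w)"

definition two_bialgebra ::
    "('k, 'q) ring_scheme \<Rightarrow> ('k, 'a, 'm) two_algebra_scheme
      \<Rightarrow> ('a \<Rightarrow> ('k, 'a, 'a) tensor_term set) \<Rightarrow> ('a \<Rightarrow> 'k) \<Rightarrow> bool" where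
  "two_bialgebra K A \<Delta> \<epsilon> \<longleftrightarrow>
     two_algebra K A \<and> coalgebra K A \<Delta> \<epsilon> \<and>
     coalgebra_hom K (scalars K) (scalars_comult K) id A \<Delta> \<epsilon> (\<lambda>c. c \<odot>\<^bsub>A\<^esub> \<one>\<^bsub>A\<^esub>) \<and>
     coalgebra_hom K (tensor K A A) (tensor_comult K A A \<Delta> \<Delta>) (tensor_counit K \<epsilon> \<epsilon>) A \<Delta> \<epsilon>
       (tensor_lift A (\<otimes>\<^bsub>A\<^esub>)) \<and>
     coalgebra_hom K (tensor K A A) (tensor_comult K A A \<Delta> \<Delta>) (tensor_counit K \<epsilon> \<epsilon>) A \<Delta> \<epsilon>
       (tensor_lift A (\<diamondop>\<^bsub>A\<^esub>))"

definition two_bialgebra_hom ::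
    "('k, 'q) ring_scheme
      \<Rightarrow> ('k, 'a, 'm) two_algebra_scheme \<Rightarrow> ('a \<Rightarrow> ('k, 'a, 'a) tensor_term set) \<Rightarrow> ('a \<Rightarrow> 'k)
      \<Rightarrow> ('k, 'b, 'n) two_algebra_scheme \<Rightarrow> ('b \<Rightarrow> ('k, 'b, 'b) tensor_term set) \<Rightarrow> ('b \<Rightarrow> 'k)
      \<Rightarrow> ('a \<Rightarrow> 'b) \<Rightarrow> bool" where
  "two_bialgebra_hom K A \<Delta> \<epsilon> B \<Delta>' \<epsilon>' f \<longleftrightarrow>
     coalgebra_hom K A \<Delta> \<epsilon> B \<Delta>' \<epsilon>' f \<and> two_algebra_hom K A B f"

definition coideal ::
    "('k, 'q) ring_scheme \<Rightarrow> ('k, 'a, 'm) module_scheme \<Rightarrow> ('a \<Rightarrow> ('k, 'a, 'a) tensor_term set)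
      \<Rightarrow> ('a \<Rightarrow> 'k) \<Rightarrow> 'a set \<Rightarrow> bool" where
  "coideal K V \<Delta> \<epsilon> L \<longleftrightarrow>
     submodule L K V \<and>
     \<Delta> ` L \<subseteq> linear_span K (tensor K V V)
       ({pure K V V x y | x y. x \<in> L \<and> y \<in> carrier V} \<union>
        {pure K V V x y | x y. x \<in> carrier V \<and> y \<in> L}) \<and>
     (\<forall>x\<in>L. \<epsilon> x = \<zero>\<^bsub>K\<^esub>)"

definition quotient_two_algebra ::
    "('k, 'a, 'm) two_algebra_scheme \<Rightarrow> 'a set \<Rightarrow> ('k, 'a set) two_algebra" where
  "quotient_two_algebra A L =
     \<lparr>carrier = a_rcosets\<^bsub>A\<^esub> L, mult = rcoset_mult A L, one = L +>\<^bsub>A\<^esub> \<one>\<^bsub>A\<^esub>, zero = L,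
      add = set_add A, smult = (\<lambda>c X. \<Union>x\<in>X. L +>\<^bsub>A\<^esub> (c \<odot>\<^bsub>A\<^esub> x)),
      dmult = rcoset_mult (diamond A) L\<rparr>"

definition quotient_comult ::
    "('k, 'q) ring_scheme \<Rightarrow> ('k, 'a, 'm) two_algebra_scheme
      \<Rightarrow> ('a \<Rightarrow> ('k, 'a, 'a) tensor_term set) \<Rightarrow> 'a set
      \<Rightarrow> 'a set \<Rightarrow> ('k, 'a set, 'a set) tensor_term set" where
  "quotient_comult K A \<Delta> L X =
     (let Q = quotient_two_algebra A L
      in the_elem ((\<lambda>x. tensor_map K Q Q (\<lambda>y. L +>\<^bsub>A\<^esub> y) (\<lambda>y. L +>\<^bsub>A\<^esub> y) (\<Delta> x)) ` X))"

definition quotient_counit :: "('a \<Rightarrow> 'k) \<Rightarrow> 'a set \<Rightarrow> 'k" where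
  "quotient_counit \<epsilon> X = the_elem (\<epsilon> ` X)"


section \<open>Direct sums of coalgebras\<close>

definition dsum :: "'i set \<Rightarrow> ('i \<Rightarrow> ('k, 'a, 'm) module_scheme) \<Rightarrow> ('k, 'i \<Rightarrow> 'a) module" where
  "dsum I B =
     \<lparr>carrier = {f \<in> \<Pi>\<^sub>E l\<in>I. carrier (B l). finite {l \<in> I. f l \<noteq> \<zero>\<^bsub>B l\<^esub>}},
      mult = undefined, one = undefined,
      zero = (\<lambda>l\<in>I. \<zero>\<^bsub>B l\<^esub>),
      add = (\<lambda>f g. \<lambda>l\<in>I. f l \<oplus>\<^bsub>B l\<^esub> g l),
      smult = (\<lambda>c f. \<lambda>l\<in>I. c \<odot>\<^bsub>B l\<^esub> f l)\<rparr>"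

definition dsum_inj :: "'i set \<Rightarrow> ('i \<Rightarrow> ('k, 'a, 'm) module_scheme) \<Rightarrow> 'i \<Rightarrow> 'a \<Rightarrow> 'i \<Rightarrow> 'a" where
  "dsum_inj I B t x = (\<lambda>l\<in>I. if l = t then x else \<zero>\<^bsub>B l\<^esub>)"

definition dsum_comult ::
    "('k, 'q) ring_scheme \<Rightarrow> 'i set \<Rightarrow> ('i \<Rightarrow> ('k, 'a, 'm) module_scheme)
      \<Rightarrow> ('i \<Rightarrow> 'a \<Rightarrow> ('k, 'a, 'a) tensor_term set)
      \<Rightarrow> ('i \<Rightarrow> 'a) \<Rightarrow> ('k, 'i \<Rightarrow> 'a, 'i \<Rightarrow> 'a) tensor_term set" where
  "dsum_comult K I B \<Delta> f =
     (let V = dsum I B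
      in \<Oplus>\<^bsub>tensor K V V\<^esub> l \<in> {l \<in> I. f l \<noteq> \<zero>\<^bsub>B l\<^esub>}.
           tensor_map K V V (dsum_inj I B l) (dsum_inj I B l) (\<Delta> l (f l)))"

definition dsum_counit ::
    "('k, 'q) ring_scheme \<Rightarrow> 'i set \<Rightarrow> ('i \<Rightarrow> ('k, 'a, 'm) module_scheme)
      \<Rightarrow> ('i \<Rightarrow> 'a \<Rightarrow> 'k) \<Rightarrow> ('i \<Rightarrow> 'a) \<Rightarrow> 'k" where
  "dsum_counit K I B \<epsilon> f = (\<Oplus>\<^bsub>K\<^esub> l \<in> {l \<in> I. f l \<noteq> \<zero>\<^bsub>B l\<^esub>}. \<epsilon> l (f l))"


section \<open>The free 2-algebra on a vector space\<close>

text \<open>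
  Formal expressions with generators in \<open>V\<close>, modulo the smallest congruence satisfying the axioms of
  2-algebras and making the inclusion of generators linear. Its universal property is
  \<open>free_two_algebra_universal\<close> below.
\<close>

datatype ('k, 'v) free_term =
    FGen 'v
  | FZero
  | FOne
  | FAdd "('k, 'v) free_term" "('k, 'v) free_term"
  | FScale 'k "('k, 'v) free_term"
  | FMul "('k, 'v) free_term" "('k, 'v) free_term"
  | FDia "('k, 'v) free_term" "('k, 'v) free_term"

primrec free_wf ::
    "('k, 'q) ring_scheme \<Rightarrow> ('k, 'v, 'm) module_scheme \<Rightarrow> ('k, 'v) free_term \<Rightarrow> bool" where
  "free_wf K V (FGen v) = (v \<in> carrier V)"
| "free_wf K V FZero = True"
| "free_wf K V FOne = True"
| "free_wf K V (FAdd s t) = (free_wf K V s \<and> free_wf K V t)"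
| "free_wf K V (FScale c t) = (c \<in> carrier K \<and> free_wf K V t)"
| "free_wf K V (FMul s t) = (free_wf K V s \<and> free_wf K V t)"
| "free_wf K V (FDia s t) = (free_wf K V s \<and> free_wf K V t)"

inductive free_eq ::
    "('k, 'q) ring_scheme \<Rightarrow> ('k, 'v, 'm) module_scheme
      \<Rightarrow> ('k, 'v) free_term \<Rightarrow> ('k, 'v) free_term \<Rightarrow> bool"
  for K V where
  refl: "free_wf K V t \<Longrightarrow> free_eq K V t t"
| sym: "free_eq K V s t \<Longrightarrow> free_eq K V t s"
| trans: "free_eq K V r s \<Longrightarrow> free_eq K V s t \<Longrightarrow> free_eq K V r t"
| add_cong: "free_eq K V s s' \<Longrightarrow> free_eq K V t t' \<Longrightarrow> free_eq K V (FAdd s t) (FAdd s' t')"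
| scale_cong: "c \<in> carrier K \<Longrightarrow> free_eq K V t t' \<Longrightarrow> free_eq K V (FScale c t) (FScale c t')"
| mul_cong: "free_eq K V s s' \<Longrightarrow> free_eq K V t t' \<Longrightarrow> free_eq K V (FMul s t) (FMul s' t')"
| dia_cong: "free_eq K V s s' \<Longrightarrow> free_eq K V t t' \<Longrightarrow> free_eq K V (FDia s t) (FDia s' t')"
| add_assoc: "free_wf K V r \<Longrightarrow> free_wf K V s \<Longrightarrow> free_wf K V t
    \<Longrightarrow> free_eq K V (FAdd (FAdd r s) t) (FAdd r (FAdd s t))"
| add_comm: "free_wf K V s \<Longrightarrow> free_wf K V t \<Longrightarrow> free_eq K V (FAdd s t) (FAdd t s)"
| add_zero: "free_wf K V t \<Longrightarrow> free_eq K V (FAdd FZero t) t"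
| add_neg: "free_wf K V t \<Longrightarrow> free_eq K V (FAdd (FScale (\<ominus>\<^bsub>K\<^esub> \<one>\<^bsub>K\<^esub>) t) t) FZero"
| scale_add_left: "c \<in> carrier K \<Longrightarrow> d \<in> carrier K \<Longrightarrow> free_wf K V t
    \<Longrightarrow> free_eq K V (FScale (c \<oplus>\<^bsub>K\<^esub> d) t) (FAdd (FScale c t) (FScale d t))"
| scale_add_right: "c \<in> carrier K \<Longrightarrow> free_wf K V s \<Longrightarrow> free_wf K V t
    \<Longrightarrow> free_eq K V (FScale c (FAdd s t)) (FAdd (FScale c s) (FScale c t))"
| scale_scale: "c \<in> carrier K \<Longrightarrow> d \<in> carrier K \<Longrightarrow> free_wf K V t
    \<Longrightarrow> free_eq K V (FScale (c \<otimes>\<^bsub>K\<^esub> d) t) (FScale c (FScale d t))"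
| scale_one: "free_wf K V t \<Longrightarrow> free_eq K V (FScale \<one>\<^bsub>K\<^esub> t) t"
| gen_add: "v \<in> carrier V \<Longrightarrow> w \<in> carrier V
    \<Longrightarrow> free_eq K V (FGen (v \<oplus>\<^bsub>V\<^esub> w)) (FAdd (FGen v) (FGen w))"
| gen_scale: "c \<in> carrier K \<Longrightarrow> v \<in> carrier V
    \<Longrightarrow> free_eq K V (FGen (c \<odot>\<^bsub>V\<^esub> v)) (FScale c (FGen v))"
| mul_assoc: "free_wf K V r \<Longrightarrow> free_wf K V s \<Longrightarrow> free_wf K V t
    \<Longrightarrow> free_eq K V (FMul (FMul r s) t) (FMul r (FMul s t))"
| mul_one_left: "free_wf K V t \<Longrightarrow> free_eq K V (FMul FOne t) t"
| mul_one_right: "free_wf K V t \<Longrightarrow> free_eq K V (FMul t FOne) t"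
| mul_add_left: "free_wf K V r \<Longrightarrow> free_wf K V s \<Longrightarrow> free_wf K V t
    \<Longrightarrow> free_eq K V (FMul (FAdd r s) t) (FAdd (FMul r t) (FMul s t))"
| mul_add_right: "free_wf K V r \<Longrightarrow> free_wf K V s \<Longrightarrow> free_wf K V t
    \<Longrightarrow> free_eq K V (FMul r (FAdd s t)) (FAdd (FMul r s) (FMul r t))"
| mul_scale_left: "c \<in> carrier K \<Longrightarrow> free_wf K V s \<Longrightarrow> free_wf K V t
    \<Longrightarrow> free_eq K V (FMul (FScale c s) t) (FScale c (FMul s t))"
| mul_scale_right: "c \<in> carrier K \<Longrightarrow> free_wf K V s \<Longrightarrow> free_wf K V t
    \<Longrightarrow> free_eq K V (FMul s (FScale c t)) (FScale c (FMul s t))"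
| dia_assoc: "free_wf K V r \<Longrightarrow> free_wf K V s \<Longrightarrow> free_wf K V t
    \<Longrightarrow> free_eq K V (FDia (FDia r s) t) (FDia r (FDia s t))"
| dia_one_left: "free_wf K V t \<Longrightarrow> free_eq K V (FDia FOne t) t"
| dia_one_right: "free_wf K V t \<Longrightarrow> free_eq K V (FDia t FOne) t"
| dia_add_left: "free_wf K V r \<Longrightarrow> free_wf K V s \<Longrightarrow> free_wf K V t
    \<Longrightarrow> free_eq K V (FDia (FAdd r s) t) (FAdd (FDia r t) (FDia s t))"
| dia_add_right: "free_wf K V r \<Longrightarrow> free_wf K V s \<Longrightarrow> free_wf K V t
    \<Longrightarrow> free_eq K V (FDia r (FAdd s t)) (FAdd (FDia r s) (FDia r t))"
| dia_scale_left: "c \<in> carrier K \<Longrightarrow> free_wf K V s \<Longrightarrow> free_wf K V t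
    \<Longrightarrow> free_eq K V (FDia (FScale c s) t) (FScale c (FDia s t))"
| dia_scale_right: "c \<in> carrier K \<Longrightarrow> free_wf K V s \<Longrightarrow> free_wf K V t
    \<Longrightarrow> free_eq K V (FDia s (FScale c t)) (FScale c (FDia s t))"

definition free_class ::
    "('k, 'q) ring_scheme \<Rightarrow> ('k, 'v, 'm) module_scheme
      \<Rightarrow> ('k, 'v) free_term \<Rightarrow> ('k, 'v) free_term set" where
  "free_class K V t = {s. free_eq K V t s}"

definition free_two_algebra ::
    "('k, 'q) ring_scheme \<Rightarrow> ('k, 'v, 'm) module_scheme
      \<Rightarrow> ('k, ('k, 'v) free_term set) two_algebra" where
  "free_two_algebra K V =
     \<lparr>carrier = free_class K V ` {t. free_wf K V t},
      mult = (\<lambda>X Y. \<Union>s\<in>X. \<Union>t\<in>Y. free_class K V (FMul s t)),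
      one = free_class K V FOne,
      zero = free_class K V FZero,
      add = (\<lambda>X Y. \<Union>s\<in>X. \<Union>t\<in>Y. free_class K V (FAdd s t)),
      smult = (\<lambda>c X. \<Union>t\<in>X. free_class K V (FScale c t)),
      dmult = (\<lambda>X Y. \<Union>s\<in>X. \<Union>t\<in>Y. free_class K V (FDia s t))\<rparr>"

definition free_inj ::
    "('k, 'q) ring_scheme \<Rightarrow> ('k, 'v, 'm) module_scheme \<Rightarrow> 'v \<Rightarrow> ('k, 'v) free_term set" where
  "free_inj K V v = free_class K V (FGen v)"

primrec free_eval ::
    "('k, 'a, 'n) two_algebra_scheme \<Rightarrow> ('v \<Rightarrow> 'a) \<Rightarrow> ('k, 'v) free_term \<Rightarrow> 'a" where
  "free_eval A f (FGen v) = f v"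
| "free_eval A f FZero = \<zero>\<^bsub>A\<^esub>"
| "free_eval A f FOne = \<one>\<^bsub>A\<^esub>"
| "free_eval A f (FAdd s t) = free_eval A f s \<oplus>\<^bsub>A\<^esub> free_eval A f t"
| "free_eval A f (FScale c t) = c \<odot>\<^bsub>A\<^esub> free_eval A f t"
| "free_eval A f (FMul s t) = free_eval A f s \<otimes>\<^bsub>A\<^esub> free_eval A f t"
| "free_eval A f (FDia s t) = free_eval A f s \<diamondop>\<^bsub>A\<^esub> free_eval A f t"

text \<open>
  For a linear \<open>f\<close> from \<open>V\<close> to a 2-algebra \<open>A\<close>, this is the unique morphism of 2-algebras extending
  \<open>f\<close>; see \<open>free_two_algebra_universal\<close> below.
\<close>

definition free_lift ::
    "('k, 'a, 'n) two_algebra_scheme \<Rightarrow> ('v \<Rightarrow> 'a) \<Rightarrow> ('k, 'v) free_term set \<Rightarrow> 'a" where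
  "free_lift A f X = the_elem (free_eval A f ` X)"

definition free_comult ::
    "('k, 'q) ring_scheme \<Rightarrow> ('k, 'v, 'm) module_scheme \<Rightarrow> ('v \<Rightarrow> ('k, 'v, 'v) tensor_term set)
      \<Rightarrow> ('k, 'v) free_term set
      \<Rightarrow> ('k, ('k, 'v) free_term set, ('k, 'v) free_term set) tensor_term set" where
  "free_comult K V \<Delta> =
     (let F = free_two_algebra K V; i = free_inj K V
      in free_lift (tensor_two_algebra K F F) (\<lambda>v. tensor_map K F F i i (\<Delta> v)))"

definition free_counit ::
    "('k, 'q) ring_scheme \<Rightarrow> ('v \<Rightarrow> 'k) \<Rightarrow> ('k, 'v) free_term set \<Rightarrow> 'k" where
  "free_counit K \<epsilon> = free_lift (scalars K) \<epsilon>"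


section \<open>The ideals and the coproduct\<close>

primrec ideal_chain ::
    "('k, 'q) ring_scheme \<Rightarrow> 'i set \<Rightarrow> ('i \<Rightarrow> ('k, 'b, 'm) two_algebra_scheme)
      \<Rightarrow> ('k, 'f, 'n) two_algebra_scheme \<Rightarrow> ('i \<Rightarrow> 'b \<Rightarrow> 'f) \<Rightarrow> nat \<Rightarrow> 'f set" where
  "ideal_chain K I B F u 0 = linear_span K F
     (\<Union>t\<in>I.
        {\<one>\<^bsub>F\<^esub> \<ominus>\<^bsub>F\<^esub> u t \<one>\<^bsub>B t\<^esub>} \<union>
        {u t (x \<otimes>\<^bsub>B t\<^esub> x') \<ominus>\<^bsub>F\<^esub> u t x \<otimes>\<^bsub>F\<^esub> u t x' | x x'. x \<in> carrier (B t) \<and> x' \<in> carrier (B t)} \<union>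
        {u t (x \<diamondop>\<^bsub>B t\<^esub> x') \<ominus>\<^bsub>F\<^esub> u t x \<diamondop>\<^bsub>F\<^esub> u t x' | x x'. x \<in> carrier (B t) \<and> x' \<in> carrier (B t)})"
| "ideal_chain K I B F u (Suc n) =
     (if odd (Suc n) then genideal F (ideal_chain K I B F u n)
      else genideal (diamond F) (ideal_chain K I B F u n))"

text \<open>
  The universal properties below are tested on objects with carriers in the type \<open>'c\<close>; a statement
  that leaves \<open>'c\<close> arbitrary covers all objects of the category.
\<close>

definition two_bialgebra_coproduct ::
    "'c itself \<Rightarrow> ('k, 'q) ring_scheme \<Rightarrow> 'i set \<Rightarrow> ('i \<Rightarrow> ('k, 'b) two_algebra)
      \<Rightarrow> ('i \<Rightarrow> 'b \<Rightarrow> ('k, 'b, 'b) tensor_term set) \<Rightarrow> ('i \<Rightarrow> 'b \<Rightarrow> 'k)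
      \<Rightarrow> ('k, 'a) two_algebra \<Rightarrow> ('a \<Rightarrow> ('k, 'a, 'a) tensor_term set) \<Rightarrow> ('a \<Rightarrow> 'k)
      \<Rightarrow> ('i \<Rightarrow> 'b \<Rightarrow> 'a) \<Rightarrow> bool" where
  "two_bialgebra_coproduct _ K I B \<Delta> \<epsilon> Q \<Delta>\<^sub>Q \<epsilon>\<^sub>Q q \<longleftrightarrow>
     two_bialgebra K Q \<Delta>\<^sub>Q \<epsilon>\<^sub>Q \<and>
     (\<forall>t\<in>I. two_bialgebra_hom K (B t) (\<Delta> t) (\<epsilon> t) Q \<Delta>\<^sub>Q \<epsilon>\<^sub>Q (q t)) \<and>
     (\<forall>(C :: ('k, 'c) two_algebra) \<Delta>\<^sub>C \<epsilon>\<^sub>C f.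
        two_bialgebra K C \<Delta>\<^sub>C \<epsilon>\<^sub>C \<longrightarrow>
        (\<forall>t\<in>I. two_bialgebra_hom K (B t) (\<Delta> t) (\<epsilon> t) C \<Delta>\<^sub>C \<epsilon>\<^sub>C (f t)) \<longrightarrow>
        (\<exists>!g. g \<in> extensional (carrier Q) \<and> two_bialgebra_hom K Q \<Delta>\<^sub>Q \<epsilon>\<^sub>Q C \<Delta>\<^sub>C \<epsilon>\<^sub>C g \<and>
           (\<forall>t\<in>I. \<forall>x\<in>carrier (B t). g (q t x) = f t x)))"

definition cocommutative_two_bialgebra_coproduct ::
    "'c itself \<Rightarrow> ('k, 'q) ring_scheme \<Rightarrow> 'i set \<Rightarrow> ('i \<Rightarrow> ('k, 'b) two_algebra)
      \<Rightarrow> ('i \<Rightarrow> 'b \<Rightarrow> ('k, 'b, 'b) tensor_term set) \<Rightarrow> ('i \<Rightarrow> 'b \<Rightarrow> 'k)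
      \<Rightarrow> ('k, 'a) two_algebra \<Rightarrow> ('a \<Rightarrow> ('k, 'a, 'a) tensor_term set) \<Rightarrow> ('a \<Rightarrow> 'k)
      \<Rightarrow> ('i \<Rightarrow> 'b \<Rightarrow> 'a) \<Rightarrow> bool" where
  "cocommutative_two_bialgebra_coproduct _ K I B \<Delta> \<epsilon> Q \<Delta>\<^sub>Q \<epsilon>\<^sub>Q q \<longleftrightarrow>
     two_bialgebra K Q \<Delta>\<^sub>Q \<epsilon>\<^sub>Q \<and> cocommutative K Q \<Delta>\<^sub>Q \<and>
     (\<forall>t\<in>I. two_bialgebra_hom K (B t) (\<Delta> t) (\<epsilon> t) Q \<Delta>\<^sub>Q \<epsilon>\<^sub>Q (q t)) \<and>
     (\<forall>(C :: ('k, 'c) two_algebra) \<Delta>\<^sub>C \<epsilon>\<^sub>C f.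
        two_bialgebra K C \<Delta>\<^sub>C \<epsilon>\<^sub>C \<longrightarrow> cocommutative K C \<Delta>\<^sub>C \<longrightarrow>
        (\<forall>t\<in>I. two_bialgebra_hom K (B t) (\<Delta> t) (\<epsilon> t) C \<Delta>\<^sub>C \<epsilon>\<^sub>C (f t)) \<longrightarrow>
        (\<exists>!g. g \<in> extensional (carrier Q) \<and> two_bialgebra_hom K Q \<Delta>\<^sub>Q \<epsilon>\<^sub>Q C \<Delta>\<^sub>C \<epsilon>\<^sub>C g \<and>
           (\<forall>t\<in>I. \<forall>x\<in>carrier (B t). g (q t x) = f t x)))"

section \<open>Universal properties\<close>

lemma tensor_class_eqI: "tensor_eq K V W s t \<Longrightarrow> tensor_class K V W s = tensor_class K V W t"
  unfolding tensor_class_def by (blast intro: tensor_eq.sym tensor_eq.trans)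

lemma tensor_class_self: "tensor_wf K V W t \<Longrightarrow> t \<in> tensor_class K V W t"
  unfolding tensor_class_def by (simp add: tensor_eq.refl)

lemma tensor_add_class:
  assumes "tensor_wf K V W s" "tensor_wf K V W t"
  shows "tensor_class K V W s \<oplus>\<^bsub>tensor K V W\<^esub> tensor_class K V W t =
    tensor_class K V W (TAdd s t)"
proof -
  have "tensor_class K V W (TAdd s' t') = tensor_class K V W (TAdd s t)"
    if "s' \<in> tensor_class K V W s" "t' \<in> tensor_class K V W t" for s' t'
    using that by (intro tensor_class_eqI tensor_eq.add_cong) (auto simp: tensor_class_def tensor_eq.sym)
  then have "(\<Union>s\<in>tensor_class K V W s. \<Union>t\<in>tensor_class K V W t. tensor_class K V W (TAdd s t)) =
      tensor_class K V W (TAdd s t)"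
    using tensor_class_self[OF assms(1)] tensor_class_self[OF assms(2)] by blast
  then show ?thesis by (simp add: tensor_def)
qed

lemma tensor_smult_class:
  assumes "c \<in> carrier K" "tensor_wf K V W t"
  shows "c \<odot>\<^bsub>tensor K V W\<^esub> tensor_class K V W t = tensor_class K V W (TScale c t)"
proof -
  have "tensor_class K V W (TScale c t') = tensor_class K V W (TScale c t)"
    if "t' \<in> tensor_class K V W t" for t'
    using that assms
    by (intro tensor_class_eqI tensor_eq.scale_cong) (auto simp: tensor_class_def tensor_eq.sym)
  then have "(\<Union>t\<in>tensor_class K V W t. tensor_class K V W (TScale c t)) =
      tensor_class K V W (TScale c t)"
    using tensor_class_self[OF assms(2)] by blast
  then show ?thesis by (simp add: tensor_def)
qed

lemma tensor_carrier: "carrier (tensor K V W) = tensor_class K V W ` {t. tensor_wf K V W t}"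
  and tensor_zero: "\<zero>\<^bsub>tensor K V W\<^esub> = tensor_class K V W TZero"
  by (simp_all add: tensor_def)

lemma tensor_module:
  assumes "field K"
  shows "module K (tensor K V W)"
proof -
  interpret field K by fact
  note [simp] = tensor_add_class tensor_smult_class tensor_zero
  show ?thesis
  proof (rule moduleI)
    show "cring K" by (rule is_cring)
    show "abelian_group (tensor K V W)"
    proof (rule abelian_groupI)
      fix x assume x: "x \<in> carrier (tensor K V W)"
      then obtain t where t: "tensor_wf K V W t" "x = tensor_class K V W t"
        by (auto simp: tensor_carrier)
      then have "tensor_class K V W (TScale (\<ominus>\<^bsub>K\<^esub> \<one>\<^bsub>K\<^esub>) t) \<in> carrier (tensor K V W)"
        "tensor_class K V W (TScale (\<ominus>\<^bsub>K\<^esub> \<one>\<^bsub>K\<^esub>) t) \<oplus>\<^bsub>tensor K V W\<^esub> x = \<zero>\<^bsub>tensor K V W\<^esub>"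
        by (auto simp: tensor_carrier intro!: tensor_class_eqI tensor_eq.add_neg del: equalityI)
      then show "\<exists>y\<in>carrier (tensor K V W). y \<oplus>\<^bsub>tensor K V W\<^esub> x = \<zero>\<^bsub>tensor K V W\<^esub>" by blast
    qed (auto simp: tensor_carrier intro!: tensor_class_eqI tensor_eq.add_assoc tensor_eq.add_zero tensor_eq.add_comm
        del: equalityI)
  qed (auto simp: tensor_carrier
        intro!: tensor_class_eqI tensor_eq.scale_add_left tensor_eq.scale_add_right
          tensor_eq.scale_scale tensor_eq.scale_one del: equalityI)
qed

lemma pure_bilinear:
  assumes "field K" "module K V" "module K W"
  shows "bilinear_map K V W (tensor K V W) (pure K V W)"
proof -
  interpret V: module K V by fact
  interpret W: module K W by fact
  show ?thesis
    unfolding bilinear_map_def linear_map_def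
    by (auto simp: pure_def tensor_carrier tensor_add_class tensor_smult_class
        intro!: tensor_class_eqI tensor_eq.pure_add_left tensor_eq.pure_add_right
          tensor_eq.pure_scale_left tensor_eq.pure_scale_right del: equalityI)
qed

lemma tensor_eval_closed:
  assumes "module K U" "bilinear_map K V W U \<beta>" "tensor_wf K V W t"
  shows "tensor_eval U \<beta> t \<in> carrier U"
proof -
  interpret U: module K U by fact
  show ?thesis
    using assms(2,3) by (induction t) (auto simp: bilinear_map_def linear_map_def)
qed

lemma tensor_eval_eq:
  assumes "module K U" "bilinear_map K V W U \<beta>" "tensor_eq K V W s t"
  shows "tensor_eval U \<beta> s = tensor_eval U \<beta> t"
proof -
  interpret U: module K U by fact
  note cl = tensor_eval_closed[OF assms(1,2)]
  show ?thesis
    using assms(3)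
  proof (induction rule: tensor_eq.induct)
    case (add_neg t)
    then show ?case
      using cl[of t] by (simp add: U.smult_l_minus U.M.l_neg)
  qed (use assms(2) in \<open>auto simp: cl U.M.a_ac U.smult_l_distr U.smult_r_distr
        U.smult_assoc1 bilinear_map_def linear_map_def\<close>)
qed

lemma tensor_lift_class:
  assumes "module K U" "bilinear_map K V W U \<beta>" "tensor_wf K V W t"
  shows "tensor_lift U \<beta> (tensor_class K V W t) = tensor_eval U \<beta> t"
proof -
  have "tensor_eval U \<beta> ` tensor_class K V W t = {tensor_eval U \<beta> t}"
  proof (intro equalityI subsetI)
    fix y assume "y \<in> tensor_eval U \<beta> ` tensor_class K V W t"
    then obtain s where "tensor_eq K V W t s" "y = tensor_eval U \<beta> s"
      unfolding tensor_class_def by blast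
    then show "y \<in> {tensor_eval U \<beta> t}"
      using tensor_eval_eq[OF assms(1,2), of t s] by simp
  next
    show "y \<in> tensor_eval U \<beta> ` tensor_class K V W t" if "y \<in> {tensor_eval U \<beta> t}" for y
      using that tensor_class_self[OF assms(3)] by blast
  qed
  then show ?thesis by (simp add: tensor_lift_def)
qed

theorem tensor_universal:
  assumes "field K" "module K V" "module K W" "module K U" "bilinear_map K V W U \<beta>"
  shows "linear_map K (tensor K V W) U (tensor_lift U \<beta>)"
    and "v \<in> carrier V \<Longrightarrow> w \<in> carrier W \<Longrightarrow> tensor_lift U \<beta> (pure K V W v w) = \<beta> v w"
    and "linear_map K (tensor K V W) U g \<Longrightarrow>
      (\<And>v w. v \<in> carrier V \<Longrightarrow> w \<in> carrier W \<Longrightarrow> g (pure K V W v w) = \<beta> v w) \<Longrightarrow>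
      x \<in> carrier (tensor K V W) \<Longrightarrow> g x = tensor_lift U \<beta> x"
proof -
  interpret U: module K U by fact
  note L = tensor_lift_class[OF assms(4,5)] and cl = tensor_eval_closed[OF assms(4,5)]
  show "linear_map K (tensor K V W) U (tensor_lift U \<beta>)"
    unfolding linear_map_def
    by (auto simp: tensor_carrier tensor_add_class tensor_smult_class L cl)
  show "tensor_lift U \<beta> (pure K V W v w) = \<beta> v w" if "v \<in> carrier V" "w \<in> carrier W"
    using that by (simp add: pure_def L)
  show "g x = tensor_lift U \<beta> x"
    if g: "linear_map K (tensor K V W) U g"
      and gp: "\<And>v w. v \<in> carrier V \<Longrightarrow> w \<in> carrier W \<Longrightarrow> g (pure K V W v w) = \<beta> v w"
      and x: "x \<in> carrier (tensor K V W)"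
  proof -
    interpret T: module K "tensor K V W" by (rule tensor_module[OF assms(1)])
    have g0: "g \<zero>\<^bsub>tensor K V W\<^esub> = \<zero>\<^bsub>U\<^esub>"
    proof -
      have "g (\<zero>\<^bsub>K\<^esub> \<odot>\<^bsub>tensor K V W\<^esub> \<zero>\<^bsub>tensor K V W\<^esub>) = \<zero>\<^bsub>K\<^esub> \<odot>\<^bsub>U\<^esub> g \<zero>\<^bsub>tensor K V W\<^esub>"
        "g \<zero>\<^bsub>tensor K V W\<^esub> \<in> carrier U"
        using g ring.ring_simprules(2)[OF field.is_ring[OF assms(1)]] T.M.zero_closed
        unfolding linear_map_def by blast+
      then show ?thesis by simp
    qed
    have "g (tensor_class K V W t) = tensor_eval U \<beta> t" if "tensor_wf K V W t" for t
      using that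
    proof (induction t)
      case TZero
      then show ?case using g0 by (simp add: tensor_zero)
    next
      case (TPure v w)
      then show ?case using gp[of v w] by (simp add: pure_def)
    next
      case (TAdd s t)
      then show ?case
        using g unfolding linear_map_def
        by (auto simp: tensor_add_class[symmetric] tensor_carrier)
    next
      case (TScale c t)
      then show ?case
        using g unfolding linear_map_def
        by (auto simp: tensor_smult_class[symmetric] tensor_carrier)
    qed
    then show ?thesis using x by (auto simp: tensor_carrier L)
  qed
qed

lemma free_class_eqI: "free_eq K V s t \<Longrightarrow> free_class K V s = free_class K V t"
  unfolding free_class_def by (blast intro: free_eq.sym free_eq.trans)

lemma free_class_self: "free_wf K V t \<Longrightarrow> t \<in> free_class K V t"
  unfolding free_class_def by (simp add: free_eq.refl)

lemma free_carrier: "carrier (free_two_algebra K V) = free_class K V ` {t. free_wf K V t}"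
  and free_zero: "\<zero>\<^bsub>free_two_algebra K V\<^esub> = free_class K V FZero"
  and free_one: "\<one>\<^bsub>free_two_algebra K V\<^esub> = free_class K V FOne"
  by (simp_all add: free_two_algebra_def)

lemma free_op_class:
  assumes "free_wf K V s" "free_wf K V t"
    and "\<And>s' t'. free_eq K V s s' \<Longrightarrow> free_eq K V t t' \<Longrightarrow> free_eq K V (h s t) (h s' t')"
  shows "(\<Union>s\<in>free_class K V s. \<Union>t\<in>free_class K V t. free_class K V (h s t)) =
    free_class K V (h s t)"
proof -
  have "free_class K V (h s' t') = free_class K V (h s t)"
    if "s' \<in> free_class K V s" "t' \<in> free_class K V t" for s' t'
    using that assms(3) by (metis free_class_eqI free_class_def mem_Collect_eq)
  then show ?thesis
    using free_class_self[OF assms(1)] free_class_self[OF assms(2)] by blast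
qed

lemma free_add_class:
  assumes "free_wf K V s" "free_wf K V t"
  shows "free_class K V s \<oplus>\<^bsub>free_two_algebra K V\<^esub> free_class K V t = free_class K V (FAdd s t)"
  using free_op_class[of K V s t FAdd, OF assms free_eq.add_cong] by (simp add: free_two_algebra_def)

lemma free_mult_class:
  assumes "free_wf K V s" "free_wf K V t"
  shows "free_class K V s \<otimes>\<^bsub>free_two_algebra K V\<^esub> free_class K V t = free_class K V (FMul s t)"
  using free_op_class[of K V s t FMul, OF assms free_eq.mul_cong] by (simp add: free_two_algebra_def)

lemma free_dmult_class:
  assumes "free_wf K V s" "free_wf K V t"
  shows "free_class K V s \<diamondop>\<^bsub>free_two_algebra K V\<^esub> free_class K V t = free_class K V (FDia s t)"
  using free_op_class[of K V s t FDia, OF assms free_eq.dia_cong] by (simp add: free_two_algebra_def)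

lemma free_smult_class:
  assumes "c \<in> carrier K" "free_wf K V t"
  shows "c \<odot>\<^bsub>free_two_algebra K V\<^esub> free_class K V t = free_class K V (FScale c t)"
proof -
  have "free_class K V (FScale c t') = free_class K V (FScale c t)"
    if "t' \<in> free_class K V t" for t'
    using that assms
    by (intro free_class_eqI free_eq.scale_cong) (auto simp: free_class_def free_eq.sym)
  then have "(\<Union>t\<in>free_class K V t. free_class K V (FScale c t)) = free_class K V (FScale c t)"
    using free_class_self[OF assms(2)] by blast
  then show ?thesis by (simp add: free_two_algebra_def)
qed

lemma diamond_simps [simp]:
  "carrier (diamond A) = carrier A" "\<one>\<^bsub>diamond A\<^esub> = \<one>\<^bsub>A\<^esub>" "\<zero>\<^bsub>diamond A\<^esub> = \<zero>\<^bsub>A\<^esub>"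
  "(\<oplus>\<^bsub>diamond A\<^esub>) = (\<oplus>\<^bsub>A\<^esub>)" "(\<odot>\<^bsub>diamond A\<^esub>) = (\<odot>\<^bsub>A\<^esub>)" "(\<otimes>\<^bsub>diamond A\<^esub>) = (\<diamondop>\<^bsub>A\<^esub>)"
  by (simp_all add: diamond_def)

lemma module_diamond:
  assumes "module K A"
  shows "module K (diamond A)"
proof -
  interpret module K A by fact
  show ?thesis
    by (rule moduleI[OF R.is_cring], rule abelian_groupI)
      (auto simp: M.a_ac smult_l_distr smult_r_distr smult_assoc1 intro: M.l_neg)
qed

lemma assoc_algebraI:
  assumes "field K" "module K A"
    and "\<one>\<^bsub>A\<^esub> \<in> carrier A"
    and "\<And>x y. x \<in> carrier A \<Longrightarrow> y \<in> carrier A \<Longrightarrow> x \<otimes>\<^bsub>A\<^esub> y \<in> carrier A"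
    and "\<And>x y z. x \<in> carrier A \<Longrightarrow> y \<in> carrier A \<Longrightarrow> z \<in> carrier A
      \<Longrightarrow> (x \<otimes>\<^bsub>A\<^esub> y) \<otimes>\<^bsub>A\<^esub> z = x \<otimes>\<^bsub>A\<^esub> (y \<otimes>\<^bsub>A\<^esub> z)"
    and "\<And>x. x \<in> carrier A \<Longrightarrow> \<one>\<^bsub>A\<^esub> \<otimes>\<^bsub>A\<^esub> x = x"
    and "\<And>x. x \<in> carrier A \<Longrightarrow> x \<otimes>\<^bsub>A\<^esub> \<one>\<^bsub>A\<^esub> = x"
    and "bilinear_map K A A A (\<otimes>\<^bsub>A\<^esub>)"
  shows "assoc_algebra K A"
proof -
  interpret A: module K A by fact
  have "ring A"
    by (rule ringI[OF A.M.abelian_group_axioms])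
      (use assms in \<open>auto intro!: monoidI simp: bilinear_map_def linear_map_def\<close>)
  then show ?thesis
    using assms
    by (auto simp: assoc_algebra_def assoc_algebra_axioms_def bilinear_map_def linear_map_def)
qed

lemma assoc_algebra_bilinear:
  assumes "assoc_algebra K A"
  shows "bilinear_map K A A A (\<otimes>\<^bsub>A\<^esub>)"
proof -
  interpret assoc_algebra K A by fact
  show ?thesis
    unfolding bilinear_map_def linear_map_def
    by (auto simp: l_distr r_distr smult_mult_left smult_mult_right)
qed

lemma free_module:
  assumes "field K"
  shows "module K (free_two_algebra K V)"
proof -
  interpret field K by fact
  note [simp] = free_add_class free_smult_class free_zero
  show ?thesis
  proof (rule moduleI)
    show "cring K" by (rule is_cring)
    show "abelian_group (free_two_algebra K V)"
    proof (rule abelian_groupI)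
      fix x assume x: "x \<in> carrier (free_two_algebra K V)"
      then obtain t where t: "free_wf K V t" "x = free_class K V t"
        by (auto simp: free_carrier)
      then have "free_class K V (FScale (\<ominus>\<^bsub>K\<^esub> \<one>\<^bsub>K\<^esub>) t) \<in> carrier (free_two_algebra K V)"
        "free_class K V (FScale (\<ominus>\<^bsub>K\<^esub> \<one>\<^bsub>K\<^esub>) t) \<oplus>\<^bsub>free_two_algebra K V\<^esub> x =
          \<zero>\<^bsub>free_two_algebra K V\<^esub>"
        by (auto simp: free_carrier intro!: free_class_eqI free_eq.add_neg del: equalityI)
      then show "\<exists>y\<in>carrier (free_two_algebra K V).
          y \<oplus>\<^bsub>free_two_algebra K V\<^esub> x = \<zero>\<^bsub>free_two_algebra K V\<^esub>" by blast
    qed (auto simp: free_carrier intro!: free_class_eqI free_eq.add_assoc free_eq.add_zero free_eq.add_comm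
        del: equalityI)
  qed (auto simp: free_carrier
        intro!: free_class_eqI free_eq.scale_add_left free_eq.scale_add_right
          free_eq.scale_scale free_eq.scale_one del: equalityI)
qed

theorem free_two_algebra_two_algebra:
  assumes "field K"
  shows "two_algebra K (free_two_algebra K V)"
proof -
  note [simp] = free_add_class free_smult_class free_mult_class free_dmult_class free_one free_carrier
  have "assoc_algebra K (free_two_algebra K V)"
    by (rule assoc_algebraI[OF assms free_module[OF assms]])
      (auto simp: bilinear_map_def linear_map_def
        intro!: free_class_eqI free_eq.mul_assoc free_eq.mul_one_left free_eq.mul_one_right
          free_eq.mul_add_left free_eq.mul_add_right free_eq.mul_scale_left free_eq.mul_scale_right
        del: equalityI)
  moreover have "assoc_algebra K (diamond (free_two_algebra K V))"
    by (rule assoc_algebraI[OF assms module_diamond[OF free_module[OF assms]]])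
      (auto simp: bilinear_map_def linear_map_def
        intro!: free_class_eqI free_eq.dia_assoc free_eq.dia_one_left free_eq.dia_one_right
          free_eq.dia_add_left free_eq.dia_add_right free_eq.dia_scale_left free_eq.dia_scale_right
        del: equalityI)
  ultimately show ?thesis by (simp add: two_algebra_def)
qed

lemma free_inj_linear:
  assumes "module K V"
  shows "linear_map K V (free_two_algebra K V) (free_inj K V)"
proof -
  interpret module K V by fact
  show ?thesis
    unfolding linear_map_def free_inj_def
    by (auto simp: free_carrier free_add_class free_smult_class
        intro!: free_class_eqI free_eq.gen_add free_eq.gen_scale del: equalityI)
qed

lemma free_eval_closed:
  assumes "two_algebra K A" "linear_map K V A f" "free_wf K V t"
  shows "free_eval A f t \<in> carrier A"
proof -
  interpret A: assoc_algebra K A using assms(1) by (simp add: two_algebra_def)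
  interpret D: assoc_algebra K "diamond A" using assms(1) by (simp add: two_algebra_def)
  show ?thesis
    using assms(2,3) D.m_closed by (induction t) (auto simp: linear_map_def)
qed

lemma free_eval_eq:
  assumes "two_algebra K A" "linear_map K V A f" "free_eq K V s t"
  shows "free_eval A f s = free_eval A f t"
proof -
  interpret A: assoc_algebra K A using assms(1) by (simp add: two_algebra_def)
  interpret D: assoc_algebra K "diamond A" using assms(1) by (simp add: two_algebra_def)
  note cl = free_eval_closed[OF assms(1,2)]
  show ?thesis
    using assms(3)
  proof (induction rule: free_eq.induct)
    case (add_neg t)
    then show ?case
      using cl[of t] by (simp add: A.smult_l_minus A.l_neg)
  qed (use assms(2) D.m_assoc D.l_one D.r_one D.l_distr D.r_distr D.smult_mult_left
        D.smult_mult_right in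
      \<open>auto simp: cl A.M.a_ac A.smult_l_distr A.smult_r_distr
        A.smult_assoc1 linear_map_def A.m_assoc A.l_distr A.r_distr A.smult_mult_left
        A.smult_mult_right\<close>)
qed

lemma free_lift_class:
  assumes "two_algebra K A" "linear_map K V A f" "free_wf K V t"
  shows "free_lift A f (free_class K V t) = free_eval A f t"
proof -
  have "free_eval A f ` free_class K V t = {free_eval A f t}"
  proof (intro equalityI subsetI)
    fix y assume "y \<in> free_eval A f ` free_class K V t"
    then obtain s where "free_eq K V t s" "y = free_eval A f s"
      unfolding free_class_def by blast
    then show "y \<in> {free_eval A f t}"
      using free_eval_eq[OF assms(1,2), of t s] by simp
  next
    show "y \<in> free_eval A f ` free_class K V t" if "y \<in> {free_eval A f t}" for y
      using that free_class_self[OF assms(3)] by blast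
  qed
  then show ?thesis by (simp add: free_lift_def)
qed

theorem free_two_algebra_universal:
  assumes "field K" "module K V" "two_algebra K A" "linear_map K V A f"
  shows "two_algebra_hom K (free_two_algebra K V) A (free_lift A f)"
    and "v \<in> carrier V \<Longrightarrow> free_lift A f (free_inj K V v) = f v"
    and "two_algebra_hom K (free_two_algebra K V) A g \<Longrightarrow>
      (\<And>v. v \<in> carrier V \<Longrightarrow> g (free_inj K V v) = f v) \<Longrightarrow>
      x \<in> carrier (free_two_algebra K V) \<Longrightarrow> g x = free_lift A f x"
proof -
  interpret A: assoc_algebra K A using assms(3) by (simp add: two_algebra_def)
  note L = free_lift_class[OF assms(3,4)] and cl = free_eval_closed[OF assms(3,4)]
  note ops = free_add_class free_smult_class free_mult_class free_dmult_class
  show "two_algebra_hom K (free_two_algebra K V) A (free_lift A f)"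
    unfolding two_algebra_hom_def linear_map_def ring_hom_def
    by (auto simp: free_carrier ops free_one L cl)
  show "free_lift A f (free_inj K V v) = f v" if "v \<in> carrier V"
    using that by (simp add: free_inj_def L)
  show "g x = free_lift A f x"
    if g: "two_algebra_hom K (free_two_algebra K V) A g"
      and gi: "\<And>v. v \<in> carrier V \<Longrightarrow> g (free_inj K V v) = f v"
      and x: "x \<in> carrier (free_two_algebra K V)"
  proof -
    let ?F = "free_two_algebra K V"
    interpret F: module K ?F by (rule free_module[OF assms(1)])
    note g' = g[unfolded two_algebra_hom_def linear_map_def ring_hom_def]
    have g0: "g \<zero>\<^bsub>?F\<^esub> = \<zero>\<^bsub>A\<^esub>"
    proof -
      have "g (\<zero>\<^bsub>K\<^esub> \<odot>\<^bsub>?F\<^esub> \<zero>\<^bsub>?F\<^esub>) = \<zero>\<^bsub>K\<^esub> \<odot>\<^bsub>A\<^esub> g \<zero>\<^bsub>?F\<^esub>" "g \<zero>\<^bsub>?F\<^esub> \<in> carrier A"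
        using g' ring.ring_simprules(2)[OF field.is_ring[OF assms(1)]] F.M.zero_closed
        by blast+
      then show ?thesis by simp
    qed
    have "g (free_class K V t) = free_eval A f t" if "free_wf K V t" for t
      using that
    proof (induction t)
      case (FGen v)
      then show ?case using gi[of v] by (simp add: free_inj_def)
    next
      case FZero
      then show ?case using g0 by (simp add: free_zero)
    next
      case FOne
      then show ?case using g' by (simp add: free_one)
    next
      case (FAdd s t)
      then show ?case using g' by (auto simp: free_add_class[symmetric] free_carrier)
    next
      case (FScale c t)
      then show ?case using g' by (auto simp: free_smult_class[symmetric] free_carrier)
    next
      case (FMul s t)
      then show ?case using g' by (auto simp: free_mult_class[symmetric] free_carrier)
    next
      case (FDia s t)
      then show ?case using g' by (auto simp: free_dmult_class[symmetric] free_carrier)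
    qed
    then show ?thesis using x by (auto simp: free_carrier L)
  qed
qed

lemma tensor_induct [consumes 1, case_names zero pure add smult]:
  assumes "x \<in> carrier (tensor K V W)"
    and "P \<zero>\<^bsub>tensor K V W\<^esub>"
    and "\<And>v w. v \<in> carrier V \<Longrightarrow> w \<in> carrier W \<Longrightarrow> P (pure K V W v w)"
    and "\<And>x y. x \<in> carrier (tensor K V W) \<Longrightarrow> y \<in> carrier (tensor K V W)
      \<Longrightarrow> P x \<Longrightarrow> P y \<Longrightarrow> P (x \<oplus>\<^bsub>tensor K V W\<^esub> y)"
    and "\<And>c x. c \<in> carrier K \<Longrightarrow> x \<in> carrier (tensor K V W)
      \<Longrightarrow> P x \<Longrightarrow> P (c \<odot>\<^bsub>tensor K V W\<^esub> x)"
  shows "P x"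
proof -
  have "P (tensor_class K V W t)" if "tensor_wf K V W t" for t
    using that
  proof (induction t)
    case TZero
    show ?case using assms(2) by (simp add: tensor_zero)
  next
    case (TPure v w)
    then show ?case using assms(3)[of v w] by (simp add: pure_def)
  next
    case (TAdd s t)
    then show ?case
      using assms(4)[of "tensor_class K V W s" "tensor_class K V W t"]
      by (simp add: tensor_add_class tensor_carrier)
  next
    case (TScale c t)
    then show ?case
      using assms(5)[of c "tensor_class K V W t"] by (simp add: tensor_smult_class tensor_carrier)
  qed
  then show ?thesis using assms(1) by (auto simp: tensor_carrier)
qed

lemma linear_map_closed: "linear_map K V W f \<Longrightarrow> x \<in> carrier V \<Longrightarrow> f x \<in> carrier W"
  and linear_map_add: "linear_map K V W f \<Longrightarrow> x \<in> carrier V \<Longrightarrow> y \<in> carrier V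
    \<Longrightarrow> f (x \<oplus>\<^bsub>V\<^esub> y) = f x \<oplus>\<^bsub>W\<^esub> f y"
  and linear_map_smult: "linear_map K V W f \<Longrightarrow> c \<in> carrier K \<Longrightarrow> x \<in> carrier V
    \<Longrightarrow> f (c \<odot>\<^bsub>V\<^esub> x) = c \<odot>\<^bsub>W\<^esub> f x"
  by (auto simp: linear_map_def)

lemma linear_map_zero:
  assumes "module K V" "module K W" "linear_map K V W f"
  shows "f \<zero>\<^bsub>V\<^esub> = \<zero>\<^bsub>W\<^esub>"
proof -
  interpret V: module K V by fact
  interpret W: module K W by fact
  have "f (\<zero>\<^bsub>K\<^esub> \<odot>\<^bsub>V\<^esub> \<zero>\<^bsub>V\<^esub>) = \<zero>\<^bsub>K\<^esub> \<odot>\<^bsub>W\<^esub> f \<zero>\<^bsub>V\<^esub>" "f \<zero>\<^bsub>V\<^esub> \<in> carrier W"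
    using linear_map_smult[OF assms(3) V.R.zero_closed V.M.zero_closed]
      linear_map_closed[OF assms(3) V.M.zero_closed] by simp_all
  then show ?thesis by simp
qed

lemma tensor_lift_linear_in_map:
  assumes "field K" "module K A" "module K B" "module K U" "module K C"
    and "\<And>z. z \<in> carrier C \<Longrightarrow> bilinear_map K A B U (\<gamma> z)"
    and "\<And>a b. a \<in> carrier A \<Longrightarrow> b \<in> carrier B \<Longrightarrow> linear_map K C U (\<lambda>z. \<gamma> z a b)"
    and "x \<in> carrier (tensor K A B)"
  shows "linear_map K C U (\<lambda>z. tensor_lift U (\<gamma> z) x)"
proof -
  interpret U: module K U by fact
  interpret C: module K C by fact
  interpret T: module K "tensor K A B" by (rule tensor_module[OF assms(1)])
  note univ = tensor_universal[OF assms(1-4) assms(6)]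
  note lin = univ(1)
  show ?thesis
    using assms(8)
  proof (induction x rule: tensor_induct)
    case zero
    then show ?case
      unfolding linear_map_def by (simp add: linear_map_zero[OF T.module_axioms assms(4) lin])
  next
    case (pure v w)
    then show ?case
      using assms(7)[OF pure] unfolding linear_map_def by (simp add: univ(2)) (simp add: Pi_def univ(2))
  next
    case (add x y)
    then show ?case
      unfolding linear_map_def
      by (simp add: Pi_def linear_map_add[OF lin] U.M.a_ac U.smult_r_distr)
  next
    case (smult c x)
    then show ?case
      unfolding linear_map_def
      by (simp add: Pi_def linear_map_smult[OF lin] U.smult_r_distr U.smult_assoc1[symmetric] U.R.m_comm)
  qed
qed

lemma tensor_lift2_bilinear:
  assumes "field K" "module K A" "module K B" "module K C" "module K D" "module K U"
    and "\<And>c d. c \<in> carrier C \<Longrightarrow> d \<in> carrier D \<Longrightarrow> bilinear_map K A B U (\<lambda>a b. \<beta> a b c d)"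
    and "\<And>a b. a \<in> carrier A \<Longrightarrow> b \<in> carrier B \<Longrightarrow> bilinear_map K C D U (\<beta> a b)"
  shows "bilinear_map K (tensor K A B) (tensor K C D) U (tensor_lift2 U \<beta>)"
    and "a \<in> carrier A \<Longrightarrow> b \<in> carrier B \<Longrightarrow> c \<in> carrier C \<Longrightarrow> d \<in> carrier D
      \<Longrightarrow> tensor_lift2 U \<beta> (pure K A B a b) (pure K C D c d) = \<beta> a b c d"
proof -
  have inner: "bilinear_map K A B U (\<lambda>a b. tensor_lift U (\<beta> a b) Y)"
    if Y: "Y \<in> carrier (tensor K C D)" for Y
    unfolding bilinear_map_def
  proof (intro conjI ballI)
    fix a assume a: "a \<in> carrier A"
    show "linear_map K B U (\<lambda>b. tensor_lift U (\<beta> a b) Y)"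
      by (rule tensor_lift_linear_in_map[OF assms(1,4,5,6,3)])
        (use a Y assms(7,8) in \<open>auto simp: bilinear_map_def\<close>)
  next
    fix b assume b: "b \<in> carrier B"
    show "linear_map K A U (\<lambda>a. tensor_lift U (\<beta> a b) Y)"
      by (rule tensor_lift_linear_in_map[OF assms(1,4,5,6,2)])
        (use b Y assms(7,8) in \<open>auto simp: bilinear_map_def\<close>)
  qed
  have lin: "linear_map K (tensor K C D) U (tensor_lift U (\<beta> a b))"
    if "a \<in> carrier A" "b \<in> carrier B" for a b
    by (rule tensor_universal(1)[OF assms(1,4,5,6) assms(8)[OF that]])
  show "bilinear_map K (tensor K A B) (tensor K C D) U (tensor_lift2 U \<beta>)"
    unfolding bilinear_map_def tensor_lift2_def
  proof (intro conjI ballI)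
    fix X assume "X \<in> carrier (tensor K A B)"
    then show "linear_map K (tensor K C D) U
        (\<lambda>Y. tensor_lift U (\<lambda>a b. tensor_lift U (\<beta> a b) Y) X)"
      by (intro tensor_lift_linear_in_map[OF assms(1,2,3,6) tensor_module[OF assms(1)] inner lin])
  next
    fix Y assume "Y \<in> carrier (tensor K C D)"
    then show "linear_map K (tensor K A B) U
        (\<lambda>X. tensor_lift U (\<lambda>a b. tensor_lift U (\<beta> a b) Y) X)"
      by (intro tensor_universal(1)[OF assms(1,2,3,6)] inner)
  qed
  show "tensor_lift2 U \<beta> (pure K A B a b) (pure K C D c d) = \<beta> a b c d"
    if "a \<in> carrier A" "b \<in> carrier B" "c \<in> carrier C" "d \<in> carrier D"
  proof -
    have p: "pure K C D c d \<in> carrier (tensor K C D)"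
      using that by (auto simp: pure_def tensor_carrier)
    show ?thesis
      unfolding tensor_lift2_def
      by (simp add: tensor_universal(2)[OF assms(1,2,3,6) inner[OF p]]
          tensor_universal(2)[OF assms(1,4,5,6) assms(8)] that)
  qed
qed

lemma module_cong:
  assumes "module K M" "carrier N = carrier M" "\<zero>\<^bsub>N\<^esub> = \<zero>\<^bsub>M\<^esub>" "(\<oplus>\<^bsub>N\<^esub>) = (\<oplus>\<^bsub>M\<^esub>)" "(\<odot>\<^bsub>N\<^esub>) = (\<odot>\<^bsub>M\<^esub>)"
  shows "module K N"
proof -
  interpret module K M by fact
  show ?thesis
    by (rule moduleI[OF R.is_cring], rule abelian_groupI)
      (auto simp: assms(2-) M.a_ac smult_l_distr smult_r_distr smult_assoc1 intro: M.l_neg)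
qed

lemma tensor_assoc_algebra:
  assumes "assoc_algebra K A" "assoc_algebra K B"
    and T: "carrier T = carrier (tensor K A B)" "\<zero>\<^bsub>T\<^esub> = \<zero>\<^bsub>tensor K A B\<^esub>"
      "(\<oplus>\<^bsub>T\<^esub>) = (\<oplus>\<^bsub>tensor K A B\<^esub>)" "(\<odot>\<^bsub>T\<^esub>) = (\<odot>\<^bsub>tensor K A B\<^esub>)"
      "\<one>\<^bsub>T\<^esub> = pure K A B \<one>\<^bsub>A\<^esub> \<one>\<^bsub>B\<^esub>"
      "(\<otimes>\<^bsub>T\<^esub>) = tensor_lift2 (tensor K A B) (\<lambda>a b a' b'. pure K A B (a \<otimes>\<^bsub>A\<^esub> a') (b \<otimes>\<^bsub>B\<^esub> b'))"
  shows "assoc_algebra K T"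
proof -
  interpret A: assoc_algebra K A by fact
  interpret B: assoc_algebra K B by fact
  let ?T = "tensor K A B"
  interpret T: module K ?T by (rule tensor_module[OF A.field_axioms])
  note mods = A.module_axioms B.module_axioms
  note pb = pure_bilinear[OF A.field_axioms mods]
  have pl: "\<And>a. a \<in> carrier A \<Longrightarrow> linear_map K B ?T (pure K A B a)"
    and pr: "\<And>b. b \<in> carrier B \<Longrightarrow> linear_map K A ?T (\<lambda>a. pure K A B a b)"
    using pb by (auto simp: bilinear_map_def)
  note [simp] = linear_map_closed[OF pl]
  define m where "m = tensor_lift2 ?T (\<lambda>a b a' b'. pure K A B (a \<otimes>\<^bsub>A\<^esub> a') (b \<otimes>\<^bsub>B\<^esub> b'))"
  have b1: "bilinear_map K A B ?T (\<lambda>a b. pure K A B (a \<otimes>\<^bsub>A\<^esub> c) (b \<otimes>\<^bsub>B\<^esub> d))"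
    if "c \<in> carrier A" "d \<in> carrier B" for c d
    using that unfolding bilinear_map_def linear_map_def
    by (auto simp: A.l_distr B.l_distr A.smult_mult_left B.smult_mult_left
        linear_map_add[OF pl] linear_map_add[OF pr] linear_map_smult[OF pl] linear_map_smult[OF pr])
  have b2: "bilinear_map K A B ?T (\<lambda>c d. pure K A B (a \<otimes>\<^bsub>A\<^esub> c) (b \<otimes>\<^bsub>B\<^esub> d))"
    if "a \<in> carrier A" "b \<in> carrier B" for a b
    using that unfolding bilinear_map_def linear_map_def
    by (auto simp: A.r_distr B.r_distr A.smult_mult_right B.smult_mult_right
        linear_map_add[OF pl] linear_map_add[OF pr] linear_map_smult[OF pl] linear_map_smult[OF pr])
  note l2 = tensor_lift2_bilinear[OF A.field_axioms mods mods T.module_axioms b1 b2, folded m_def]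
  have mp: "m (pure K A B a b) (pure K A B c d) = pure K A B (a \<otimes>\<^bsub>A\<^esub> c) (b \<otimes>\<^bsub>B\<^esub> d)"
    if "a \<in> carrier A" "b \<in> carrier B" "c \<in> carrier A" "d \<in> carrier B" for a b c d
    by (rule l2(2)) (use that in auto)
  have mb: "bilinear_map K ?T ?T ?T m" by (rule l2(1))
  have ml: "\<And>x. x \<in> carrier ?T \<Longrightarrow> linear_map K ?T ?T (m x)"
    and mr: "\<And>y. y \<in> carrier ?T \<Longrightarrow> linear_map K ?T ?T (\<lambda>x. m x y)"
    using mb by (auto simp: bilinear_map_def)
  note [simp] = linear_map_closed[OF ml]
  note lin = linear_map_add[OF ml] linear_map_add[OF mr] linear_map_smult[OF ml] linear_map_smult[OF mr]
    linear_map_zero[OF T.module_axioms T.module_axioms ml]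
    linear_map_zero[OF T.module_axioms T.module_axioms mr]
  have one_l: "m (pure K A B \<one>\<^bsub>A\<^esub> \<one>\<^bsub>B\<^esub>) x = x" if "x \<in> carrier ?T" for x
    using that by (induction x rule: tensor_induct) (auto simp: lin mp)
  have one_r: "m x (pure K A B \<one>\<^bsub>A\<^esub> \<one>\<^bsub>B\<^esub>) = x" if "x \<in> carrier ?T" for x
    using that by (induction x rule: tensor_induct) (auto simp: lin mp)
  have ass1: "m (m (pure K A B a b) (pure K A B c d)) z = m (pure K A B a b) (m (pure K A B c d) z)"
    if "a \<in> carrier A" "b \<in> carrier B" "c \<in> carrier A" "d \<in> carrier B" "z \<in> carrier ?T" for a b c d z
    using that(5,1-4)
    by (induction z rule: tensor_induct) (auto simp: lin mp A.m_assoc B.m_assoc)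
  have ass2: "m (m (pure K A B a b) y) z = m (pure K A B a b) (m y z)"
    if "a \<in> carrier A" "b \<in> carrier B" "y \<in> carrier ?T" "z \<in> carrier ?T" for a b y z
    using that(3,1,2,4) by (induction y rule: tensor_induct) (auto simp: lin ass1)
  have ass: "m (m x y) z = m x (m y z)"
    if "x \<in> carrier ?T" "y \<in> carrier ?T" "z \<in> carrier ?T" for x y z
    using that by (induction x rule: tensor_induct) (auto simp: lin ass2)
  show ?thesis
  proof (rule assoc_algebraI[OF A.field_axioms module_cong[OF T.module_axioms T(1-4)]])
    show "bilinear_map K T T T (\<otimes>\<^bsub>T\<^esub>)"
      using mb unfolding T(6) m_def[symmetric] by (simp add: bilinear_map_def linear_map_def T(1-4))
  qed (simp_all add: T m_def[symmetric] one_l one_r ass)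
qed

lemma tensor_eq_transfer:
  assumes "tensor_eq K V W s t"
    and V: "carrier V = carrier V'" "(\<oplus>\<^bsub>V\<^esub>) = (\<oplus>\<^bsub>V'\<^esub>)" "(\<odot>\<^bsub>V\<^esub>) = (\<odot>\<^bsub>V'\<^esub>)"
    and W: "carrier W = carrier W'" "(\<oplus>\<^bsub>W\<^esub>) = (\<oplus>\<^bsub>W'\<^esub>)" "(\<odot>\<^bsub>W\<^esub>) = (\<odot>\<^bsub>W'\<^esub>)"
  shows "tensor_eq K V' W' s t"
proof -
  have wf: "tensor_wf K V W t = tensor_wf K V' W' t" for t
    by (induction t) (auto simp: V W)
  show ?thesis
    using assms(1)
  proof (induction rule: tensor_eq.induct)
    case (trans r s t)
    then show ?case by (blast intro: tensor_eq.trans)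
  next
    case (sym s t)
    then show ?case by (blast intro: tensor_eq.sym)
  qed (simp_all add: V W wf tensor_eq.intros(1,4-))
qed

theorem tensor_two_algebra_two_algebra:
  assumes "two_algebra K A" "two_algebra K B"
  shows "two_algebra K (tensor_two_algebra K A B)"
proof -
  have D: "tensor K (diamond A) (diamond B) = tensor K A B"
    "pure K (diamond A) (diamond B) = pure K A B"
  proof -
    have w: "tensor_wf K (diamond A) (diamond B) = tensor_wf K A B"
    proof
      show "tensor_wf K (diamond A) (diamond B) t = tensor_wf K A B t" for t
        by (induction t) auto
    qed
    have "tensor_eq K (diamond A) (diamond B) s t \<longleftrightarrow> tensor_eq K A B s t" for s t
      using tensor_eq_transfer[of K A B s t "diamond A" "diamond B"]
        tensor_eq_transfer[of K "diamond A" "diamond B" s t A B] by auto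
    then have c: "tensor_class K (diamond A) (diamond B) = tensor_class K A B"
      by (auto simp: tensor_class_def)
    show "tensor K (diamond A) (diamond B) = tensor K A B" by (simp add: tensor_def c w)
    show "pure K (diamond A) (diamond B) = pure K A B" by (intro ext) (simp add: pure_def c)
  qed
  have "assoc_algebra K (tensor_two_algebra K A B)"
    using assms unfolding two_algebra_def
    by (intro tensor_assoc_algebra[of K A B]) (auto simp: tensor_two_algebra_def)
  moreover have "assoc_algebra K (diamond (tensor_two_algebra K A B))"
    using assms unfolding two_algebra_def
    by (intro tensor_assoc_algebra[of K "diamond A" "diamond B"])
      (auto simp: D tensor_two_algebra_def)
  ultimately show ?thesis by (simp add: two_algebra_def)
qed

theorem scalars_two_algebra:
  assumes "field K"
  shows "two_algebra K (scalars K)"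
proof -
  interpret field K by fact
  have m: "module K (scalars K)"
    by (rule moduleI[OF is_cring], rule abelian_groupI)
      (auto simp: scalars_def a_ac m_assoc l_distr r_distr intro: l_neg)
  have "assoc_algebra K (scalars K)"
    by (rule assoc_algebraI[OF assms m])
      (auto simp: bilinear_map_def linear_map_def scalars_def m_ac l_distr r_distr)
  moreover have "diamond (scalars K) = scalars K"
    by (simp add: diamond_def scalars_def)
  ultimately show ?thesis by (simp add: two_algebra_def)
qed

lemma tensor_map_linear:
  assumes "field K" "module K V" "module K W" "module K V'" "module K W'"
    and "linear_map K V V' f" "linear_map K W W' g"
  shows "linear_map K (tensor K V W) (tensor K V' W') (tensor_map K V' W' f g)"
  unfolding tensor_map_def
proof (rule tensor_universal(1)[OF assms(1-3) tensor_module[OF assms(1)]])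
  show "bilinear_map K V W (tensor K V' W') (\<lambda>v w. pure K V' W' (f v) (g w))"
    using pure_bilinear[OF assms(1,4,5)] assms(6,7)
    by (auto simp: bilinear_map_def linear_map_def Pi_def)
qed

text \<open>
  \<open>free_comult\<close> and \<open>free_counit\<close> are the unique morphisms of 2-algebras extending the
  comultiplication and the counit of \<open>V\<close>.
\<close>

theorem free_comult_universal:
  fixes \<Delta> :: "'v \<Rightarrow> ('k, 'v, 'v) tensor_term set"
  assumes "coalgebra K V \<Delta> \<epsilon>"
  defines "F \<equiv> free_two_algebra K V" and "i \<equiv> free_inj K V"
  shows "two_algebra_hom K F (tensor_two_algebra K F F) (free_comult K V \<Delta>)"
    and "v \<in> carrier V \<Longrightarrow> free_comult K V \<Delta> (i v) = tensor_map K F F i i (\<Delta> v)"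
    and "two_algebra_hom K F (tensor_two_algebra K F F) g \<Longrightarrow>
      (\<And>v. v \<in> carrier V \<Longrightarrow> g (i v) = tensor_map K F F i i (\<Delta> v)) \<Longrightarrow>
      x \<in> carrier F \<Longrightarrow> g x = free_comult K V \<Delta> x"
proof -
  interpret coalgebra K V \<Delta> \<epsilon> by fact
  have F: "two_algebra K F" "module K F"
    unfolding F_def by (rule free_two_algebra_two_algebra free_module, rule field_axioms)+
  have i: "linear_map K V F i"
    unfolding F_def i_def by (rule free_inj_linear[OF module_axioms])
  have "linear_map K V (tensor_two_algebra K F F) (\<lambda>v. tensor_map K F F i i (\<Delta> v))"
    using comult_linear
      tensor_map_linear[OF field_axioms module_axioms module_axioms F(2) F(2) i i]
    by (auto simp: linear_map_def tensor_two_algebra_def Pi_def)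
  note univ = free_two_algebra_universal[OF field_axioms module_axioms
      tensor_two_algebra_two_algebra[OF F(1) F(1)] this, folded F_def i_def]
  have e: "free_comult K V \<Delta> =
      free_lift (tensor_two_algebra K F F) (\<lambda>v. tensor_map K F F i i (\<Delta> v))"
    by (simp add: free_comult_def F_def i_def Let_def)
  show "two_algebra_hom K F (tensor_two_algebra K F F) (free_comult K V \<Delta>)"
    and "v \<in> carrier V \<Longrightarrow> free_comult K V \<Delta> (i v) = tensor_map K F F i i (\<Delta> v)"
    and "two_algebra_hom K F (tensor_two_algebra K F F) g \<Longrightarrow>
      (\<And>v. v \<in> carrier V \<Longrightarrow> g (i v) = tensor_map K F F i i (\<Delta> v)) \<Longrightarrow>
      x \<in> carrier F \<Longrightarrow> g x = free_comult K V \<Delta> x"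
    unfolding e using univ by blast+
qed

theorem free_counit_universal:
  assumes "coalgebra K V \<Delta> \<epsilon>"
  defines "F \<equiv> free_two_algebra K V" and "i \<equiv> free_inj K V"
  shows "two_algebra_hom K F (scalars K) (free_counit K \<epsilon>)"
    and "v \<in> carrier V \<Longrightarrow> free_counit K \<epsilon> (i v) = \<epsilon> v"
    and "two_algebra_hom K F (scalars K) g \<Longrightarrow>
      (\<And>v. v \<in> carrier V \<Longrightarrow> g (i v) = \<epsilon> v) \<Longrightarrow> x \<in> carrier F \<Longrightarrow> g x = free_counit K \<epsilon> x"
proof -
  interpret coalgebra K V \<Delta> \<epsilon> by fact
  note univ = free_two_algebra_universal[OF field_axioms module_axioms
      scalars_two_algebra[OF field_axioms] counit_linear, folded F_def i_def free_counit_def]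
  show "two_algebra_hom K F (scalars K) (free_counit K \<epsilon>)"
    and "v \<in> carrier V \<Longrightarrow> free_counit K \<epsilon> (i v) = \<epsilon> v"
    and "two_algebra_hom K F (scalars K) g \<Longrightarrow>
      (\<And>v. v \<in> carrier V \<Longrightarrow> g (i v) = \<epsilon> v) \<Longrightarrow> x \<in> carrier F \<Longrightarrow> g x = free_counit K \<epsilon> x"
    unfolding free_counit_def using univ unfolding free_counit_def by blast+
qed

end

(*
The coproduct is the largest quotient of the free 2-algebra F on the direct sum of the B_t in which
all u_t become 2-algebra morphisms. In every 2-bialgebra the comultiplication and the counit are
morphisms of 2-algebras, and a morphism of 2-algebras out of F is determined by its composites with
the u_t; moreover it vanishes on L as soon as these composites are morphisms of 2-algebras, because
its kernel is then a two-sided ideal for both multiplications that contains J_0.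

With p : F -> F/L this applies to (p (x) p) o Delta and to epsilon, whose composites with u_t are
(q_t (x) q_t) o Delta_t and epsilon_t. As the kernel of p (x) p is L (x) F + F (x) L, this says that
L is a coideal. Coassociativity, counitality, cocommutativity, and the compatibility of the induced
maps F/L -> C with the coalgebra structures are identities between morphisms of 2-algebras out of
F/L, so it suffices to check them on the images of the B_t, where they hold by assumption.
*)
theory Submission
  imports Defs
begin

section \<open>Tensor products of 2-algebras\<close>

text \<open>The definition of a 2-bialgebra asks the unit and the multiplications to be coalgebra
  maps, whereas equations here are tested on generators of a free 2-algebra, and these determine
  only morphisms of 2-algebras. \<open>two_bialgebra_iff\<close> converts one form into the other;
  it rests on the interchange of the two middle factors of a fourfold tensor product. For an axiom
  to become an equation between morphisms of 2-algebras, every map composed in it has to be one.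
  Hence the lemmas on tensor maps, the swap, the associator and the contractions of a tensor factor
  by the counit. The coalgebra axioms are verified directly on F/L, by transport from the B_t. The
  input from F is that \<open>\<Delta>\<^sub>F\<close> and \<open>\<epsilon>\<^sub>F\<close> are
  morphisms of 2-algebras with known values on the elements u_t x. A further source of length is the
  encoding: \<open>tensor\<close> and \<open>tensor_two_algebra\<close>, or A and
  \<open>diamond A\<close>, are distinct records with the same linear part, and congruence lemmas
  move between them.\<close>

lemma pure_closed [intro, simp]:
  "v \<in> carrier V \<Longrightarrow> w \<in> carrier W \<Longrightarrow> pure K V W v w \<in> carrier (tensor K V W)"
  by (auto simp: pure_def tensor_carrier)

lemma linear_map_id: "linear_map K V V (\<lambda>x. x)" "linear_map K V V id"
  by (auto simp: linear_map_def)

lemma linear_map_comp: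
  "linear_map K V W f \<Longrightarrow> linear_map K W U g \<Longrightarrow> linear_map K V U (\<lambda>x. g (f x))"
  by (auto simp: linear_map_def Pi_def)

lemma bilinear_map_linear_left: "bilinear_map K V W U \<beta> \<Longrightarrow> v \<in> carrier V \<Longrightarrow> linear_map K W U (\<beta> v)"
  and bilinear_map_linear_right:
    "bilinear_map K V W U \<beta> \<Longrightarrow> w \<in> carrier W \<Longrightarrow> linear_map K V U (\<lambda>v. \<beta> v w)"
  by (auto simp: bilinear_map_def)

lemma bilinear_mapI:
  assumes "\<And>v. v \<in> carrier V \<Longrightarrow> linear_map K W U (\<beta> v)"
    and "\<And>w. w \<in> carrier W \<Longrightarrow> linear_map K V U (\<lambda>v. \<beta> v w)"
  shows "bilinear_map K V W U \<beta>"
  using assms by (simp add: bilinear_map_def)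

lemma bilinear_map_comp:
  assumes "bilinear_map K V W U \<beta>" "linear_map K V' V f" "linear_map K W' W g" "linear_map K U U' h"
  shows "bilinear_map K V' W' U' (\<lambda>v w. h (\<beta> (f v) (g w)))"
proof (rule bilinear_mapI)
  fix v assume "v \<in> carrier V'"
  then have "linear_map K W U (\<beta> (f v))"
    by (rule bilinear_map_linear_left[OF assms(1) linear_map_closed[OF assms(2)]])
  from linear_map_comp[OF linear_map_comp[OF assms(3) this] assms(4)]
  show "linear_map K W' U' (\<lambda>w. h (\<beta> (f v) (g w)))" .
next
  fix w assume "w \<in> carrier W'"
  then have "linear_map K V U (\<lambda>v. \<beta> v (g w))"
    by (rule bilinear_map_linear_right[OF assms(1) linear_map_closed[OF assms(3)]])
  from linear_map_comp[OF linear_map_comp[OF assms(2) this] assms(4)]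
  show "linear_map K V' U' (\<lambda>v. h (\<beta> (f v) (g w)))" .
qed

section \<open>2-algebras, their morphisms, and the vector space underlying their tensor
  product\<close>

lemma two_algebra_diamond: "two_algebra K A \<Longrightarrow> assoc_algebra K (diamond A)"
  and two_algebra_assoc: "two_algebra K A \<Longrightarrow> assoc_algebra K A"
  by (simp_all add: two_algebra_def)

lemma two_algebra_module: "two_algebra K A \<Longrightarrow> module K A"
  unfolding two_algebra_def assoc_algebra_def by blast

lemma two_algebra_closed:
  assumes "two_algebra K A"
  shows "\<one>\<^bsub>A\<^esub> \<in> carrier A"
    and "x \<in> carrier A \<Longrightarrow> y \<in> carrier A \<Longrightarrow> x \<otimes>\<^bsub>A\<^esub> y \<in> carrier A"
    and "x \<in> carrier A \<Longrightarrow> y \<in> carrier A \<Longrightarrow> x \<diamondop>\<^bsub>A\<^esub> y \<in> carrier A"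
proof -
  interpret A: assoc_algebra K A using assms by (simp add: two_algebra_def)
  interpret D: assoc_algebra K "diamond A" using assms by (simp add: two_algebra_def)
  show "\<one>\<^bsub>A\<^esub> \<in> carrier A"
    and "x \<in> carrier A \<Longrightarrow> y \<in> carrier A \<Longrightarrow> x \<otimes>\<^bsub>A\<^esub> y \<in> carrier A"
    and "x \<in> carrier A \<Longrightarrow> y \<in> carrier A \<Longrightarrow> x \<diamondop>\<^bsub>A\<^esub> y \<in> carrier A"
    using D.m_closed by auto
qed

lemma two_algebra_bilinear:
  assumes "two_algebra K A"
  shows "bilinear_map K A A A (\<otimes>\<^bsub>A\<^esub>)" "bilinear_map K A A A (\<diamondop>\<^bsub>A\<^esub>)"
  using assoc_algebra_bilinear[OF two_algebra_assoc[OF assms]]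
    assoc_algebra_bilinear[OF two_algebra_diamond[OF assms]]
  by (simp_all add: bilinear_map_def linear_map_def)

lemma two_algebra_hom_iff:
  "two_algebra_hom K A B f \<longleftrightarrow>
     linear_map K A B f \<and> f \<one>\<^bsub>A\<^esub> = \<one>\<^bsub>B\<^esub> \<and>
     (\<forall>x\<in>carrier A. \<forall>y\<in>carrier A. f (x \<otimes>\<^bsub>A\<^esub> y) = f x \<otimes>\<^bsub>B\<^esub> f y) \<and>
     (\<forall>x\<in>carrier A. \<forall>y\<in>carrier A. f (x \<diamondop>\<^bsub>A\<^esub> y) = f x \<diamondop>\<^bsub>B\<^esub> f y)"
  by (auto simp: two_algebra_hom_def ring_hom_def linear_map_def)

lemma two_algebra_hom_linear: "two_algebra_hom K A B f \<Longrightarrow> linear_map K A B f"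
  by (simp add: two_algebra_hom_def)

lemma two_algebra_hom_comp:
  assumes "two_algebra_hom K A B f" "two_algebra_hom K B C g"
  shows "two_algebra_hom K A C (\<lambda>x. g (f x))"
  using assms by (auto simp: two_algebra_hom_iff linear_map_comp linear_map_closed)

lemma two_algebra_hom_id: "two_algebra_hom K A A (\<lambda>x. x)" "two_algebra_hom K A A id"
  by (auto simp: two_algebra_hom_iff linear_map_id)

lemma tensor_two_algebra_simps [simp]:
  "carrier (tensor_two_algebra K A B) = carrier (tensor K A B)"
  "\<zero>\<^bsub>tensor_two_algebra K A B\<^esub> = \<zero>\<^bsub>tensor K A B\<^esub>"
  "\<one>\<^bsub>tensor_two_algebra K A B\<^esub> = pure K A B \<one>\<^bsub>A\<^esub> \<one>\<^bsub>B\<^esub>"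
  "(\<oplus>\<^bsub>tensor_two_algebra K A B\<^esub>) = (\<oplus>\<^bsub>tensor K A B\<^esub>)"
  "(\<odot>\<^bsub>tensor_two_algebra K A B\<^esub>) = (\<odot>\<^bsub>tensor K A B\<^esub>)"
  by (simp_all add: tensor_two_algebra_def)

lemma linear_map_cong:
  assumes "carrier V = carrier V'" "(\<oplus>\<^bsub>V\<^esub>) = (\<oplus>\<^bsub>V'\<^esub>)" "(\<odot>\<^bsub>V\<^esub>) = (\<odot>\<^bsub>V'\<^esub>)"
    and "carrier W = carrier W'" "(\<oplus>\<^bsub>W\<^esub>) = (\<oplus>\<^bsub>W'\<^esub>)" "(\<odot>\<^bsub>W\<^esub>) = (\<odot>\<^bsub>W'\<^esub>)"
  shows "linear_map K V W f \<longleftrightarrow> linear_map K V' W' f"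
  by (simp add: linear_map_def assms)

lemma linear_map_tensor_two_algebra [simp]:
  "linear_map K (tensor_two_algebra K A B) U f \<longleftrightarrow> linear_map K (tensor K A B) U f"
  "linear_map K V (tensor_two_algebra K A B) g \<longleftrightarrow> linear_map K V (tensor K A B) g"
  by (rule linear_map_cong; simp)+

text \<open>Terms, congruence and classes of a tensor product refer only to carriers, additions and
  scalar multiplications. Factors that agree in these data therefore give literally equal tensor
  products, not just isomorphic ones.\<close>

lemma tensor_cong:
  assumes V: "carrier V = carrier V'" "(\<oplus>\<^bsub>V\<^esub>) = (\<oplus>\<^bsub>V'\<^esub>)" "(\<odot>\<^bsub>V\<^esub>) = (\<odot>\<^bsub>V'\<^esub>)"
    and W: "carrier W = carrier W'" "(\<oplus>\<^bsub>W\<^esub>) = (\<oplus>\<^bsub>W'\<^esub>)" "(\<odot>\<^bsub>W\<^esub>) = (\<odot>\<^bsub>W'\<^esub>)"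
  shows "tensor K V W = tensor K V' W'" "pure K V W = pure K V' W'"
proof -
  have w: "tensor_wf K V W = tensor_wf K V' W'"
  proof
    show "tensor_wf K V W t = tensor_wf K V' W' t" for t
      by (induction t) (auto simp: V W)
  qed
  have "tensor_eq K V W s t \<longleftrightarrow> tensor_eq K V' W' s t" for s t
    using tensor_eq_transfer[OF _ V W] tensor_eq_transfer[OF _ V[symmetric] W[symmetric]] by blast
  then have c: "tensor_class K V W = tensor_class K V' W'"
    by (auto simp: tensor_class_def)
  show "tensor K V W = tensor K V' W'" by (simp add: tensor_def c w)
  show "pure K V W = pure K V' W'" by (intro ext) (simp add: pure_def c)
qed

text \<open>Multiplicativity of maps on iterated tensor products needs
  \<open>tensor_two_algebra\<close> as a factor, while the axioms of \<open>coalgebra\<close> are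
  phrased with \<open>tensor\<close>. These rules normalise to the latter.\<close>

lemma tensor_tensor_two_algebra [simp]:
  "tensor K (tensor_two_algebra K A B) W = tensor K (tensor K A B) W"
  "tensor K W (tensor_two_algebra K A B) = tensor K W (tensor K A B)"
  "pure K (tensor_two_algebra K A B) W = pure K (tensor K A B) W"
  "pure K W (tensor_two_algebra K A B) = pure K W (tensor K A B)"
  by (rule tensor_cong; simp)+

section \<open>Extensionality and functoriality of the tensor product\<close>

context
  fixes K :: "('k, 'q) ring_scheme"
  assumes K: "field K"
begin

lemma scalars_module: "module K (scalars K)"
  by (rule two_algebra_module[OF scalars_two_algebra[OF K]])

lemma tensor_ext:
  assumes "module K U"
    and f: "linear_map K (tensor K V W) U f" and g: "linear_map K (tensor K V W) U g"
    and "\<And>v w. v \<in> carrier V \<Longrightarrow> w \<in> carrier W \<Longrightarrow> f (pure K V W v w) = g (pure K V W v w)"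
    and "x \<in> carrier (tensor K V W)"
  shows "f x = g x"
  using assms(5)
proof (induction x rule: tensor_induct)
  case zero
  then show ?case
    by (simp add: linear_map_zero[OF tensor_module[OF K] assms(1) f]
        linear_map_zero[OF tensor_module[OF K] assms(1) g])
qed (use assms in \<open>auto simp: linear_map_add[OF f] linear_map_add[OF g]
    linear_map_smult[OF f] linear_map_smult[OF g]\<close>)

text \<open>This serves to test multiplicativity of a linear map f on a tensor product: f(xy) and
  f(x)f(y) are both bilinear in (x, y), so pairs of pure tensors suffice.\<close>

lemma tensor_bilinear_ext:
  assumes "module K U"
    and f: "bilinear_map K (tensor K V W) (tensor K V' W') U \<beta>"
    and g: "bilinear_map K (tensor K V W) (tensor K V' W') U \<gamma>"
    and eq: "\<And>v w v' w'. v \<in> carrier V \<Longrightarrow> w \<in> carrier W \<Longrightarrow> v' \<in> carrier V' \<Longrightarrow> w' \<in> carrier W' \<Longrightarrow>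
      \<beta> (pure K V W v w) (pure K V' W' v' w') = \<gamma> (pure K V W v w) (pure K V' W' v' w')"
    and "x \<in> carrier (tensor K V W)" "y \<in> carrier (tensor K V' W')"
  shows "\<beta> x y = \<gamma> x y"
proof (rule tensor_ext[OF assms(1) _ _ _ assms(5), of "\<lambda>x. \<beta> x y" "\<lambda>x. \<gamma> x y"])
  fix v w assume vw: "v \<in> carrier V" "w \<in> carrier W"
  show "\<beta> (pure K V W v w) y = \<gamma> (pure K V W v w) y"
    by (rule tensor_ext[OF assms(1) bilinear_map_linear_left[OF f pure_closed[OF vw]]
          bilinear_map_linear_left[OF g pure_closed[OF vw]] eq[OF vw] assms(6)])
qed (use bilinear_map_linear_right[OF f assms(6)] bilinear_map_linear_right[OF g assms(6)] in auto)

lemma pure_map_bilinear: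
  assumes "module K V'" "module K W'" "linear_map K V V' f" "linear_map K W W' g"
  shows "bilinear_map K V W (tensor K V' W') (\<lambda>v w. pure K V' W' (f v) (g w))"
  using bilinear_map_comp[OF pure_bilinear[OF K assms(1,2)] assms(3,4) linear_map_id(1)] .

lemma tensor_map_pure:
  assumes "module K V" "module K W" "module K V'" "module K W'"
    and "linear_map K V V' f" "linear_map K W W' g" "v \<in> carrier V" "w \<in> carrier W"
  shows "tensor_map K V' W' f g (pure K V W v w) = pure K V' W' (f v) (g w)"
  unfolding tensor_map_def
  by (rule tensor_universal(2)[OF K assms(1,2) tensor_module[OF K] pure_map_bilinear])
    (fact assms)+

lemma tensor_map_eqI:
  assumes "module K V" "module K W" "module K V'" "module K W'"
    and "linear_map K V V' f" "linear_map K W W' g"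
    and "linear_map K (tensor K V W) (tensor K V' W') h"
    and "\<And>v w. v \<in> carrier V \<Longrightarrow> w \<in> carrier W \<Longrightarrow> h (pure K V W v w) = pure K V' W' (f v) (g w)"
    and "x \<in> carrier (tensor K V W)"
  shows "tensor_map K V' W' f g x = h x"
  by (rule tensor_ext[OF tensor_module[OF K] tensor_map_linear[OF K assms(1-6)] assms(7) _
      assms(9)])
    (simp add: tensor_map_pure[OF assms(1-6)] assms(8))

lemma tensor_map_comp:
  assumes "module K V" "module K W" "module K V'" "module K W'" "module K V''" "module K W''"
    and "linear_map K V V' f" "linear_map K W W' g" "linear_map K V' V'' f'"
        "linear_map K W' W'' g'"
    and "x \<in> carrier (tensor K V W)"
  shows "tensor_map K V'' W'' f' g' (tensor_map K V' W' f g x) =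
    tensor_map K V'' W'' (\<lambda>v. f' (f v)) (\<lambda>w. g' (g w)) x"
proof (rule tensor_map_eqI[symmetric, OF assms(1,2,5,6)])
  show "linear_map K (tensor K V W) (tensor K V'' W'')
      (\<lambda>x. tensor_map K V'' W'' f' g' (tensor_map K V' W' f g x))"
    by (rule linear_map_comp[OF tensor_map_linear[OF K assms(1-4,7,8)]
        tensor_map_linear[OF K assms(3-6,9,10)]])
  show "linear_map K V V'' (\<lambda>v. f' (f v))" "linear_map K W W'' (\<lambda>w. g' (g w))"
    by (rule linear_map_comp; fact)+
qed (use assms in \<open>simp_all add: tensor_map_pure[OF assms(1-4,7,8)]
    tensor_map_pure[OF assms(3-6,9,10)] linear_map_closed[OF assms(7)]
    linear_map_closed[OF assms(8)]\<close>)

text \<open>The functions agree only on the carriers, so they cannot be rewritten into one another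
  as functions. Linearity of f' and g' is inherited from f and g because carriers are closed under
  the operations.\<close>

lemma tensor_map_cong:
  assumes "module K V" "module K W" "module K V'" "module K W'"
    and "linear_map K V V' f" "linear_map K W W' g"
    and "\<And>v. v \<in> carrier V \<Longrightarrow> f v = f' v" "\<And>w. w \<in> carrier W \<Longrightarrow> g w = g' w"
    and "x \<in> carrier (tensor K V W)"
  shows "tensor_map K V' W' f g x = tensor_map K V' W' f' g' x"
proof -
  interpret V: module K V by fact
  interpret W: module K W by fact
  have "linear_map K V V' f'" "linear_map K W W' g'"
    using assms(5-8) by (simp_all add: linear_map_def Pi_def)
  then show ?thesis
    using tensor_map_eqI[OF assms(1-6) tensor_map_linear[OF K assms(1-4)] _ assms(9), of f' g']
    by (simp add: tensor_map_pure[OF assms(1-4)] assms(7,8))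
qed

end

section \<open>Morphisms of 2-algebras between tensor products\<close>

context
  fixes K :: "('k, 'q) ring_scheme"
  assumes K: "field K"
begin

text \<open>Stated for arbitrary bilinear \<mu> and \<nu> so that one proof covers both
  multiplications, here and in \<open>coalgebra_hom_mult_iff\<close>.\<close>

lemma tensor_mult_bilinear:
  assumes A: "module K A" "bilinear_map K A A A \<mu>" and B: "module K B" "bilinear_map K B B B \<nu>"
  defines "T \<equiv> tensor K A B"
  defines "m \<equiv> tensor_lift2 T (\<lambda>a b a' b'. pure K A B (\<mu> a a') (\<nu> b b'))"
  shows "bilinear_map K T T T m"
    and "a \<in> carrier A \<Longrightarrow> b \<in> carrier B \<Longrightarrow> a' \<in> carrier A \<Longrightarrow> b' \<in> carrier B \<Longrightarrow>
      m (pure K A B a b) (pure K A B a' b') = pure K A B (\<mu> a a') (\<nu> b b')"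
proof -
  note p = pure_map_bilinear[OF K A(1) B(1)]
  have 1: "bilinear_map K A B T (\<lambda>a b. pure K A B (\<mu> a a') (\<nu> b b'))"
    if "a' \<in> carrier A" "b' \<in> carrier B" for a' b'
    unfolding T_def
    by (rule p[OF bilinear_map_linear_right[OF A(2)] bilinear_map_linear_right[OF B(2)]]) fact+
  have 2: "bilinear_map K A B T (\<lambda>a' b'. pure K A B (\<mu> a a') (\<nu> b b'))"
    if "a \<in> carrier A" "b \<in> carrier B" for a b
    unfolding T_def
    by (rule p[OF bilinear_map_linear_left[OF A(2)] bilinear_map_linear_left[OF B(2)]]) fact+
  note L = tensor_lift2_bilinear[OF K A(1) B(1) A(1) B(1) tensor_module[OF K, of A B, folded
      T_def] 1 2,
      folded m_def T_def]
  show "bilinear_map K T T T m" by (rule L(1))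
  show "m (pure K A B a b) (pure K A B a' b') = pure K A B (\<mu> a a') (\<nu> b b')"
    if "a \<in> carrier A" "b \<in> carrier B" "a' \<in> carrier A" "b' \<in> carrier B"
    using that by (intro L(2))
qed

lemma tensor_two_algebra_mult_pure:
  assumes "two_algebra K A" "two_algebra K B"
    and "a \<in> carrier A" "b \<in> carrier B" "a' \<in> carrier A" "b' \<in> carrier B"
  shows "pure K A B a b \<otimes>\<^bsub>tensor_two_algebra K A B\<^esub> pure K A B a' b' = pure K A B (a \<otimes>\<^bsub>A\<^esub> a')
      (b \<otimes>\<^bsub>B\<^esub> b')"
    and "pure K A B a b \<diamondop>\<^bsub>tensor_two_algebra K A B\<^esub> pure K A B a' b' = pure K A B (a \<diamondop>\<^bsub>A\<^esub> a')
        (b \<diamondop>\<^bsub>B\<^esub> b')"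
  using assms
  by (simp_all add: tensor_two_algebra_def two_algebra_module two_algebra_bilinear
      tensor_mult_bilinear(2))

lemma tensor_two_algebra_homI:
  assumes A: "two_algebra K A" and B: "two_algebra K B" and C: "two_algebra K C"
    and f: "linear_map K (tensor K A B) C f"
    and one: "f (pure K A B \<one>\<^bsub>A\<^esub> \<one>\<^bsub>B\<^esub>) = \<one>\<^bsub>C\<^esub>"
    and mult: "\<And>a b a' b'. a \<in> carrier A \<Longrightarrow> b \<in> carrier B \<Longrightarrow> a' \<in> carrier A \<Longrightarrow> b' \<in> carrier B \<Longrightarrow>
      f (pure K A B (a \<otimes>\<^bsub>A\<^esub> a') (b \<otimes>\<^bsub>B\<^esub> b')) = f (pure K A B a b) \<otimes>\<^bsub>C\<^esub> f (pure K A B a' b')"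
    and dmult: "\<And>a b a' b'. a \<in> carrier A \<Longrightarrow> b \<in> carrier B \<Longrightarrow> a' \<in> carrier A \<Longrightarrow> b' \<in> carrier B \<Longrightarrow>
      f (pure K A B (a \<diamondop>\<^bsub>A\<^esub> a') (b \<diamondop>\<^bsub>B\<^esub> b')) = f (pure K A B a b) \<diamondop>\<^bsub>C\<^esub> f (pure K A B a' b')"
  shows "two_algebra_hom K (tensor_two_algebra K A B) C f"
proof -
  let ?T = "tensor_two_algebra K A B"
  have T: "two_algebra K ?T" by (rule tensor_two_algebra_two_algebra[OF A B])
  have f': "linear_map K ?T C f" using f by simp
  \<comment> \<open>\<open>two_algebra_bilinear\<close> speaks of \<open>?T\<close>,
    \<open>tensor_bilinear_ext\<close> of \<open>tensor K A B\<close>; the linear data are the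
    same.\<close>
  have Tc: "bilinear_map K (tensor K A B) (tensor K A B) U \<beta>" if "bilinear_map K ?T ?T U \<beta>" for U \<beta>
    using that by (simp add: bilinear_map_def)
  have left: "bilinear_map K (tensor K A B) (tensor K A B) C (\<lambda>x y. f (\<beta> x y))"
    if "bilinear_map K ?T ?T ?T \<beta>" for \<beta>
    by (rule Tc[OF bilinear_map_comp[OF that linear_map_id(1) linear_map_id(1) f']])
  have right: "bilinear_map K (tensor K A B) (tensor K A B) C (\<lambda>x y. \<beta> (f x) (f y))"
    if "bilinear_map K C C C \<beta>" for \<beta>
    by (rule bilinear_map_comp[OF that f f linear_map_id(1)])
  note ext = tensor_bilinear_ext[OF K two_algebra_module[OF C]]
  have "f (x \<otimes>\<^bsub>?T\<^esub> y) = f x \<otimes>\<^bsub>C\<^esub> f y" if "x \<in> carrier (tensor K A B)" "y \<in> carrier (tensor K A B)"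
      for x y
    by (rule ext[OF left[OF two_algebra_bilinear(1)[OF T]] right[OF two_algebra_bilinear(1)[OF C]]])
      (simp_all add: tensor_two_algebra_mult_pure[OF A B] mult that)
  moreover have "f (x \<diamondop>\<^bsub>?T\<^esub> y) = f x \<diamondop>\<^bsub>C\<^esub> f y" if "x \<in> carrier (tensor K A B)"
      "y \<in> carrier (tensor K A B)" for x y
    by (rule ext[OF left[OF two_algebra_bilinear(2)[OF T]] right[OF two_algebra_bilinear(2)[OF C]]])
      (simp_all add: tensor_two_algebra_mult_pure[OF A B] dmult that)
  ultimately show ?thesis
    using f one by (simp add: two_algebra_hom_iff)
qed

lemma tensor_map_hom:
  assumes A: "two_algebra K A" and B: "two_algebra K B" and A': "two_algebra K A'"
      and B': "two_algebra K B'"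
    and f: "two_algebra_hom K A A' f" and g: "two_algebra_hom K B B' g"
  shows "two_algebra_hom K (tensor_two_algebra K A B) (tensor_two_algebra K A' B')
      (tensor_map K A' B' f g)"
proof -
  note lin = two_algebra_hom_linear[OF f] two_algebra_hom_linear[OF g]
  note mods = two_algebra_module[OF A] two_algebra_module[OF B] two_algebra_module[OF A']
      two_algebra_module[OF B']
  show ?thesis
    by (rule tensor_two_algebra_homI[OF A B tensor_two_algebra_two_algebra[OF A' B']])
      (simp_all add: tensor_map_linear[OF K mods lin] tensor_map_pure[OF K mods lin]
        tensor_two_algebra_mult_pure[OF A' B'] two_algebra_closed[OF A] two_algebra_closed[OF B]
        linear_map_closed[OF lin(1)] linear_map_closed[OF lin(2)]
        f[unfolded two_algebra_hom_iff] g[unfolded two_algebra_hom_iff])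
qed

section \<open>Swap, associator and counit contractions as morphisms of 2-algebras\<close>

lemma pure_swap_bilinear:
  assumes "module K V" "module K W"
  shows "bilinear_map K V W (tensor K W V) (\<lambda>v w. pure K W V w v)"
  using pure_bilinear[OF K assms(2,1)] by (auto simp: bilinear_map_def)

lemma tensor_swap_linear:
  assumes "module K V" "module K W"
  shows "linear_map K (tensor K V W) (tensor K W V) (tensor_swap K V W)"
  and "v \<in> carrier V \<Longrightarrow> w \<in> carrier W \<Longrightarrow> tensor_swap K V W (pure K V W v w) = pure K W V w v"
  unfolding tensor_swap_def
  using tensor_universal(1,2)[OF K assms tensor_module[OF K] pure_swap_bilinear[OF assms]] .

text \<open>With this, cocommutativity becomes an equation between two morphisms of 2-algebras and
  can be tested on generators.\<close>

lemma tensor_swap_hom: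
  assumes A: "two_algebra K A" and B: "two_algebra K B"
  shows "two_algebra_hom K (tensor_two_algebra K A B) (tensor_two_algebra K B A)
      (tensor_swap K A B)"
  by (rule tensor_two_algebra_homI[OF A B tensor_two_algebra_two_algebra[OF B A]])
    (simp_all add: tensor_swap_linear[OF two_algebra_module[OF A] two_algebra_module[OF B]]
      tensor_two_algebra_mult_pure[OF B A] two_algebra_closed[OF A] two_algebra_closed[OF B])

lemma tensor_swap_natural:
  assumes "module K V" "module K W" "module K V'" "module K W'"
    and "linear_map K V V' f" "linear_map K W W' g" "x \<in> carrier (tensor K V W)"
  shows "tensor_swap K V' W' (tensor_map K V' W' f g x) = tensor_map K W' V' g f
      (tensor_swap K V W x)"
  by (rule tensor_ext[OF K tensor_module[OF K]
        linear_map_comp[OF tensor_map_linear[OF K assms(1-6)] tensor_swap_linear(1)[OF assms(3,4)]]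
        linear_map_comp[OF tensor_swap_linear(1)[OF assms(1,2)]
          tensor_map_linear[OF K assms(2,1,4,3,6,5)]] _ assms(7)])
    (simp add: tensor_map_pure[OF K assms(1-6)] tensor_map_pure[OF K assms(2,1,4,3,6,5)]
      tensor_swap_linear(2)[OF assms(1,2)] tensor_swap_linear(2)[OF assms(3,4)]
      linear_map_closed[OF assms(5)] linear_map_closed[OF assms(6)])

lemma tensor_assoc_linear:
  assumes U: "module K U" and V: "module K V" and W: "module K W"
  shows "linear_map K (tensor K (tensor K U V) W) (tensor K U (tensor K V W))
      (tensor_assoc K U V W)"
    and "u \<in> carrier U \<Longrightarrow> v \<in> carrier V \<Longrightarrow> w \<in> carrier W \<Longrightarrow>
      tensor_assoc K U V W (pure K (tensor K U V) W (pure K U V u v) w) =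
      pure K U (tensor K V W) u (pure K V W v w)"
proof -
  let ?UV = "tensor K U V" and ?VW = "tensor K V W" and ?T = "tensor K U (tensor K V W)"
  let ?\<beta> = "\<lambda>w u v. pure K U ?VW u (pure K V W v w)"
  note m = tensor_module[OF K]
  have b: "bilinear_map K U V ?T (?\<beta> w)" if "w \<in> carrier W" for w
    by (rule pure_map_bilinear[OF K U m linear_map_id(1)
          bilinear_map_linear_right[OF pure_bilinear[OF K V W] that]])
  \<comment> \<open>Linearity in X is the universal property of the inner lift. Linearity in w holds
    because a lift depends linearly on the bilinear map that is lifted.\<close>
  have c: "bilinear_map K ?UV W ?T (\<lambda>X w. tensor_lift ?T (?\<beta> w) X)"
  proof (rule bilinear_mapI)
    fix X assume "X \<in> carrier ?UV"
    then show "linear_map K W ?T (\<lambda>w. tensor_lift ?T (?\<beta> w) X)"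
      by (intro tensor_lift_linear_in_map[OF K U V m W] b
          linear_map_comp[OF bilinear_map_linear_left[OF pure_bilinear[OF K V W]]
            bilinear_map_linear_left[OF pure_bilinear[OF K U m]]])
  next
    fix w assume "w \<in> carrier W"
    then show "linear_map K ?UV ?T (tensor_lift ?T (?\<beta> w))"
      by (intro tensor_universal(1)[OF K U V m] b)
  qed
  have e: "tensor_assoc K U V W = tensor_lift ?T (\<lambda>X w. tensor_lift ?T (?\<beta> w) X)"
    by (simp add: tensor_assoc_def Let_def)
  show "linear_map K (tensor K ?UV W) ?T (tensor_assoc K U V W)"
    unfolding e by (rule tensor_universal(1)[OF K m W m c])
  show "tensor_assoc K U V W (pure K ?UV W (pure K U V u v) w) = pure K U ?VW u (pure K V W v w)"
    if "u \<in> carrier U" "v \<in> carrier V" "w \<in> carrier W"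
    unfolding e using that
    by (simp add: tensor_universal(2)[OF K m W m c] tensor_universal(2)[OF K U V m b])
qed

lemma tensor_ext3:
  assumes "module K U" "module K V" "module K W" "module K X"
    and f: "linear_map K (tensor K (tensor K U V) W) X f"
        and g: "linear_map K (tensor K (tensor K U V) W) X g"
    and "\<And>u v w. u \<in> carrier U \<Longrightarrow> v \<in> carrier V \<Longrightarrow> w \<in> carrier W \<Longrightarrow>
      f (pure K (tensor K U V) W (pure K U V u v) w) = g (pure K (tensor K U V) W (pure K U V u v)
          w)"
    and "x \<in> carrier (tensor K (tensor K U V) W)"
  shows "f x = g x"
proof (rule tensor_ext[OF K assms(4) f g _ assms(8)])
  fix y w assume y: "y \<in> carrier (tensor K U V)" and w: "w \<in> carrier W"
  have l: "linear_map K (tensor K U V) (tensor K (tensor K U V) W)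
      (\<lambda>y. pure K (tensor K U V) W y w)"
    by (rule bilinear_map_linear_right[OF pure_bilinear[OF K tensor_module[OF K] assms(3)] w])
  show "f (pure K (tensor K U V) W y w) = g (pure K (tensor K U V) W y w)"
    by (rule tensor_ext[OF K assms(4) linear_map_comp[OF l f] linear_map_comp[OF l g] _ y])
      (simp add: assms(7) w)
qed

lemma tensor_assoc_natural:
  assumes "module K U" "module K V" "module K W" "module K U'" "module K V'" "module K W'"
    and f: "linear_map K U U' f" and g: "linear_map K V V' g" and h: "linear_map K W W' h"
    and "x \<in> carrier (tensor K (tensor K U V) W)"
  shows "tensor_assoc K U' V' W' (tensor_map K (tensor K U' V') W' (tensor_map K U' V' f g) h x) =
    tensor_map K U' (tensor K V' W') f (tensor_map K V' W' g h) (tensor_assoc K U V W x)"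
proof -
  note m = tensor_module[OF K]
  note fg = tensor_map_linear[OF K assms(1,2,4,5) f g]
      and gh = tensor_map_linear[OF K assms(2,3,5,6) g h]
  show ?thesis
    by (rule tensor_ext3[OF assms(1-3) m
        linear_map_comp[OF tensor_map_linear[OF K m assms(3) m assms(6) fg h]
            tensor_assoc_linear(1)[OF assms(4-6)]]
        linear_map_comp[OF tensor_assoc_linear(1)[OF assms(1-3)] tensor_map_linear[OF K assms(1) m
            assms(4) m f gh]]
        _ assms(10)])
      (simp add: tensor_map_pure[OF K m assms(3) m assms(6) fg h]
          tensor_map_pure[OF K assms(1,2,4,5) f g]
        tensor_map_pure[OF K assms(2,3,5,6) g h] tensor_map_pure[OF K assms(1) m assms(4) m f gh]
        tensor_assoc_linear(2)[OF assms(1-3)] tensor_assoc_linear(2)[OF assms(4-6)]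
        linear_map_closed[OF f] linear_map_closed[OF g] linear_map_closed[OF h])
qed

text \<open>\<open>tensor_two_algebra_homI\<close> reduces to pure tensors of (A (x) B) (x) C, whose
  first factor X is still an arbitrary tensor. For fixed c and c' the remaining identity is bilinear
  in X and X', so a second extensionality argument brings it down to pure X and X'.\<close>

lemma tensor_assoc_hom:
  assumes A: "two_algebra K A" and B: "two_algebra K B" and C: "two_algebra K C"
  shows "two_algebra_hom K (tensor_two_algebra K (tensor_two_algebra K A B) C)
    (tensor_two_algebra K A (tensor_two_algebra K B C)) (tensor_assoc K A B C)"
proof -
  let ?AB = "tensor_two_algebra K A B" and ?BC = "tensor_two_algebra K B C"
  let ?T = "tensor_two_algebra K A ?BC" and ?p = "pure K (tensor K A B) C"
  note AB = tensor_two_algebra_two_algebra[OF A B] and BC = tensor_two_algebra_two_algebra[OF B C]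
  note T = tensor_two_algebra_two_algebra[OF A BC]
  note mods = two_algebra_module[OF A] two_algebra_module[OF B] two_algebra_module[OF C]
  let ?f = "tensor_assoc K A B C"
  note lin = tensor_assoc_linear(1)[OF mods]
  have lin': "linear_map K (tensor K (tensor K A B) C) ?T ?f" using lin by simp
  \<comment> \<open>Two versions of the same linear map are kept: \<open>?AB\<close> carries the
    products of A (x) B, while \<open>tensor K A B\<close> is the form that
    \<open>tensor_bilinear_ext\<close> expects.\<close>
  have pl: "linear_map K ?AB ?T (\<lambda>X. ?f (?p X c))" if "c \<in> carrier C" for c
    using linear_map_comp[OF bilinear_map_linear_right[OF pure_bilinear[OF K tensor_module[OF K]
        mods(3)] that] lin']
    by simp
  have pl': "linear_map K (tensor K A B) ?T (\<lambda>X. ?f (?p X c))" if "c \<in> carrier C" for c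
    using pl[OF that] by simp
  have c': "bilinear_map K (tensor K A B) (tensor K A B) U \<beta>" if "bilinear_map K ?AB ?AB U \<beta>"
      for U \<beta>
    using that by (simp add: bilinear_map_def)
  note left = c'[OF bilinear_map_comp[OF _ linear_map_id(1) linear_map_id(1) pl]]
  note right = bilinear_map_comp[OF _ pl' pl' linear_map_id(1)]
  note ext = tensor_bilinear_ext[OF K two_algebra_module[OF T]]
  note pure_simps = tensor_assoc_linear(2)[OF mods] tensor_two_algebra_mult_pure[OF A B]
    tensor_two_algebra_mult_pure[OF B C] tensor_two_algebra_mult_pure[OF A BC, simplified]
    two_algebra_closed[OF A] two_algebra_closed[OF B] two_algebra_closed[OF C]
  have "?f (?p (X \<otimes>\<^bsub>?AB\<^esub> X') (c \<otimes>\<^bsub>C\<^esub> c')) = ?f (?p X c) \<otimes>\<^bsub>?T\<^esub> ?f (?p X' c')"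
    if "X \<in> carrier (tensor K A B)" "X' \<in> carrier (tensor K A B)" "c \<in> carrier C" "c' \<in> carrier C"
        for X X' c c'
    by (rule ext[OF left[OF two_algebra_bilinear(1)[OF AB]]
        right[OF two_algebra_bilinear(1)[OF T]]])
      (use that in \<open>simp_all add: pure_simps\<close>)
  moreover have "?f (?p (X \<diamondop>\<^bsub>?AB\<^esub> X') (c \<diamondop>\<^bsub>C\<^esub> c')) = ?f (?p X c) \<diamondop>\<^bsub>?T\<^esub> ?f (?p X' c')"
    if "X \<in> carrier (tensor K A B)" "X' \<in> carrier (tensor K A B)" "c \<in> carrier C" "c' \<in> carrier C"
        for X X' c c'
    by (rule ext[OF left[OF two_algebra_bilinear(2)[OF AB]]
        right[OF two_algebra_bilinear(2)[OF T]]])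
      (use that in \<open>simp_all add: pure_simps\<close>)
  ultimately show ?thesis
    by (intro tensor_two_algebra_homI[OF AB C T]) (simp_all add: lin pure_simps)
qed

lemma counit_map_bilinear:
  assumes "module K V" "linear_map K V (scalars K) \<epsilon>"
  shows "bilinear_map K V V V (\<lambda>v w. \<epsilon> v \<odot>\<^bsub>V\<^esub> w)" "bilinear_map K V V V (\<lambda>v w. \<epsilon> w \<odot>\<^bsub>V\<^esub> v)"
proof -
  interpret module K V by fact
  have c: "\<epsilon> v \<in> carrier K" if "v \<in> carrier V" for v
    using linear_map_closed[OF assms(2) that] by (simp add: scalars_def)
  have a: "\<epsilon> (v \<oplus>\<^bsub>V\<^esub> w) = \<epsilon> v \<oplus>\<^bsub>K\<^esub> \<epsilon> w" if "v \<in> carrier V" "w \<in> carrier V" for v w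
    using linear_map_add[OF assms(2) that] by (simp add: scalars_def)
  have s: "\<epsilon> (k \<odot>\<^bsub>V\<^esub> w) = k \<otimes>\<^bsub>K\<^esub> \<epsilon> w" if "k \<in> carrier K" "w \<in> carrier V" for k w
    using linear_map_smult[OF assms(2) that] by (simp add: scalars_def)
  show "bilinear_map K V V V (\<lambda>v w. \<epsilon> v \<odot>\<^bsub>V\<^esub> w)" "bilinear_map K V V V (\<lambda>v w. \<epsilon> w \<odot>\<^bsub>V\<^esub> v)"
    unfolding bilinear_map_def linear_map_def
    by (auto simp: c a s smult_l_distr smult_r_distr smult_assoc1[symmetric] R.m_comm)
qed

text \<open>Transports the counit laws: if f intertwines the counits, contracting one factor before
  or after f (x) f makes no difference up to f.\<close>

lemma counit_map_natural:
  assumes V: "module K V" and W: "module K W" and "linear_map K V (scalars K) \<epsilon>"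
      "linear_map K W (scalars K) \<epsilon>'"
    and f: "linear_map K V W f" and e: "\<And>v. v \<in> carrier V \<Longrightarrow> \<epsilon>' (f v) = \<epsilon> v"
    and x: "x \<in> carrier (tensor K V V)"
  shows "tensor_lift W (\<lambda>v w. \<epsilon>' v \<odot>\<^bsub>W\<^esub> w) (tensor_map K W W f f x) = f
      (tensor_lift V (\<lambda>v w. \<epsilon> v \<odot>\<^bsub>V\<^esub> w) x)"
    and "tensor_lift W (\<lambda>v w. \<epsilon>' w \<odot>\<^bsub>W\<^esub> v) (tensor_map K W W f f x) = f
        (tensor_lift V (\<lambda>v w. \<epsilon> w \<odot>\<^bsub>V\<^esub> v) x)"
proof -
  note bV = counit_map_bilinear[OF V assms(3)] and bW = counit_map_bilinear[OF W assms(4)]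
  have c: "\<epsilon> v \<in> carrier K" if "v \<in> carrier V" for v
    using linear_map_closed[OF assms(3) that] by (simp add: scalars_def)
  note lV = tensor_universal[OF K V V V] and lW = tensor_universal[OF K W W W]
  note tl = tensor_map_linear[OF K V V W W f f]
  note simps = tensor_map_pure[OF K V V W W f f] linear_map_closed[OF f] linear_map_smult[OF f] e c
  show "tensor_lift W (\<lambda>v w. \<epsilon>' v \<odot>\<^bsub>W\<^esub> w) (tensor_map K W W f f x) = f
      (tensor_lift V (\<lambda>v w. \<epsilon> v \<odot>\<^bsub>V\<^esub> w) x)"
    by (rule tensor_ext[OF K W linear_map_comp[OF tl lW(1)[OF bW(1)]]
        linear_map_comp[OF lV(1)[OF bV(1)] f] _ x])
      (simp add: simps lV(2)[OF bV(1)] lW(2)[OF bW(1)])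
  show "tensor_lift W (\<lambda>v w. \<epsilon>' w \<odot>\<^bsub>W\<^esub> v) (tensor_map K W W f f x) = f
      (tensor_lift V (\<lambda>v w. \<epsilon> w \<odot>\<^bsub>V\<^esub> v) x)"
    by (rule tensor_ext[OF K W linear_map_comp[OF tl lW(1)[OF bW(2)]]
        linear_map_comp[OF lV(1)[OF bV(2)] f] _ x])
      (simp add: simps lV(2)[OF bV(2)] lW(2)[OF bW(2)])
qed

text \<open>Since \<epsilon> is multiplicative and scalars move freely through products, contracting
  a factor by \<epsilon> respects both multiplications. Each counit law then compares a morphism of
  2-algebras with the identity.\<close>

lemma counit_map_hom:
  assumes A: "two_algebra K A" and e: "two_algebra_hom K A (scalars K) \<epsilon>"
  shows "two_algebra_hom K (tensor_two_algebra K A A) A (tensor_lift A (\<lambda>v w. \<epsilon> v \<odot>\<^bsub>A\<^esub> w))"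
    and "two_algebra_hom K (tensor_two_algebra K A A) A (tensor_lift A (\<lambda>v w. \<epsilon> w \<odot>\<^bsub>A\<^esub> v))"
proof -
  interpret A: assoc_algebra K A using A by (simp add: two_algebra_def)
  interpret D: assoc_algebra K "diamond A" using A by (simp add: two_algebra_def)
  note m = two_algebra_module[OF A]
  note l = two_algebra_hom_linear[OF e]
  note b = counit_map_bilinear[OF m l]
  have c: "\<epsilon> v \<in> carrier K" if "v \<in> carrier A" for v
    using linear_map_closed[OF l that] by (simp add: scalars_def)
  have e': "\<epsilon> \<one>\<^bsub>A\<^esub> = \<one>\<^bsub>K\<^esub>"
    "\<And>x y. x \<in> carrier A \<Longrightarrow> y \<in> carrier A \<Longrightarrow> \<epsilon> (x \<otimes>\<^bsub>A\<^esub> y) = \<epsilon> x \<otimes>\<^bsub>K\<^esub> \<epsilon> y"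
    "\<And>x y. x \<in> carrier A \<Longrightarrow> y \<in> carrier A \<Longrightarrow> \<epsilon> (x \<diamondop>\<^bsub>A\<^esub> y) = \<epsilon> x \<otimes>\<^bsub>K\<^esub> \<epsilon> y"
    using e by (auto simp: two_algebra_hom_iff scalars_def)
  note dm = D.smult_mult_left D.smult_mult_right D.m_closed
  note simps = c e' A.smult_mult_left A.smult_mult_right dm[simplified] A.smult_assoc1[symmetric]
      A.m_comm
  show "two_algebra_hom K (tensor_two_algebra K A A) A (tensor_lift A (\<lambda>v w. \<epsilon> v \<odot>\<^bsub>A\<^esub> w))"
    by (rule tensor_two_algebra_homI[OF A A A])
      (simp_all add: tensor_universal(1,2)[OF K m m m b(1)] simps)
  show "two_algebra_hom K (tensor_two_algebra K A A) A (tensor_lift A (\<lambda>v w. \<epsilon> w \<odot>\<^bsub>A\<^esub> v))"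
    by (rule tensor_two_algebra_homI[OF A A A])
      (simp_all add: tensor_universal(1,2)[OF K m m m b(2)] simps)
qed

end

section \<open>2-bialgebras as 2-algebras with multiplicative comultiplication and counit\<close>

context
  fixes K :: "('k, 'q) ring_scheme"
  assumes K: "field K"
begin

text \<open>Both coalgebra-map conditions are linear on A (x) A, hence decided on pure tensors x (x)
  y. There the comultiplication of A (x) A followed by \<mu> (x) \<mu> is the product of \<Delta> x
  and \<Delta> y in A (x) A.\<close>

lemma coalgebra_hom_mult_iff:
  assumes C: "coalgebra K A \<Delta> \<epsilon>" and \<mu>: "bilinear_map K A A A \<mu>"
  defines "m \<equiv> tensor_lift2 (tensor K A A) (\<lambda>a b a' b'. pure K A A (\<mu> a a') (\<mu> b b'))"
  shows "coalgebra_hom K (tensor K A A) (tensor_comult K A A \<Delta> \<Delta>) (tensor_counit K \<epsilon> \<epsilon>) A \<Delta> \<epsilon>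
      (tensor_lift A \<mu>)
    \<longleftrightarrow> (\<forall>x\<in>carrier A. \<forall>y\<in>carrier A. \<Delta> (\<mu> x y) = m (\<Delta> x) (\<Delta> y) \<and> \<epsilon> (\<mu> x y) = \<epsilon> x \<otimes>\<^bsub>K\<^esub> \<epsilon> y)"
proof -
  interpret coalgebra K A \<Delta> \<epsilon> by fact
  note A = module_axioms and t = tensor_module[OF K]
  let ?T = "tensor K A A" and ?M = "tensor_lift A \<mu>"
  let ?TT = "tensor K ?T ?T"
  note pb = pure_bilinear[OF K A A]
  note M = tensor_universal(1,2)[OF K A A A \<mu>]
  \<comment> \<open>\<open>G\<close> is the interchange of the two middle factors, the part of
    \<open>tensor_comult\<close> that does not involve \<Delta>.\<close>
  define G where "G = tensor_lift2 ?TT (\<lambda>v1 v2 w1 w2. pure K ?T ?T (pure K A A v1 w1)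
      (pure K A A v2 w2))"
  have 1: "bilinear_map K A A ?TT (\<lambda>v1 v2. pure K ?T ?T (pure K A A v1 w1) (pure K A A v2 w2))"
    if "w1 \<in> carrier A" "w2 \<in> carrier A" for w1 w2
    by (rule pure_map_bilinear[OF K t t bilinear_map_linear_right[OF pb]
        bilinear_map_linear_right[OF pb]]) fact+
  have 2: "bilinear_map K A A ?TT (\<lambda>w1 w2. pure K ?T ?T (pure K A A v1 w1) (pure K A A v2 w2))"
    if "v1 \<in> carrier A" "v2 \<in> carrier A" for v1 v2
    by (rule pure_map_bilinear[OF K t t bilinear_map_linear_left[OF pb]
        bilinear_map_linear_left[OF pb]]) fact+
  note G = tensor_lift2_bilinear[OF K A A A A t 1 2, folded G_def]
  note m = tensor_mult_bilinear[OF K A \<mu> A \<mu>, folded m_def]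
  note MM = tensor_map_linear[OF K t t A A M(1) M(1)]
      and MMp = tensor_map_pure[OF K t t A A M(1) M(1)]
  \<comment> \<open>Multiplying after the interchange is the componentwise product: on pure tensors
    both sides are (\<mu> a a') (x) (\<mu> b b').\<close>
  have Gm: "tensor_map K A A ?M ?M (G X Y) = m X Y" if "X \<in> carrier ?T" "Y \<in> carrier ?T" for X Y
    by (rule tensor_bilinear_ext[OF K t bilinear_map_comp[OF G(1) linear_map_id(1)
        linear_map_id(1) MM] m(1)])
      (simp_all add: that G(2) m(2) MMp M(2))
  have Db: "bilinear_map K A A ?TT (\<lambda>v w. G (\<Delta> v) (\<Delta> w))"
    by (rule bilinear_map_comp[OF G(1) comult_linear comult_linear linear_map_id(1)])
  have e: "tensor_comult K A A \<Delta> \<Delta> = tensor_lift ?TT (\<lambda>v w. G (\<Delta> v) (\<Delta> w))"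
    by (simp add: tensor_comult_def G_def Let_def)
  note D = tensor_universal(1,2)[OF K A A t Db, folded e]
  have sb: "bilinear_map K A A (scalars K) (\<lambda>v w. \<epsilon> v \<otimes>\<^bsub>K\<^esub> \<epsilon> w)"
    using bilinear_map_comp[OF two_algebra_bilinear(1)[OF scalars_two_algebra[OF K]] counit_linear
        counit_linear
        linear_map_id(1)] by (simp add: scalars_def)
  note E = tensor_universal(1,2)[OF K A A scalars_module[OF K] sb, folded tensor_counit_def]
  note [simp] = linear_map_closed[OF comult_linear]
  show ?thesis
  proof
    assume h: "coalgebra_hom K ?T (tensor_comult K A A \<Delta> \<Delta>) (tensor_counit K \<epsilon> \<epsilon>) A \<Delta> \<epsilon> ?M"
    show "\<forall>x\<in>carrier A. \<forall>y\<in>carrier A. \<Delta> (\<mu> x y) = m (\<Delta> x) (\<Delta> y) \<and> \<epsilon> (\<mu> x y) = \<epsilon> x \<otimes>\<^bsub>K\<^esub> \<epsilon> y"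
    proof (intro ballI)
      fix x y assume xy: "x \<in> carrier A" "y \<in> carrier A"
      then have "\<Delta> (?M (pure K A A x y)) = tensor_map K A A ?M ?M
          (tensor_comult K A A \<Delta> \<Delta> (pure K A A x y))"
        "\<epsilon> (?M (pure K A A x y)) = tensor_counit K \<epsilon> \<epsilon> (pure K A A x y)"
        using h unfolding coalgebra_hom_def by blast+
      then show "\<Delta> (\<mu> x y) = m (\<Delta> x) (\<Delta> y) \<and> \<epsilon> (\<mu> x y) = \<epsilon> x \<otimes>\<^bsub>K\<^esub> \<epsilon> y"
        by (simp add: xy M(2) D(2) E(2) Gm)
    qed
  next
    assume h: "\<forall>x\<in>carrier A. \<forall>y\<in>carrier A. \<Delta> (\<mu> x y) = m (\<Delta> x) (\<Delta> y) \<and> \<epsilon> (\<mu> x y) = \<epsilon> x \<otimes>\<^bsub>K\<^esub> \<epsilon> y"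
    have "\<Delta> (?M X) = tensor_map K A A ?M ?M (tensor_comult K A A \<Delta> \<Delta> X)" if "X \<in> carrier ?T" for X
      by (rule tensor_ext[OF K t linear_map_comp[OF M(1) comult_linear]
          linear_map_comp[OF D(1) MM] _ that])
        (simp add: M(2) D(2) Gm h)
    moreover have "\<epsilon> (?M X) = tensor_counit K \<epsilon> \<epsilon> X" if "X \<in> carrier ?T" for X
      by (rule tensor_ext[OF K scalars_module[OF K] linear_map_comp[OF M(1) counit_linear] E(1) _
          that])
        (simp add: M(2) E(2) h)
    ultimately show "coalgebra_hom K ?T (tensor_comult K A A \<Delta> \<Delta>) (tensor_counit K \<epsilon> \<epsilon>) A \<Delta> \<epsilon> ?M"
      by (simp add: coalgebra_hom_def M(1))
  qed
qed

text \<open>Both conditions are linear in the scalar c, so the case c = 1 decides them.\<close>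

lemma coalgebra_hom_unit_iff:
  assumes C: "coalgebra K A \<Delta> \<epsilon>" and o: "\<eta> \<in> carrier A"
  shows "coalgebra_hom K (scalars K) (scalars_comult K) id A \<Delta> \<epsilon> (\<lambda>c. c \<odot>\<^bsub>A\<^esub> \<eta>) \<longleftrightarrow>
    \<Delta> \<eta> = pure K A A \<eta> \<eta> \<and> \<epsilon> \<eta> = \<one>\<^bsub>K\<^esub>"
proof -
  interpret coalgebra K A \<Delta> \<epsilon> by fact
  let ?f = "\<lambda>c. c \<odot>\<^bsub>A\<^esub> \<eta>"
  note A = module_axioms and S = scalars_module[OF K]
  have f: "linear_map K (scalars K) A ?f"
    using o by (auto simp: linear_map_def scalars_def smult_l_distr smult_assoc1)
  have D: "\<Delta> (c \<odot>\<^bsub>A\<^esub> \<eta>) = c \<odot>\<^bsub>tensor K A A\<^esub> \<Delta> \<eta>" "\<epsilon> (c \<odot>\<^bsub>A\<^esub> \<eta>) = c \<otimes>\<^bsub>K\<^esub> \<epsilon> \<eta>" if "c \<in> carrier K"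
      for c
    using linear_map_smult[OF comult_linear that o] linear_map_smult[OF counit_linear that o]
    by (simp_all add: scalars_def)
  have S1: "c \<in> carrier K \<Longrightarrow> c \<in> carrier (scalars K)" for c by (simp add: scalars_def)
  have R: "tensor_map K A A ?f ?f (scalars_comult K c) = c \<odot>\<^bsub>tensor K A A\<^esub> pure K A A \<eta> \<eta>"
      if "c \<in> carrier K" for c
    using linear_map_smult[OF bilinear_map_linear_right[OF pure_bilinear[OF K A A] o] that o] o that
    by (simp add: scalars_comult_def tensor_map_pure[OF K S S A A f f] S1)
  interpret T: module K "tensor K A A" by (rule tensor_module[OF K])
  have cl: "\<epsilon> \<eta> \<in> carrier K" "\<Delta> \<eta> \<in> carrier (tensor K A A)"
    using linear_map_closed[OF counit_linear o] linear_map_closed[OF comult_linear o]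
        by (simp_all add: scalars_def)
  have "carrier (scalars K) = carrier K" by (simp add: scalars_def)
  then have "coalgebra_hom K (scalars K) (scalars_comult K) id A \<Delta> \<epsilon> ?f \<longleftrightarrow>
      (\<forall>c\<in>carrier K. c \<odot>\<^bsub>tensor K A A\<^esub> \<Delta> \<eta> = c \<odot>\<^bsub>tensor K A A\<^esub> pure K A A \<eta> \<eta>) \<and>
      (\<forall>c\<in>carrier K. c \<otimes>\<^bsub>K\<^esub> \<epsilon> \<eta> = c)"
    using f by (simp add: coalgebra_hom_def D R)
  also have "\<dots> \<longleftrightarrow> \<Delta> \<eta> = pure K A A \<eta> \<eta> \<and> \<epsilon> \<eta> = \<one>\<^bsub>K\<^esub>"
  proof (intro iffI conjI)
    assume h: "(\<forall>c\<in>carrier K. c \<odot>\<^bsub>tensor K A A\<^esub> \<Delta> \<eta> = c \<odot>\<^bsub>tensor K A A\<^esub> pure K A A \<eta> \<eta>) \<and>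
      (\<forall>c\<in>carrier K. c \<otimes>\<^bsub>K\<^esub> \<epsilon> \<eta> = c)"
    show "\<Delta> \<eta> = pure K A A \<eta> \<eta>" "\<epsilon> \<eta> = \<one>\<^bsub>K\<^esub>"
      using bspec[OF conjunct1[OF h] one_closed] bspec[OF conjunct2[OF h] one_closed] cl o
          by simp_all
  qed simp_all
  finally show ?thesis .
qed

text \<open>This is the form in which the axioms are used and established from here on. The case
  distinction isolates the two conjuncts common to both sides, which the preceding equivalences
  presuppose.\<close>

lemma two_bialgebra_iff:
  "two_bialgebra K A \<Delta> \<epsilon> \<longleftrightarrow> two_algebra K A \<and> coalgebra K A \<Delta> \<epsilon> \<and>
    two_algebra_hom K A (tensor_two_algebra K A A) \<Delta> \<and> two_algebra_hom K A (scalars K) \<epsilon>"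
proof (cases "two_algebra K A \<and> coalgebra K A \<Delta> \<epsilon>")
  case True
  then have A: "two_algebra K A" and C: "coalgebra K A \<Delta> \<epsilon>" by auto
  note b = two_algebra_bilinear[OF A]
  have l: "linear_map K A (tensor K A A) \<Delta>" "linear_map K A (scalars K) \<epsilon>"
    using coalgebra.comult_linear[OF C] coalgebra.counit_linear[OF C] .
  show ?thesis
    unfolding two_bialgebra_def coalgebra_hom_mult_iff[OF C b(1)] coalgebra_hom_mult_iff[OF C b(2)]
      coalgebra_hom_unit_iff[OF C two_algebra_closed(1)[OF A]] two_algebra_hom_iff
    using A C l by (auto simp: tensor_two_algebra_def scalars_def linear_map_def)
qed (auto simp: two_bialgebra_def)

end

section \<open>Submodules and quotients\<close>

lemma submodule_closed:
  assumes "submodule L K V"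
  shows "x \<in> L \<Longrightarrow> x \<in> carrier V" "\<zero>\<^bsub>V\<^esub> \<in> L" "x \<in> L \<Longrightarrow> y \<in> L \<Longrightarrow> x \<oplus>\<^bsub>V\<^esub> y \<in> L"
    "x \<in> L \<Longrightarrow> \<ominus>\<^bsub>V\<^esub> x \<in> L" "c \<in> carrier K \<Longrightarrow> x \<in> L \<Longrightarrow> c \<odot>\<^bsub>V\<^esub> x \<in> L"
proof -
  interpret submodule L K V by fact
  show "x \<in> L \<Longrightarrow> x \<in> carrier V" "\<zero>\<^bsub>V\<^esub> \<in> L" "x \<in> L \<Longrightarrow> y \<in> L \<Longrightarrow> x \<oplus>\<^bsub>V\<^esub> y \<in> L"
    "x \<in> L \<Longrightarrow> \<ominus>\<^bsub>V\<^esub> x \<in> L" "c \<in> carrier K \<Longrightarrow> x \<in> L \<Longrightarrow> c \<odot>\<^bsub>V\<^esub> x \<in> L"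
    using mem_carrier[of x] one_closed m_closed[of x y] m_inv_closed[of x] smult_closed[of c x]
    by (simp_all add: a_inv_def)
qed

lemma linear_span_submodule:
  assumes "module K V" "S \<subseteq> carrier V"
  shows "submodule (linear_span K V S) K V"
proof -
  interpret module K V by fact
  have "linear_span K V S \<subseteq> carrier V"
    using carrier_is_submodule assms(2) by (auto simp: linear_span_def)
  then show ?thesis
    by (rule submoduleI) (auto simp: linear_span_def intro: submodule_closed(2-5))
qed

lemma linear_span_superset: "S \<subseteq> linear_span K V S"
  by (auto simp: linear_span_def)

lemma linear_span_minimal: "submodule N K V \<Longrightarrow> S \<subseteq> N \<Longrightarrow> linear_span K V S \<subseteq> N"
  by (auto simp: linear_span_def)

lemma submodule_kernel:
  assumes "module K V" "module K W" "linear_map K V W f"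
  shows "submodule {x \<in> carrier V. f x = \<zero>\<^bsub>W\<^esub>} K V"
proof -
  interpret V: module K V by fact
  interpret W: module K W by fact
  show ?thesis
  proof (rule V.submoduleI)
    fix a assume a: "a \<in> {x \<in> carrier V. f x = \<zero>\<^bsub>W\<^esub>}"
    then have "f (\<ominus>\<^bsub>V\<^esub> a \<oplus>\<^bsub>V\<^esub> a) = f (\<ominus>\<^bsub>V\<^esub> a) \<oplus>\<^bsub>W\<^esub> f a" "f (\<ominus>\<^bsub>V\<^esub> a) \<in> carrier W"
      using linear_map_add[OF assms(3)] linear_map_closed[OF assms(3)] by auto
    then show "\<ominus>\<^bsub>V\<^esub> a \<in> {x \<in> carrier V. f x = \<zero>\<^bsub>W\<^esub>}"
      using a by (simp add: V.M.l_neg linear_map_zero[OF assms])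
  qed (auto simp: linear_map_zero[OF assms] linear_map_add[OF assms(3)]
      linear_map_smult[OF assms(3)])
qed

lemma linear_map_minus:
  assumes "module K V" "module K W" "linear_map K V W f" "x \<in> carrier V" "y \<in> carrier V"
  shows "f (x \<ominus>\<^bsub>V\<^esub> y) = f x \<ominus>\<^bsub>W\<^esub> f y"
proof -
  interpret V: module K V by fact
  interpret W: module K W by fact
  have "f (\<ominus>\<^bsub>V\<^esub> y \<oplus>\<^bsub>V\<^esub> y) = f (\<ominus>\<^bsub>V\<^esub> y) \<oplus>\<^bsub>W\<^esub> f y" "f (\<ominus>\<^bsub>V\<^esub> y) \<in> carrier W" "f y \<in> carrier W"
    using linear_map_add[OF assms(3)] linear_map_closed[OF assms(3)] assms(5) by auto
  then have "f (\<ominus>\<^bsub>V\<^esub> y) = \<ominus>\<^bsub>W\<^esub> f y"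
    using assms(5) W.M.minus_equality[of "f (\<ominus>\<^bsub>V\<^esub> y)" "f y"]
    by (simp add: V.M.l_neg linear_map_zero[OF assms(1-3)])
  then show ?thesis
    using assms(4,5) linear_map_add[OF assms(3)] by (simp add: a_minus_def)
qed

section \<open>Inheritance of module and algebra axioms by images\<close>

lemma module_image:
  assumes "module K A" "carrier Q = p ` carrier A" "\<zero>\<^bsub>Q\<^esub> = p \<zero>\<^bsub>A\<^esub>"
    and add: "\<And>x y. x \<in> carrier A \<Longrightarrow> y \<in> carrier A \<Longrightarrow> p x \<oplus>\<^bsub>Q\<^esub> p y = p (x \<oplus>\<^bsub>A\<^esub> y)"
    and smult: "\<And>c x. c \<in> carrier K \<Longrightarrow> x \<in> carrier A \<Longrightarrow> c \<odot>\<^bsub>Q\<^esub> p x = p (c \<odot>\<^bsub>A\<^esub> x)"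
  shows "module K Q"
proof -
  interpret module K A by fact
  show ?thesis
  proof (rule moduleI[OF R.is_cring], rule abelian_groupI)
    fix x assume "x \<in> carrier Q"
    then obtain a where "a \<in> carrier A" "x = p a" by (auto simp: assms(2))
    then show "\<exists>y\<in>carrier Q. y \<oplus>\<^bsub>Q\<^esub> x = \<zero>\<^bsub>Q\<^esub>"
      by (intro bexI[of _ "p (\<ominus>\<^bsub>A\<^esub> a)"]) (auto simp: assms(2,3) add M.l_neg)
  qed (auto simp: assms(2,3) add smult M.a_ac smult_l_distr smult_r_distr smult_assoc1)
qed

text \<open>The axioms are identities, so they pass to Q along a surjection compatible with the
  operations. Applied to the coset map, once for each multiplication, this avoids computing with
  cosets as sets.\<close>

lemma assoc_algebra_image:
  assumes "assoc_algebra K A" "module K Q" "carrier Q = p ` carrier A" "\<one>\<^bsub>Q\<^esub> = p \<one>\<^bsub>A\<^esub>"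
    and "linear_map K A Q p"
    and mult: "\<And>x y. x \<in> carrier A \<Longrightarrow> y \<in> carrier A \<Longrightarrow> p x \<otimes>\<^bsub>Q\<^esub> p y = p (x \<otimes>\<^bsub>A\<^esub> y)"
  shows "assoc_algebra K Q"
proof -
  interpret A: assoc_algebra K A by fact
  have add: "p x \<oplus>\<^bsub>Q\<^esub> p y = p (x \<oplus>\<^bsub>A\<^esub> y)" if "x \<in> carrier A" "y \<in> carrier A" for x y
    using linear_map_add[OF assms(5) that] by simp
  have smult: "c \<odot>\<^bsub>Q\<^esub> p x = p (c \<odot>\<^bsub>A\<^esub> x)" if "c \<in> carrier K" "x \<in> carrier A" for c x
    using linear_map_smult[OF assms(5) that] by simp
  show ?thesis
    by (rule assoc_algebraI[OF A.field_axioms assms(2)])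
      (auto simp: assms(3,4) mult add smult A.m_assoc bilinear_map_def linear_map_def A.l_distr
          A.r_distr
        A.smult_mult_left A.smult_mult_right)
qed

section \<open>The quotient of a vector space by a subspace\<close>

context
  fixes K :: "('k, 'q) ring_scheme" and A :: "('k, 'a, 'm) two_algebra_scheme" and L :: "'a set"
  assumes A: "module K A" and L: "submodule L K A"
begin

lemma submodule_abelian_subgroup: "abelian_subgroup L A"
  using A L abelian_subgroupI3[of L A]
  by (simp add: module_def submodule_def additive_subgroup_def)

lemma coset_eq_iff:
  assumes "x \<in> carrier A" "y \<in> carrier A"
  shows "L +>\<^bsub>A\<^esub> x = L +>\<^bsub>A\<^esub> y \<longleftrightarrow> x \<ominus>\<^bsub>A\<^esub> y \<in> L"
proof -
  interpret abelian_subgroup L A by (rule submodule_abelian_subgroup)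
  show ?thesis
    using a_rcos_module[OF assms(2,1)] a_repr_independence'[OF _ assms(2), of x]
      a_repr_independenceD[OF assms(1), of y]
    by (auto simp: a_minus_def)
qed

lemma coset_self: "x \<in> carrier A \<Longrightarrow> x \<in> L +>\<^bsub>A\<^esub> x"
  by (rule abelian_subgroup.a_rcos_self[OF submodule_abelian_subgroup])

lemma mem_coset_iff:
  assumes "x \<in> carrier A"
  shows "y \<in> L +>\<^bsub>A\<^esub> x \<longleftrightarrow> y \<in> carrier A \<and> L +>\<^bsub>A\<^esub> y = L +>\<^bsub>A\<^esub> x"
proof -
  interpret abelian_subgroup L A by (rule submodule_abelian_subgroup)
  show ?thesis
    using a_repr_independence'[OF _ assms, of y] a_rcos_self[of y]
        a_elemrcos_carrier[OF assms, of y] by auto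
qed

lemma coset_zero: "L +>\<^bsub>A\<^esub> \<zero>\<^bsub>A\<^esub> = L"
proof -
  interpret module K A by (rule A)
  show ?thesis using M.a_coset_add_zero submodule_closed(1)[OF L] by blast
qed

lemma coset_eq_zero_iff: "x \<in> carrier A \<Longrightarrow> L +>\<^bsub>A\<^esub> x = L \<longleftrightarrow> x \<in> L"
proof -
  interpret module K A by (rule A)
  show "x \<in> carrier A \<Longrightarrow> L +>\<^bsub>A\<^esub> x = L \<longleftrightarrow> x \<in> L"
    using coset_eq_iff[of x "\<zero>\<^bsub>A\<^esub>"] using M.minus_equality[of "\<zero>\<^bsub>A\<^esub>" "\<zero>\<^bsub>A\<^esub>"]
    by (simp add: coset_zero a_minus_def)
qed

lemma quotient_carrier: "carrier (quotient_two_algebra A L) = (\<lambda>x. L +>\<^bsub>A\<^esub> x) ` carrier A"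
  and quotient_zero: "\<zero>\<^bsub>quotient_two_algebra A L\<^esub> = L"
  and quotient_one: "\<one>\<^bsub>quotient_two_algebra A L\<^esub> = L +>\<^bsub>A\<^esub> \<one>\<^bsub>A\<^esub>"
  by (auto simp: quotient_two_algebra_def A_RCOSETS_def')

lemma quotient_add:
  assumes "x \<in> carrier A" "y \<in> carrier A"
  shows "(L +>\<^bsub>A\<^esub> x) \<oplus>\<^bsub>quotient_two_algebra A L\<^esub> (L +>\<^bsub>A\<^esub> y) = L +>\<^bsub>A\<^esub> (x \<oplus>\<^bsub>A\<^esub> y)"
  using abelian_subgroup.a_rcos_sum[OF submodule_abelian_subgroup assms]
  by (simp add: quotient_two_algebra_def)

text \<open>The scalar multiple of a coset is encoded as a union over its representatives. All
  members of this union coincide, because c y - c x = c (y - x) lies in L.\<close>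

lemma quotient_smult:
  assumes c: "c \<in> carrier K" and x: "x \<in> carrier A"
  shows "c \<odot>\<^bsub>quotient_two_algebra A L\<^esub> (L +>\<^bsub>A\<^esub> x) = L +>\<^bsub>A\<^esub> (c \<odot>\<^bsub>A\<^esub> x)"
proof -
  interpret module K A by (rule A)
  have "L +>\<^bsub>A\<^esub> (c \<odot>\<^bsub>A\<^esub> y) = L +>\<^bsub>A\<^esub> (c \<odot>\<^bsub>A\<^esub> x)" if "y \<in> L +>\<^bsub>A\<^esub> x" for y
  proof -
    have y: "y \<in> carrier A" "y \<ominus>\<^bsub>A\<^esub> x \<in> L"
      using that x by (auto simp: mem_coset_iff coset_eq_iff)
    then have "c \<odot>\<^bsub>A\<^esub> y \<ominus>\<^bsub>A\<^esub> c \<odot>\<^bsub>A\<^esub> x = c \<odot>\<^bsub>A\<^esub> (y \<ominus>\<^bsub>A\<^esub> x)"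
      using c x by (simp add: a_minus_def smult_r_distr smult_r_minus)
    then show ?thesis
      using y c x submodule_closed(5)[OF L c] by (simp add: coset_eq_iff)
  qed
  then have "(\<Union>y\<in>L +>\<^bsub>A\<^esub> x. L +>\<^bsub>A\<^esub> (c \<odot>\<^bsub>A\<^esub> y)) = (\<Union>y\<in>L +>\<^bsub>A\<^esub> x. L +>\<^bsub>A\<^esub> (c \<odot>\<^bsub>A\<^esub> x))"
    by (rule SUP_cong[OF HOL.refl])
  also have "\<dots> = L +>\<^bsub>A\<^esub> (c \<odot>\<^bsub>A\<^esub> x)"
    using coset_self[OF x] by auto
  finally show ?thesis by (simp add: quotient_two_algebra_def)
qed

lemma quotient_module: "module K (quotient_two_algebra A L)"
  by (rule module_image[OF A quotient_carrier])
    (simp_all add: quotient_zero coset_zero quotient_add quotient_smult)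

lemma quotient_map_linear: "linear_map K A (quotient_two_algebra A L) (\<lambda>x. L +>\<^bsub>A\<^esub> x)"
  by (auto simp: linear_map_def quotient_carrier quotient_add quotient_smult)

text \<open>f is constant on each coset, so the image of a coset is a singleton and
  \<open>the_elem\<close> extracts its element. \<open>quotient_comult\<close> and
  \<open>quotient_counit\<close> are encoded in this way.\<close>

lemma quotient_lift:
  assumes C: "module K C" and f: "linear_map K A C f" and L0: "\<And>x. x \<in> L \<Longrightarrow> f x = \<zero>\<^bsub>C\<^esub>"
  shows "x \<in> carrier A \<Longrightarrow> the_elem (f ` (L +>\<^bsub>A\<^esub> x)) = f x"
    and "linear_map K (quotient_two_algebra A L) C (\<lambda>X. the_elem (f ` X))"
proof -
  interpret A: module K A by (rule A)
  interpret C: module K C by (rule C)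
  show e: "the_elem (f ` (L +>\<^bsub>A\<^esub> x)) = f x" if x: "x \<in> carrier A" for x
  proof -
    have "f y = f x" if "y \<in> L +>\<^bsub>A\<^esub> x" for y
    proof -
      have y: "y \<in> carrier A" "y \<ominus>\<^bsub>A\<^esub> x \<in> L"
        using that x by (auto simp: mem_coset_iff coset_eq_iff)
      then have "f y \<ominus>\<^bsub>C\<^esub> f x = \<zero>\<^bsub>C\<^esub>"
        using linear_map_minus[OF A C f y(1) x] L0 by simp
      then show ?thesis
        using C.M.minus_equality[of "f y" "\<ominus>\<^bsub>C\<^esub> f x"] linear_map_closed[OF f] x y(1)
        by (simp add: a_minus_def)
    qed
    then have "f ` (L +>\<^bsub>A\<^esub> x) = {f x}" using coset_self[OF x] by blast
    then show ?thesis by simp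
  qed
  show "linear_map K (quotient_two_algebra A L) C (\<lambda>X. the_elem (f ` X))"
    by (auto simp: linear_map_def quotient_carrier quotient_add quotient_smult e
        linear_map_add[OF f] linear_map_smult[OF f] linear_map_closed[OF f])
qed

end

section \<open>The kernel of the tensor square of a quotient map\<close>

lemma submodule_cong:
  assumes "carrier V = carrier V'" "\<zero>\<^bsub>V\<^esub> = \<zero>\<^bsub>V'\<^esub>" "(\<oplus>\<^bsub>V\<^esub>) = (\<oplus>\<^bsub>V'\<^esub>)" "(\<odot>\<^bsub>V\<^esub>) = (\<odot>\<^bsub>V'\<^esub>)"
  shows "submodule N K V \<longleftrightarrow> submodule N K V'"
  by (simp add: submodule_def submodule_axioms_def subgroup_def m_inv_def assms)

text \<open>
  The map \<open>Q \<otimes> Q \<rightarrow> (F \<otimes> F) / N\<close> induced by \<open>(x + L, y + L) \<mapsto> x \<otimes> y + N\<close>, with \<open>N\<close> the span below,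
  composed with \<open>tensor_map K Q Q p p\<close> is the projection modulo \<open>N\<close>.
\<close>

lemma tensor_map_quotient_kernel:
  fixes K :: "('k, 'q) ring_scheme" and F :: "('k, 'a, 'm) two_algebra_scheme"
  assumes K: "field K" and F: "module K F" and L: "submodule L K F"
  defines "Q \<equiv> quotient_two_algebra F L" and "p \<equiv> (\<lambda>x. L +>\<^bsub>F\<^esub> x)"
  assumes z: "z \<in> carrier (tensor K F F)" and z0: "tensor_map K Q Q p p z = \<zero>\<^bsub>tensor K Q Q\<^esub>"
  shows "z \<in> linear_span K (tensor K F F)
       ({pure K F F x y | x y. x \<in> L \<and> y \<in> carrier F} \<union>
        {pure K F F x y | x y. x \<in> carrier F \<and> y \<in> L})" (is "z \<in> linear_span K _ ?S")
proof -
  \<comment> \<open>\<open>quotient_two_algebra\<close> expects a 2-algebra record, so the vector space \<open>?T\<close> is quotiented in the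
    guise of \<open>?T'\<close>; \<open>N\<close> need not be an ideal, and the multiplications of \<open>?T'\<close> play no role.\<close>
  let ?T = "tensor K F F" and ?T' = "tensor_two_algebra K F F"
  define N where "N = linear_span K ?T ?S"
  interpret F: module K F by (rule F)
  interpret T: module K ?T by (rule tensor_module[OF K])
  note Lc = submodule_closed[OF L]
  have "submodule N K ?T"
    unfolding N_def by (rule linear_span_submodule[OF tensor_module[OF K]]) (auto intro: Lc)
  then have N: "submodule N K ?T'" by (simp add: submodule_cong[of ?T' ?T])
  have T': "module K ?T'" by (rule module_cong[OF tensor_module[OF K]]) simp_all
  have T_minus: "z \<ominus>\<^bsub>?T'\<^esub> z' = z \<ominus>\<^bsub>?T\<^esub> z'" for z z'
    by (simp add: a_minus_def a_inv_def m_inv_def)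
  let ?R = "quotient_two_algebra ?T' N"
  note R = quotient_module[OF T' N] and Q = quotient_module[OF F L, folded Q_def]
  note r = quotient_map_linear[OF T' N] and p = quotient_map_linear[OF F L, folded Q_def, folded
      p_def]
  note pb = pure_bilinear[OF K F F]
  \<comment> \<open>\<open>s\<close> chooses a representative of each coset, which makes
    \<open>b\<close> a total function; \<open>bp\<close> shows that its values do not depend on the
    choice.\<close>
  define s where "s X = (SOME x. x \<in> carrier F \<and> p x = X)" for X
  have s: "s (p x) \<in> carrier F" "p (s (p x)) = p x" if "x \<in> carrier F" for x
    using someI[of "\<lambda>y. y \<in> carrier F \<and> p y = p x" x] that by (auto simp: s_def)
  define b where "b X Y = N +>\<^bsub>?T'\<^esub> pure K F F (s X) (s Y)" for X Y
  have bp: "b (p x) (p y) = N +>\<^bsub>?T'\<^esub> pure K F F x y" if x: "x \<in> carrier F" and y: "y \<in> carrier F"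
      for x y
  proof -
    let ?x = "s (p x)" and ?y = "s (p y)"
    have l: "?x \<ominus>\<^bsub>F\<^esub> x \<in> L" "?y \<ominus>\<^bsub>F\<^esub> y \<in> L"
      using coset_eq_iff[OF F L s(1)[OF x] x] coset_eq_iff[OF F L s(1)[OF y] y] s(2) x y
      by (auto simp: p_def)
    have m: "pure K F F (?x \<ominus>\<^bsub>F\<^esub> x) ?y \<in> N" "pure K F F x (?y \<ominus>\<^bsub>F\<^esub> y) \<in> N"
      unfolding N_def
      by (rule subsetD[OF linear_span_superset], use l s(1) x y in blast)+
    \<comment> \<open>The representatives are exchanged one at a time; each exchange changes the
      pure tensor by a generator of \<open>N\<close>.\<close>
    have "N +>\<^bsub>?T'\<^esub> pure K F F ?x ?y = N +>\<^bsub>?T'\<^esub> pure K F F x ?y"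
      using m(1) linear_map_minus[OF F tensor_module[OF K]
          bilinear_map_linear_right[OF pb s(1)[OF y]] s(1)[OF x] x] s(1) x y
      by (simp add: coset_eq_iff[OF T' N] T_minus)
    also have "\<dots> = N +>\<^bsub>?T'\<^esub> pure K F F x y"
      using m(2) linear_map_minus[OF F tensor_module[OF K] bilinear_map_linear_left[OF pb x]
          s(1)[OF y] y] s(1) x y
      by (simp add: coset_eq_iff[OF T' N] T_minus)
    finally show ?thesis by (simp add: b_def)
  qed
  have Qc: "carrier Q = p ` carrier F" by (simp add: Q_def p_def quotient_carrier[OF F L])
  have Qo: "p x \<oplus>\<^bsub>Q\<^esub> p y = p (x \<oplus>\<^bsub>F\<^esub> y)" if "x \<in> carrier F" "y \<in> carrier F" for x y
    using that by (simp add: Q_def p_def quotient_add[OF F L])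
  have Qs: "c \<odot>\<^bsub>Q\<^esub> p x = p (c \<odot>\<^bsub>F\<^esub> x)" if "c \<in> carrier K" "x \<in> carrier F" for c x
    using that by (simp add: Q_def p_def quotient_smult[OF F L])
  have cp: "linear_map K F ?R (\<lambda>y. N +>\<^bsub>?T'\<^esub> pure K F F x y)"
    "linear_map K F ?R (\<lambda>y. N +>\<^bsub>?T'\<^esub> pure K F F y x)" if "x \<in> carrier F" for x
    using linear_map_comp[OF bilinear_map_linear_left[OF pb that]]
        linear_map_comp[OF bilinear_map_linear_right[OF pb that]]
      r by simp_all
  have b: "bilinear_map K Q Q ?R b"
    unfolding bilinear_map_def linear_map_def
    by (auto simp: Qc Qo Qs bp linear_map_closed[OF cp(1)] linear_map_closed[OF cp(2)]
        linear_map_add[OF cp(1)]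
        linear_map_add[OF cp(2)] linear_map_smult[OF cp(1)] linear_map_smult[OF cp(2)])
  note lift = tensor_universal(1,2)[OF K Q Q R b]
  have r': "linear_map K ?T ?R (\<lambda>z. N +>\<^bsub>?T'\<^esub> z)" using r by simp
  \<comment> \<open>Both sides are linear in z and agree on pure tensors by \<open>bp\<close>. For
    the given z the left side vanishes, so z lies in \<open>N\<close>.\<close>
  have "tensor_lift ?R b (tensor_map K Q Q p p z) = N +>\<^bsub>?T'\<^esub> z"
    by (rule tensor_ext[OF K R linear_map_comp[OF tensor_map_linear[OF K F F Q Q p p] lift(1)] r'
        _ z])
      (simp add: tensor_map_pure[OF K F F Q Q p p] lift(2) linear_map_closed[OF p] bp)
  then have "N +>\<^bsub>?T'\<^esub> z = N"
    using linear_map_zero[OF tensor_module[OF K] R lift(1)] by (simp add: z0 quotient_zero[OF T' N])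
  then show ?thesis
    using coset_eq_zero_iff[OF T' N, of z] z by (simp add: N_def)
qed

lemma ideal_submodule:
  assumes "two_algebra K A" "ideal L A"
  shows "submodule L K A"
proof -
  interpret assoc_algebra K A using assms(1) by (simp add: two_algebra_def)
  interpret ideal L A by fact
  show ?thesis
  proof (rule submoduleI)
    fix c x assume cx: "c \<in> carrier K" "x \<in> L"
    then have "c \<odot>\<^bsub>A\<^esub> x = (c \<odot>\<^bsub>A\<^esub> \<one>\<^bsub>A\<^esub>) \<otimes>\<^bsub>A\<^esub> x" by (simp add: smult_mult_left)
    also have "\<dots> \<in> L" using cx by (intro I_l_closed) auto
    finally show "c \<odot>\<^bsub>A\<^esub> x \<in> L" .
  qed (auto intro: a_closed)
qed

lemma a_r_coset_diamond: "(+>\<^bsub>diamond A\<^esub>) = (+>\<^bsub>A\<^esub>)"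
  by (simp add: a_r_coset_def r_coset_def fun_eq_iff)

section \<open>Quotients of 2-algebras by ideals for both multiplications\<close>

context
  fixes K :: "('k, 'q) ring_scheme" and A :: "('k, 'a, 'm) two_algebra_scheme" and L :: "'a set"
  assumes A: "two_algebra K A" and L: "ideal L A" and L': "ideal L (diamond A)"
begin

lemma quotient_mult:
  assumes "x \<in> carrier A" "y \<in> carrier A"
  shows "(L +>\<^bsub>A\<^esub> x) \<otimes>\<^bsub>quotient_two_algebra A L\<^esub> (L +>\<^bsub>A\<^esub> y) = L +>\<^bsub>A\<^esub> (x \<otimes>\<^bsub>A\<^esub> y)"
    and "(L +>\<^bsub>A\<^esub> x) \<diamondop>\<^bsub>quotient_two_algebra A L\<^esub> (L +>\<^bsub>A\<^esub> y) = L +>\<^bsub>A\<^esub> (x \<diamondop>\<^bsub>A\<^esub> y)"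
  using ideal.rcoset_mult_add[OF L assms] ideal.rcoset_mult_add[OF L', of x y] assms
  by (simp_all add: quotient_two_algebra_def a_r_coset_diamond)

lemma quotient_two_algebra_two_algebra: "two_algebra K (quotient_two_algebra A L)"
proof -
  let ?Q = "quotient_two_algebra A L" and ?p = "\<lambda>x. L +>\<^bsub>A\<^esub> x"
  note mL = two_algebra_module[OF A] ideal_submodule[OF A L]
  note p = quotient_map_linear[OF mL]
  have "assoc_algebra K ?Q"
    by (rule assoc_algebra_image[OF two_algebra_assoc[OF A] quotient_module[OF mL]
        quotient_carrier[OF mL] _ p])
      (simp_all add: quotient_one[OF mL] quotient_mult)
  moreover have "assoc_algebra K (diamond ?Q)"
  proof (rule assoc_algebra_image[OF two_algebra_diamond[OF A]
      module_diamond[OF quotient_module[OF mL]], of ?p])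
    show "linear_map K (diamond A) (diamond ?Q) ?p" using p by (simp add: linear_map_def)
  qed (simp_all add: quotient_carrier[OF mL] quotient_one[OF mL] quotient_mult)
  ultimately show ?thesis by (simp add: two_algebra_def)
qed

lemma quotient_map_hom: "two_algebra_hom K A (quotient_two_algebra A L) (\<lambda>x. L +>\<^bsub>A\<^esub> x)"
  using quotient_map_linear[OF two_algebra_module[OF A] ideal_submodule[OF A L]]
  by (simp add: two_algebra_hom_iff quotient_mult
      quotient_one[OF two_algebra_module[OF A] ideal_submodule[OF A L]])

lemma quotient_lift_hom:
  assumes C: "two_algebra K C" and f: "two_algebra_hom K A C f" and L0: "\<And>x. x \<in> L \<Longrightarrow> f x = \<zero>\<^bsub>C\<^esub>"
  shows "two_algebra_hom K (quotient_two_algebra A L) C (\<lambda>X. the_elem (f ` X))"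
proof -
  note mL = two_algebra_module[OF A] ideal_submodule[OF A L]
  note l = quotient_lift[OF mL two_algebra_module[OF C] two_algebra_hom_linear[OF f] L0]
  show ?thesis
    using l(2) f
    by (auto simp: two_algebra_hom_iff quotient_carrier[OF mL] quotient_one[OF mL] quotient_mult
        l(1)
        two_algebra_closed[OF A])
qed

end

section \<open>Direct sums\<close>

text \<open>The linear map out of the direct sum with components \<open>h l\<close>. Both
  \<open>dsum_comult\<close> and \<open>dsum_counit\<close> are of this shape, so that their
  linearity and their values on the summands follow from one lemma.\<close>

definition dsum_lift ::
    "('i \<Rightarrow> ('k, 'a, 'm) module_scheme) \<Rightarrow> 'i set \<Rightarrow> ('k, 'b, 'n) module_scheme
      \<Rightarrow> ('i \<Rightarrow> 'a \<Rightarrow> 'b) \<Rightarrow> ('i \<Rightarrow> 'a) \<Rightarrow> 'b" where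
  "dsum_lift B I W h f = (\<Oplus>\<^bsub>W\<^esub> l \<in> {l \<in> I. f l \<noteq> \<zero>\<^bsub>B l\<^esub>}. h l (f l))"

context
  fixes K :: "('k, 'q) ring_scheme" and I :: "'i set" and B :: "'i \<Rightarrow> ('k, 'a, 'm) module_scheme"
  assumes K: "field K" and B: "\<And>l. l \<in> I \<Longrightarrow> module K (B l)"
begin

lemma dsum_simps:
  "f \<in> carrier (dsum I B) \<longleftrightarrow> f \<in> (\<Pi>\<^sub>E l\<in>I. carrier (B l)) \<and> finite {l \<in> I. f l \<noteq> \<zero>\<^bsub>B l\<^esub>}"
  "\<zero>\<^bsub>dsum I B\<^esub> = (\<lambda>l\<in>I. \<zero>\<^bsub>B l\<^esub>)"
  "f \<oplus>\<^bsub>dsum I B\<^esub> g = (\<lambda>l\<in>I. f l \<oplus>\<^bsub>B l\<^esub> g l)"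
  "c \<odot>\<^bsub>dsum I B\<^esub> f = (\<lambda>l\<in>I. c \<odot>\<^bsub>B l\<^esub> f l)"
  by (simp_all add: dsum_def)

lemma dsum_carrierD: "f \<in> carrier (dsum I B) \<Longrightarrow> l \<in> I \<Longrightarrow> f l \<in> carrier (B l)"
  by (auto simp: dsum_simps)

lemma dsum_closedI:
  assumes "f \<in> extensional I" "\<And>l. l \<in> I \<Longrightarrow> f l \<in> carrier (B l)"
    and "finite S" "\<And>l. l \<in> I \<Longrightarrow> l \<notin> S \<Longrightarrow> f l = \<zero>\<^bsub>B l\<^esub>"
  shows "f \<in> carrier (dsum I B)"
proof -
  have "{l \<in> I. f l \<noteq> \<zero>\<^bsub>B l\<^esub>} \<subseteq> S" using assms(4) by blast
  then show ?thesis
    using finite_subset[OF _ assms(3)] assms(1,2) by (auto simp: dsum_simps PiE_iff)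
qed

lemma dsum_add_closed:
  assumes f: "f \<in> carrier (dsum I B)" and g: "g \<in> carrier (dsum I B)"
  shows "f \<oplus>\<^bsub>dsum I B\<^esub> g \<in> carrier (dsum I B)"
proof -
  have z: "\<zero>\<^bsub>B l\<^esub> \<oplus>\<^bsub>B l\<^esub> \<zero>\<^bsub>B l\<^esub> = \<zero>\<^bsub>B l\<^esub>" "x \<in> carrier (B l) \<Longrightarrow> y \<in> carrier (B l) \<Longrightarrow> x \<oplus>\<^bsub>B l\<^esub> y \<in>
      carrier (B l)"
    if "l \<in> I" for l x y
  proof -
    interpret module K "B l" by (rule B[OF that])
    show "\<zero>\<^bsub>B l\<^esub> \<oplus>\<^bsub>B l\<^esub> \<zero>\<^bsub>B l\<^esub> = \<zero>\<^bsub>B l\<^esub>" by simp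
    show "x \<in> carrier (B l) \<Longrightarrow> y \<in> carrier (B l) \<Longrightarrow> x \<oplus>\<^bsub>B l\<^esub> y \<in> carrier (B l)" by simp
  qed
  show ?thesis
    by (rule dsum_closedI[of _ "{l \<in> I. f l \<noteq> \<zero>\<^bsub>B l\<^esub>} \<union> {l \<in> I. g l \<noteq> \<zero>\<^bsub>B l\<^esub>}"])
      (use f g in \<open>auto simp: dsum_simps(3) z dsum_carrierD\<close>, simp_all add: dsum_simps(1))
qed

lemma dsum_map_closed:
  assumes f: "f \<in> carrier (dsum I B)"
    and h: "\<And>l x. l \<in> I \<Longrightarrow> x \<in> carrier (B l) \<Longrightarrow> h l x \<in> carrier (B l)"
        "\<And>l. l \<in> I \<Longrightarrow> h l \<zero>\<^bsub>B l\<^esub> = \<zero>\<^bsub>B l\<^esub>"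
  shows "(\<lambda>l\<in>I. h l (f l)) \<in> carrier (dsum I B)"
  by (rule dsum_closedI[of _ "{l \<in> I. f l \<noteq> \<zero>\<^bsub>B l\<^esub>}"])
    (use f in \<open>auto simp: h dsum_carrierD\<close>, simp_all add: dsum_simps(1))

lemma dsum_eqI:
  assumes "f \<in> carrier (dsum I B)" "g \<in> carrier (dsum I B)" "\<And>l. l \<in> I \<Longrightarrow> f l = g l"
  shows "f = g"
  using assms by (auto simp: dsum_simps intro: PiE_ext)

lemma dsum_zero_closed: "\<zero>\<^bsub>dsum I B\<^esub> \<in> carrier (dsum I B)"
proof -
  have "\<zero>\<^bsub>B l\<^esub> \<in> carrier (B l)" if "l \<in> I" for l
  proof -
    interpret module K "B l" by (rule B[OF that])
    show ?thesis by simp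
  qed
  moreover have "{l \<in> I. (\<lambda>l\<in>I. \<zero>\<^bsub>B l\<^esub>) l \<noteq> \<zero>\<^bsub>B l\<^esub>} = {}" by auto
  ultimately show ?thesis by (simp add: dsum_simps)
qed

lemma dsum_smult_closed:
  assumes "c \<in> carrier K" "f \<in> carrier (dsum I B)"
  shows "c \<odot>\<^bsub>dsum I B\<^esub> f \<in> carrier (dsum I B)"
  unfolding dsum_simps(4)
proof (rule dsum_map_closed[OF assms(2)])
  fix l assume "l \<in> I"
  then interpret module K "B l" by (rule B)
  show "x \<in> carrier (B l) \<Longrightarrow> c \<odot>\<^bsub>B l\<^esub> x \<in> carrier (B l)" "c \<odot>\<^bsub>B l\<^esub> \<zero>\<^bsub>B l\<^esub> = \<zero>\<^bsub>B l\<^esub>" for x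
    using assms(1) by simp_all
qed

lemma dsum_module: "module K (dsum I B)"
proof -
  interpret field K by (rule K)
  note [simp] = dsum_add_closed dsum_zero_closed dsum_smult_closed dsum_carrierD
  have M: "\<And>l. l \<in> I \<Longrightarrow> abelian_group (B l)"
    using B by (simp add: module_def)
  show ?thesis
  proof (rule moduleI[OF is_cring], rule abelian_groupI)
    fix f assume f: "f \<in> carrier (dsum I B)"
    have n: "(\<lambda>l\<in>I. \<ominus>\<^bsub>B l\<^esub> f l) \<in> carrier (dsum I B)"
    proof (rule dsum_map_closed[OF f])
      fix l assume "l \<in> I"
      then interpret module K "B l" by (rule B)
      show "x \<in> carrier (B l) \<Longrightarrow> \<ominus>\<^bsub>B l\<^esub> x \<in> carrier (B l)" for x by simp
      show "\<ominus>\<^bsub>B l\<^esub> \<zero>\<^bsub>B l\<^esub> = \<zero>\<^bsub>B l\<^esub>"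
        using M.minus_equality[of "\<zero>\<^bsub>B l\<^esub>" "\<zero>\<^bsub>B l\<^esub>"] by simp
    qed
    moreover have "(\<lambda>l\<in>I. \<ominus>\<^bsub>B l\<^esub> f l) \<oplus>\<^bsub>dsum I B\<^esub> f = \<zero>\<^bsub>dsum I B\<^esub>"
      by (rule dsum_eqI[OF dsum_add_closed[OF n f] dsum_zero_closed])
        (use f in \<open>simp add: dsum_simps(2,3) abelian_group.l_neg[OF M]\<close>)
    ultimately show "\<exists>g\<in>carrier (dsum I B). g \<oplus>\<^bsub>dsum I B\<^esub> f = \<zero>\<^bsub>dsum I B\<^esub>" by blast
  next
    fix f g h assume c: "f \<in> carrier (dsum I B)" "g \<in> carrier (dsum I B)" "h \<in> carrier (dsum I B)"
    show "f \<oplus>\<^bsub>dsum I B\<^esub> g \<oplus>\<^bsub>dsum I B\<^esub> h = f \<oplus>\<^bsub>dsum I B\<^esub> (g \<oplus>\<^bsub>dsum I B\<^esub> h)"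
      by (rule dsum_eqI) (use c in \<open>simp, simp, simp add: dsum_simps(3)
          abelian_monoid.a_assoc[OF abelian_group.axioms(1)[OF M]]\<close>)
  next
    fix f g assume c: "f \<in> carrier (dsum I B)" "g \<in> carrier (dsum I B)"
    show "f \<oplus>\<^bsub>dsum I B\<^esub> g = g \<oplus>\<^bsub>dsum I B\<^esub> f"
      by (rule dsum_eqI) (use c in \<open>simp, simp, simp add: dsum_simps(3)
          abelian_monoid.a_comm[OF abelian_group.axioms(1)[OF M]]\<close>)
  next
    fix f assume f: "f \<in> carrier (dsum I B)"
    show "\<zero>\<^bsub>dsum I B\<^esub> \<oplus>\<^bsub>dsum I B\<^esub> f = f"
      by (rule dsum_eqI) (use f in \<open>simp, simp, simp add: dsum_simps(2,3)
          abelian_monoid.l_zero[OF abelian_group.axioms(1)[OF M]]\<close>)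
    show "\<one>\<^bsub>K\<^esub> \<odot>\<^bsub>dsum I B\<^esub> f = f"
      by (rule dsum_eqI) (use f in \<open>simp, simp, simp add: dsum_simps(4) module.smult_one[OF B]\<close>)
  next
    fix c d f assume c: "c \<in> carrier K" "d \<in> carrier K" "f \<in> carrier (dsum I B)"
    show "(c \<oplus>\<^bsub>K\<^esub> d) \<odot>\<^bsub>dsum I B\<^esub> f = c \<odot>\<^bsub>dsum I B\<^esub> f \<oplus>\<^bsub>dsum I B\<^esub> d \<odot>\<^bsub>dsum I B\<^esub> f"
      by (rule dsum_eqI) (use c in \<open>simp, simp, simp add: dsum_simps(3,4)
          module.smult_l_distr[OF B]\<close>)
    show "(c \<otimes>\<^bsub>K\<^esub> d) \<odot>\<^bsub>dsum I B\<^esub> f = c \<odot>\<^bsub>dsum I B\<^esub> (d \<odot>\<^bsub>dsum I B\<^esub> f)"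
      by (rule dsum_eqI) (use c in \<open>simp, simp, simp add: dsum_simps(3,4)
          module.smult_assoc1[OF B]\<close>)
  next
    fix c f g assume c: "c \<in> carrier K" "f \<in> carrier (dsum I B)" "g \<in> carrier (dsum I B)"
    show "c \<odot>\<^bsub>dsum I B\<^esub> (f \<oplus>\<^bsub>dsum I B\<^esub> g) = c \<odot>\<^bsub>dsum I B\<^esub> f \<oplus>\<^bsub>dsum I B\<^esub> c \<odot>\<^bsub>dsum I B\<^esub> g"
      by (rule dsum_eqI) (use c in \<open>simp, simp, simp add: dsum_simps(3,4)
          module.smult_r_distr[OF B]\<close>)
  qed simp_all
qed

lemma dsum_inj_closed:
  assumes "t \<in> I" "x \<in> carrier (B t)"
  shows "dsum_inj I B t x \<in> carrier (dsum I B)"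
proof -
  have "{l \<in> I. dsum_inj I B t x l \<noteq> \<zero>\<^bsub>B l\<^esub>} \<subseteq> {t}" by (auto simp: dsum_inj_def)
  moreover have "\<zero>\<^bsub>B l\<^esub> \<in> carrier (B l)" if "l \<in> I" for l
    using dsum_carrierD[OF dsum_zero_closed that] that by (simp add: dsum_simps(2))
  ultimately show ?thesis
    using assms finite_subset by (auto simp: dsum_simps dsum_inj_def)
qed

lemma dsum_inj_linear:
  assumes t: "t \<in> I"
  shows "linear_map K (B t) (dsum I B) (dsum_inj I B t)"
proof -
  interpret V: module K "dsum I B" by (rule dsum_module)
  have z: "\<zero>\<^bsub>B l\<^esub> \<oplus>\<^bsub>B l\<^esub> \<zero>\<^bsub>B l\<^esub> = \<zero>\<^bsub>B l\<^esub>" "c \<in> carrier K \<Longrightarrow> c \<odot>\<^bsub>B l\<^esub> \<zero>\<^bsub>B l\<^esub> = \<zero>\<^bsub>B l\<^esub>" if "l \<in> I"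
      for l c
  proof -
    interpret module K "B l" by (rule B[OF that])
    show "\<zero>\<^bsub>B l\<^esub> \<oplus>\<^bsub>B l\<^esub> \<zero>\<^bsub>B l\<^esub> = \<zero>\<^bsub>B l\<^esub>" "c \<in> carrier K \<Longrightarrow> c \<odot>\<^bsub>B l\<^esub> \<zero>\<^bsub>B l\<^esub> = \<zero>\<^bsub>B l\<^esub>" by simp_all
  qed
  show ?thesis
    unfolding linear_map_def using t
    by (auto simp: dsum_inj_closed) (auto simp: dsum_simps dsum_inj_def fun_eq_iff z)
qed

text \<open>Splits off one component and leaves a remainder vanishing at t, which is the inductive
  step of \<open>dsum_ext\<close>.\<close>

lemma dsum_decompose:
  assumes f: "f \<in> carrier (dsum I B)" and t: "t \<in> I"
  shows "f = dsum_inj I B t (f t) \<oplus>\<^bsub>dsum I B\<^esub> f(t := \<zero>\<^bsub>B t\<^esub>)"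
    and "f(t := \<zero>\<^bsub>B t\<^esub>) \<in> carrier (dsum I B)"
proof -
  interpret T: module K "B t" by (rule B[OF t])
  have z: "\<zero>\<^bsub>B l\<^esub> \<in> carrier (B l)" if "l \<in> I" for l
    using dsum_carrierD[OF dsum_zero_closed that] that by (simp add: dsum_simps(2))
  show c: "f(t := \<zero>\<^bsub>B t\<^esub>) \<in> carrier (dsum I B)"
    by (rule dsum_closedI[of _ "{l \<in> I. f l \<noteq> \<zero>\<^bsub>B l\<^esub>}"])
      (use f t in \<open>auto simp: z dsum_carrierD\<close>, auto simp: dsum_simps(1) PiE_iff extensional_def)
  show "f = dsum_inj I B t (f t) \<oplus>\<^bsub>dsum I B\<^esub> f(t := \<zero>\<^bsub>B t\<^esub>)"
  proof (rule dsum_eqI[OF f dsum_add_closed[OF dsum_inj_closed[OF t dsum_carrierD[OF f t]] c]])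
    fix l assume l: "l \<in> I"
    then interpret module K "B l" by (rule B)
    show "f l = (dsum_inj I B t (f t) \<oplus>\<^bsub>dsum I B\<^esub> f(t := \<zero>\<^bsub>B t\<^esub>)) l"
      using l dsum_carrierD[OF f l] T.M.r_zero[OF dsum_carrierD[OF f t]]
      by (auto simp: dsum_simps(3) dsum_inj_def)
  qed
qed

lemma dsum_ext:
  assumes W: "module K W" and \<phi>: "linear_map K (dsum I B) W \<phi>" and \<psi>: "linear_map K (dsum I B) W \<psi>"
    and eq: "\<And>t x. t \<in> I \<Longrightarrow> x \<in> carrier (B t) \<Longrightarrow> \<phi> (dsum_inj I B t x) = \<psi> (dsum_inj I B t x)"
    and f: "f \<in> carrier (dsum I B)"
  shows "\<phi> f = \<psi> f"
proof -
  \<comment> \<open>The induction runs over finite sets J containing the support rather than over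
    the support itself. An inserted index outside I can simply be dropped, as the support lies in
    I.\<close>
  have "\<phi> f = \<psi> f" if "finite J" "f \<in> carrier (dsum I B)" "{l \<in> I. f l \<noteq> \<zero>\<^bsub>B l\<^esub>} \<subseteq> J" for J f
    using that
  proof (induction J arbitrary: f rule: finite_induct)
    case empty
    then have "f = \<zero>\<^bsub>dsum I B\<^esub>"
      by (intro dsum_eqI[OF _ dsum_zero_closed]) (auto simp: dsum_simps(2))
    then show ?case
      using linear_map_zero[OF dsum_module W \<phi>] linear_map_zero[OF dsum_module W \<psi>] by simp
  next
    case (insert t J)
    show ?case
    proof (cases "t \<in> I")
      case True
      note d = dsum_decompose[OF insert.prems(1) True]
      note i = dsum_inj_closed[OF True dsum_carrierD[OF insert.prems(1) True]]
      have "\<phi> (f(t := \<zero>\<^bsub>B t\<^esub>)) = \<psi> (f(t := \<zero>\<^bsub>B t\<^esub>))"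
        using insert.prems(2) by (intro insert.IH d(2)) auto
      then show ?thesis
        using linear_map_add[OF \<phi> i d(2)] linear_map_add[OF \<psi> i d(2)]
          eq[OF True dsum_carrierD[OF insert.prems(1) True]] d(1) by simp
    next
      case False
      then show ?thesis using insert by (intro insert.IH) auto
    qed
  qed
  then show ?thesis using f by (auto simp: dsum_simps(1))
qed

lemma dsum_lift:
  assumes W: "module K W" and h: "\<And>l. l \<in> I \<Longrightarrow> linear_map K (B l) W (h l)"
  shows "linear_map K (dsum I B) W (dsum_lift B I W h)"
    and "t \<in> I \<Longrightarrow> x \<in> carrier (B t) \<Longrightarrow> dsum_lift B I W h (dsum_inj I B t x) = h t x"
proof -
  interpret W: module K W by (rule W)
  note hc = linear_map_closed[OF h]
  have h0: "h l \<zero>\<^bsub>B l\<^esub> = \<zero>\<^bsub>W\<^esub>" if "l \<in> I" for l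
    by (rule linear_map_zero[OF B[OF that] W h[OF that]])
  \<comment> \<open>Since \<open>h l\<close> maps zero to zero, the sum may run over any finite J in
    I that contains the support. This is needed because supports shrink under scaling by zero and
    under cancellation, so that the sums must be compared over a common index set.\<close>
  have ext: "dsum_lift B I W h f = (\<Oplus>\<^bsub>W\<^esub> l \<in> J. h l (f l))"
    if "f \<in> carrier (dsum I B)" "finite J" "{l \<in> I. f l \<noteq> \<zero>\<^bsub>B l\<^esub>} \<subseteq> J" "J \<subseteq> I" for f J
    unfolding dsum_lift_def
    by (rule W.M.add.finprod_mono_neutral_cong_left)
        (use that h0 in \<open>auto intro!: hc dsum_carrierD\<close>)
  show "linear_map K (dsum I B) W (dsum_lift B I W h)"
    unfolding linear_map_def
  proof (intro conjI ballI Pi_I)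
    fix f assume f: "f \<in> carrier (dsum I B)"
    show "dsum_lift B I W h f \<in> carrier W"
      unfolding dsum_lift_def by (rule W.M.finsum_closed) (use f in \<open>auto intro!: hc dsum_carrierD\<close>)
    show "dsum_lift B I W h (c \<odot>\<^bsub>dsum I B\<^esub> f) = c \<odot>\<^bsub>W\<^esub> dsum_lift B I W h f" if c: "c \<in> carrier K"
        for c
    proof -
      let ?J = "{l \<in> I. f l \<noteq> \<zero>\<^bsub>B l\<^esub>}"
      have J: "finite ?J" using f by (simp add: dsum_simps(1))
      have "dsum_lift B I W h (c \<odot>\<^bsub>dsum I B\<^esub> f) = (\<Oplus>\<^bsub>W\<^esub> l \<in> ?J. h l ((c \<odot>\<^bsub>dsum I B\<^esub> f) l))"
        by (rule ext[OF dsum_smult_closed[OF c f] J])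
            (auto simp: dsum_simps(4) module.smult_r_null[OF B c])
      also have "\<dots> = (\<Oplus>\<^bsub>W\<^esub> l \<in> ?J. c \<odot>\<^bsub>W\<^esub> h l (f l))"
        by (rule W.M.finsum_cong')
          (use f c in \<open>auto simp: dsum_simps(4) linear_map_smult[OF h] dsum_carrierD intro!: hc
              W.smult_closed\<close>)
      also have "\<dots> = c \<odot>\<^bsub>W\<^esub> (\<Oplus>\<^bsub>W\<^esub> l \<in> ?J. h l (f l))"
        by (rule W.finsum_smult_ldistr[symmetric, OF J c])
            (use f in \<open>auto intro!: hc dsum_carrierD\<close>)
      finally show ?thesis by (simp add: dsum_lift_def)
    qed
    show "dsum_lift B I W h (f \<oplus>\<^bsub>dsum I B\<^esub> g) = dsum_lift B I W h f \<oplus>\<^bsub>W\<^esub> dsum_lift B I W h g"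
      if g: "g \<in> carrier (dsum I B)" for g
    proof -
      let ?J = "{l \<in> I. f l \<noteq> \<zero>\<^bsub>B l\<^esub>} \<union> {l \<in> I. g l \<noteq> \<zero>\<^bsub>B l\<^esub>}"
      have J: "finite ?J" using f g by (simp add: dsum_simps(1))
      have z: "\<zero>\<^bsub>B l\<^esub> \<oplus>\<^bsub>B l\<^esub> \<zero>\<^bsub>B l\<^esub> = \<zero>\<^bsub>B l\<^esub>" if "l \<in> I" for l
      proof -
        interpret module K "B l" by (rule B[OF that])
        show ?thesis by simp
      qed
      have "dsum_lift B I W h (f \<oplus>\<^bsub>dsum I B\<^esub> g) = (\<Oplus>\<^bsub>W\<^esub> l \<in> ?J. h l ((f \<oplus>\<^bsub>dsum I B\<^esub> g) l))"
        by (rule ext[OF dsum_add_closed[OF f g] J]) (auto simp: dsum_simps(3) z)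
      also have "\<dots> = (\<Oplus>\<^bsub>W\<^esub> l \<in> ?J. h l (f l) \<oplus>\<^bsub>W\<^esub> h l (g l))"
        by (rule W.M.finsum_cong')
          (use f g in \<open>auto simp: dsum_simps(3) linear_map_add[OF h] dsum_carrierD intro!: hc
              W.M.a_closed\<close>)
      also have "\<dots> = (\<Oplus>\<^bsub>W\<^esub> l \<in> ?J. h l (f l)) \<oplus>\<^bsub>W\<^esub> (\<Oplus>\<^bsub>W\<^esub> l \<in> ?J. h l (g l))"
        by (rule W.M.finsum_addf) (use f g in \<open>auto intro!: hc dsum_carrierD\<close>)
      also have "\<dots> = dsum_lift B I W h f \<oplus>\<^bsub>W\<^esub> dsum_lift B I W h g"
        using ext[OF f J] ext[OF g J] by auto
      finally show ?thesis .
    qed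
  qed
  show "dsum_lift B I W h (dsum_inj I B t x) = h t x" if t: "t \<in> I" and x: "x \<in> carrier (B t)"
  proof -
    \<comment> \<open>The index set {t} also covers x = 0, where the support is empty.\<close>
    have "dsum_lift B I W h (dsum_inj I B t x) = (\<Oplus>\<^bsub>W\<^esub> l \<in> {t}. h l (dsum_inj I B t x l))"
      by (rule ext[OF dsum_inj_closed[OF t x]]) (use t in \<open>auto simp: dsum_inj_def\<close>)
    also have "\<dots> = h t x"
      using hc[OF t x] t by (simp add: W.M.finsum_insert dsum_inj_def)
    finally show ?thesis .
  qed
qed

end

section \<open>Transport of coassociativity, and kernels of morphisms of 2-algebras\<close>

lemma tensor_map_tensor_two_algebra [simp]:
  "tensor_map K (tensor_two_algebra K A B) W = tensor_map K (tensor K A B) W"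
  "tensor_map K W (tensor_two_algebra K A B) = tensor_map K W (tensor K A B)"
  by (simp_all add: tensor_map_def fun_eq_iff)

text \<open>As q intertwines \<Delta> and \<Delta>', both sides at q x are the images under q (x) (q
  (x) q) of the two sides of coassociativity for B at x. The calculation uses functoriality of the
  tensor map and naturality of the associator; \<Delta>' enters only as a linear map.\<close>

lemma coassoc_transfer:
  assumes C: "coalgebra K B \<Delta> \<epsilon>" and Q: "module K Q" and D: "linear_map K Q (tensor K Q Q) \<Delta>'"
    and q: "linear_map K B Q q" and qD: "\<And>x. x \<in> carrier B \<Longrightarrow> \<Delta>' (q x) = tensor_map K Q Q q q (\<Delta> x)"
    and x: "x \<in> carrier B"
  shows "tensor_assoc K Q Q Q (tensor_map K (tensor K Q Q) Q \<Delta>' id (\<Delta>' (q x))) =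
    tensor_map K Q (tensor K Q Q) id \<Delta>' (\<Delta>' (q x))"
proof -
  interpret coalgebra K B \<Delta> \<epsilon> by fact
  note K = field_axioms and B = module_axioms
  note t = tensor_module[OF K]
  let ?BB = "tensor K B B" and ?QQ = "tensor K Q Q"
  define d where "d = \<Delta> x"
  have d: "d \<in> carrier ?BB" using linear_map_closed[OF comult_linear x] by (simp add: d_def)
  note id = linear_map_id(2)
  note qq = tensor_map_linear[OF K B B Q Q q q]
  note Dq = linear_map_comp[OF q D] and qi = linear_map_comp[OF q id]
      and iq = linear_map_comp[OF id q]
    and qqD = linear_map_comp[OF comult_linear qq]
  have "tensor_map K ?QQ Q \<Delta>' id (tensor_map K Q Q q q d) = tensor_map K ?QQ Q (\<lambda>v. \<Delta>' (q v))
      (\<lambda>w. id (q w)) d"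
    by (rule tensor_map_comp[OF K B B Q Q t Q q q D id d])
  also have "\<dots> = tensor_map K ?QQ Q (\<lambda>v. tensor_map K Q Q q q (\<Delta> v)) (\<lambda>w. q (id w)) d"
    by (rule tensor_map_cong[OF K B B t Q Dq qi _ _ d]) (simp_all add: qD)
  also have "\<dots> = tensor_map K ?QQ Q (tensor_map K Q Q q q) q (tensor_map K ?BB B \<Delta> id d)"
    by (rule tensor_map_comp[OF K B B t B t Q comult_linear id qq q d, symmetric])
  finally have "tensor_assoc K Q Q Q (tensor_map K ?QQ Q \<Delta>' id (tensor_map K Q Q q q d)) =
      tensor_assoc K Q Q Q (tensor_map K ?QQ Q (tensor_map K Q Q q q) q
          (tensor_map K ?BB B \<Delta> id d))"
    by simp
  also have "\<dots> = tensor_map K Q ?QQ q (tensor_map K Q Q q q)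
      (tensor_assoc K B B B (tensor_map K ?BB B \<Delta> id d))"
    by (rule tensor_assoc_natural[OF K B B B Q Q Q q q q
          linear_map_closed[OF tensor_map_linear[OF K B B t B comult_linear id] d]])
  also have "tensor_assoc K B B B (tensor_map K ?BB B \<Delta> id d) = tensor_map K B ?BB id \<Delta> d"
    unfolding d_def by (rule coassoc[OF x])
  also have "tensor_map K Q ?QQ q (tensor_map K Q Q q q) (tensor_map K B ?BB id \<Delta> d) =
      tensor_map K Q ?QQ (\<lambda>v. q (id v)) (\<lambda>w. tensor_map K Q Q q q (\<Delta> w)) d"
    by (rule tensor_map_comp[OF K B B B t Q t id comult_linear q qq d])
  also have "\<dots> = tensor_map K Q ?QQ (\<lambda>v. id (q v)) (\<lambda>w. \<Delta>' (q w)) d"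
    by (rule tensor_map_cong[OF K B B Q t iq qqD _ _ d]) (simp_all add: qD)
  also have "\<dots> = tensor_map K Q ?QQ id \<Delta>' (tensor_map K Q Q q q d)"
    by (rule tensor_map_comp[OF K B B Q Q Q t q q id D d, symmetric])
  finally show ?thesis unfolding qD[OF x] d_def[symmetric] .
qed

text \<open>Being a morphism depends only on the values on the carrier, as A is closed under its
  operations. Used to replace a composite by a simpler expression for it and to pass to a restricted
  function.\<close>

lemma two_algebra_hom_cong:
  assumes A: "two_algebra K A" and f: "two_algebra_hom K A C f"
      and eq: "\<And>x. x \<in> carrier A \<Longrightarrow> f x = g x"
  shows "two_algebra_hom K A C g"
proof -
  interpret module K A by (rule two_algebra_module[OF A])
  show ?thesis
    using f two_algebra_closed[OF A] by (simp add: two_algebra_hom_iff linear_map_def Pi_def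
        eq[symmetric])
qed

lemma two_algebra_hom_kernel:
  assumes A: "two_algebra K A" and C: "two_algebra K C" and f: "two_algebra_hom K A C f"
  shows "ideal {x \<in> carrier A. f x = \<zero>\<^bsub>C\<^esub>} A" "ideal {x \<in> carrier A. f x = \<zero>\<^bsub>C\<^esub>} (diamond A)"
proof -
  interpret A: assoc_algebra K A using A by (simp add: two_algebra_def)
  interpret A': assoc_algebra K "diamond A" using A by (simp add: two_algebra_def)
  interpret C: assoc_algebra K C using C by (simp add: two_algebra_def)
  interpret C': assoc_algebra K "diamond C" using C by (simp add: two_algebra_def)
  note s = submodule_kernel[OF two_algebra_module[OF A] two_algebra_module[OF C]
      two_algebra_hom_linear[OF f]]
  note f' = f[unfolded two_algebra_hom_iff] and fc =
      linear_map_closed[OF two_algebra_hom_linear[OF f]]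
  show "ideal {x \<in> carrier A. f x = \<zero>\<^bsub>C\<^esub>} A"
    by (rule idealI[OF A.ring_axioms submodule.axioms(1)[OF s]]) (auto simp: f' fc)
  have "submodule {x \<in> carrier A. f x = \<zero>\<^bsub>C\<^esub>} K (diamond A)"
    using s by (simp add: submodule_cong[of "diamond A" A])
  then show "ideal {x \<in> carrier A. f x = \<zero>\<^bsub>C\<^esub>} (diamond A)"
    using C'.l_null C'.r_null fc two_algebra_closed(3)[OF A]
    by (intro idealI[OF A'.ring_axioms submodule.axioms(1)]) (auto simp: f')
qed

section \<open>The coproduct of a family of 2-bialgebras\<close>

text \<open>The definitions in this locale repeat those in the statement of
  \<open>mainTheorem8\<close>, so that the construction can be studied in separate lemmas. The
  theorem finally identifies the two copies.\<close>

locale two_bialgebra_family =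
  fixes K :: "('k, 'q) ring_scheme"
    and I :: "'i set"
    and B :: "'i \<Rightarrow> ('k, 'b) two_algebra"
    and \<Delta> :: "'i \<Rightarrow> 'b \<Rightarrow> ('k, 'b, 'b) tensor_term set"
    and \<epsilon> :: "'i \<Rightarrow> 'b \<Rightarrow> 'k"
  assumes K: "field K"
    and bialgebra: "\<And>l. l \<in> I \<Longrightarrow> two_bialgebra K (B l) (\<Delta> l) (\<epsilon> l)"
begin

definition "V = dsum I B"
definition "F = free_two_algebra K V"
definition "\<Delta>\<^sub>F = free_comult K V (dsum_comult K I B \<Delta>)"
definition "\<epsilon>\<^sub>F = free_counit K (dsum_counit K I B \<epsilon>)"
definition "u = (\<lambda>t x. free_inj K V (dsum_inj I B t x))"
definition "J n = ideal_chain K I B F u n"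
definition "L = (\<Union>n. J n)"
definition "Q = quotient_two_algebra F L"
definition "\<Delta>\<^sub>Q = quotient_comult K F \<Delta>\<^sub>F L"
definition "\<epsilon>\<^sub>Q = quotient_counit \<epsilon>\<^sub>F"
definition "p x = L +>\<^bsub>F\<^esub> x"
definition "q = (\<lambda>t x. L +>\<^bsub>F\<^esub> u t x)"

section \<open>The free 2-algebra F and the maps out of it\<close>

lemma B_structure:
  assumes "l \<in> I"
  shows "two_algebra K (B l)" "coalgebra K (B l) (\<Delta> l) (\<epsilon> l)"
    "two_algebra_hom K (B l) (tensor_two_algebra K (B l) (B l)) (\<Delta> l)"
    "two_algebra_hom K (B l) (scalars K) (\<epsilon> l)" "module K (B l)"
  using bialgebra[OF assms] two_algebra_module[of K "B l"]
      by (simp_all add: two_bialgebra_iff[OF K])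

lemma B_linear:
  assumes "l \<in> I"
  shows "linear_map K (B l) (tensor K (B l) (B l)) (\<Delta> l)" "linear_map K (B l) (scalars K) (\<epsilon> l)"
  using coalgebra.comult_linear[OF B_structure(2)[OF assms]]
      coalgebra.counit_linear[OF B_structure(2)[OF assms]] .

lemma V_module: "module K V"
  unfolding V_def by (rule dsum_module[where I = I and B = B, OF K B_structure(5)])

lemma F_two_algebra: "two_algebra K F"
  unfolding F_def by (rule free_two_algebra_two_algebra[OF K])

lemma F_module: "module K F"
  by (rule two_algebra_module[OF F_two_algebra])

lemma i_linear: "linear_map K V F (free_inj K V)"
  unfolding F_def by (rule free_inj_linear[OF V_module])

lemma j_linear: "t \<in> I \<Longrightarrow> linear_map K (B t) V (dsum_inj I B t)"
  unfolding V_def by (rule dsum_inj_linear[where I = I and B = B, OF K B_structure(5)])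

lemma u_linear: "t \<in> I \<Longrightarrow> linear_map K (B t) F (u t)"
  unfolding u_def by (rule linear_map_comp[OF j_linear i_linear])

text \<open>Two reductions are combined: f and g agree on the image of V by extensionality on the
  direct sum, and then both equal the free extension of g composed with the inclusion of V.\<close>

lemma F_hom_ext:
  assumes A: "two_algebra K A" and f: "two_algebra_hom K F A f" and g: "two_algebra_hom K F A g"
    and eq: "\<And>t x. t \<in> I \<Longrightarrow> x \<in> carrier (B t) \<Longrightarrow> f (u t x) = g (u t x)"
    and x: "x \<in> carrier F"
  shows "f x = g x"
proof -
  note m = two_algebra_module[OF A]
  note fi = linear_map_comp[OF i_linear two_algebra_hom_linear[OF f]]
    and gi = linear_map_comp[OF i_linear two_algebra_hom_linear[OF g]]
  have "f (free_inj K V v) = g (free_inj K V v)" if "v \<in> carrier V" for v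
    by (rule dsum_ext[where I = I and B = B, OF K B_structure(5) m fi[unfolded V_def]
        gi[unfolded V_def] _ that[unfolded V_def], folded V_def])
      (simp_all add: eq[unfolded u_def])
  then have "f x = free_lift A (\<lambda>v. g (free_inj K V v)) x"
      "g x = free_lift A (\<lambda>v. g (free_inj K V v)) x"
    using free_two_algebra_universal(3)[OF K V_module A gi, folded F_def] f g x by blast+
  then show ?thesis by simp
qed

lemma V_lift:
  assumes "module K W" "\<And>l. l \<in> I \<Longrightarrow> linear_map K (B l) W (h l)"
  shows "linear_map K V W (dsum_lift B I W h)"
    and "t \<in> I \<Longrightarrow> x \<in> carrier (B t) \<Longrightarrow> dsum_lift B I W h (dsum_inj I B t x) = h t x"
  unfolding V_def by (rule dsum_lift[where I = I and B = B, OF K B_structure(5) assms]; assumption)+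

lemma F_hom_lift:
  assumes A: "two_algebra K A" and h: "linear_map K V A h"
  shows "two_algebra_hom K F A (free_lift A h)"
    and "t \<in> I \<Longrightarrow> x \<in> carrier (B t) \<Longrightarrow> free_lift A h (u t x) = h (dsum_inj I B t x)"
  using free_two_algebra_universal(1,2)[OF K V_module A h, folded F_def]
      linear_map_closed[OF j_linear]
  by (simp_all add: u_def)

text \<open>The extension to F rests on linearity of \<open>dsum_comult\<close>, which comes from
  writing it as a \<open>dsum_lift\<close>. On u_t x, functoriality merges the tensor squares of the
  injections into V and into F.\<close>

lemma comult_F:
  shows "two_algebra_hom K F (tensor_two_algebra K F F) \<Delta>\<^sub>F"
    and "t \<in> I \<Longrightarrow> x \<in> carrier (B t) \<Longrightarrow> \<Delta>\<^sub>F (u t x) = tensor_map K F F (u t) (u t) (\<Delta> t x)"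
proof -
  let ?i = "free_inj K V"
  let ?h = "\<lambda>l b. tensor_map K V V (dsum_inj I B l) (dsum_inj I B l) (\<Delta> l b)"
  have h: "linear_map K (B l) (tensor K V V) (?h l)" if l: "l \<in> I" for l
    by (rule linear_map_comp[OF B_linear(1)[OF l] tensor_map_linear[OF K B_structure(5)[OF l]
        B_structure(5)[OF l] V_module V_module j_linear[OF l] j_linear[OF l]]])
  have e: "dsum_comult K I B \<Delta> = dsum_lift B I (tensor K V V) ?h"
    by (simp add: fun_eq_iff dsum_comult_def dsum_lift_def V_def Let_def)
  have D: "linear_map K V (tensor K V V) (dsum_comult K I B \<Delta>)"
    "\<And>t x. t \<in> I \<Longrightarrow> x \<in> carrier (B t) \<Longrightarrow> dsum_comult K I B \<Delta> (dsum_inj I B t x) = ?h t x"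
    unfolding e by (rule V_lift[OF tensor_module[OF K] h]; assumption)+
  have ii: "linear_map K (tensor K V V) (tensor K F F) (tensor_map K F F ?i ?i)"
    by (rule tensor_map_linear[OF K V_module V_module F_module F_module i_linear i_linear])
  have l: "linear_map K V (tensor_two_algebra K F F)
      (\<lambda>v. tensor_map K F F ?i ?i (dsum_comult K I B \<Delta> v))"
    using linear_map_comp[OF D(1) ii] by simp
  have "tensor_map K F F ?i ?i (dsum_comult K I B \<Delta> (dsum_inj I B t x)) = tensor_map K F F (u t)
      (u t) (\<Delta> t x)"
    if t: "t \<in> I" and x: "x \<in> carrier (B t)" for t x
    using tensor_map_comp[OF K B_structure(5)[OF t] B_structure(5)[OF t] V_module V_module
        F_module F_module j_linear[OF t] j_linear[OF t]
        i_linear i_linear linear_map_closed[OF B_linear(1)[OF t] x]]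
    by (simp add: D(2)[OF t x] u_def)
  note L = F_hom_lift[OF tensor_two_algebra_two_algebra[OF F_two_algebra F_two_algebra] l] this
  have e: "\<Delta>\<^sub>F = free_lift (tensor_two_algebra K F F)
      (\<lambda>v. tensor_map K F F ?i ?i (dsum_comult K I B \<Delta> v))"
    by (simp add: \<Delta>\<^sub>F_def free_comult_def F_def Let_def)
  show "two_algebra_hom K F (tensor_two_algebra K F F) \<Delta>\<^sub>F"
    and "t \<in> I \<Longrightarrow> x \<in> carrier (B t) \<Longrightarrow> \<Delta>\<^sub>F (u t x) = tensor_map K F F (u t) (u t) (\<Delta> t x)"
    unfolding e using L by simp_all
qed

lemma counit_F:
  shows "two_algebra_hom K F (scalars K) \<epsilon>\<^sub>F"
    and "t \<in> I \<Longrightarrow> x \<in> carrier (B t) \<Longrightarrow> \<epsilon>\<^sub>F (u t x) = \<epsilon> t x"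
proof -
  \<comment> \<open>\<open>dsum_counit\<close> sums in K and \<open>dsum_lift\<close> in
    \<open>scalars K\<close>. These are different records with the same addition and zero, so the
    sums are unfolded to be identified.\<close>
  have e: "dsum_counit K I B \<epsilon> = dsum_lift B I (scalars K) \<epsilon>"
    by (simp add: fun_eq_iff dsum_counit_def dsum_lift_def finsum_def finprod_def scalars_def)
  have D: "linear_map K V (scalars K) (dsum_counit K I B \<epsilon>)"
    "\<And>t x. t \<in> I \<Longrightarrow> x \<in> carrier (B t) \<Longrightarrow> dsum_counit K I B \<epsilon> (dsum_inj I B t x) = \<epsilon> t x"
    unfolding e by (rule V_lift[OF scalars_module[OF K] B_linear(2)]; assumption)+
  show "two_algebra_hom K F (scalars K) \<epsilon>\<^sub>F"
    and "t \<in> I \<Longrightarrow> x \<in> carrier (B t) \<Longrightarrow> \<epsilon>\<^sub>F (u t x) = \<epsilon> t x"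
    unfolding \<epsilon>\<^sub>F_def free_counit_def
    using F_hom_lift[OF scalars_two_algebra[OF K] D(1)] D(2) by simp_all
qed

section \<open>The chain of ideals and its union L\<close>

definition "gens = (\<Union>t\<in>I.
        {\<one>\<^bsub>F\<^esub> \<ominus>\<^bsub>F\<^esub> u t \<one>\<^bsub>B t\<^esub>} \<union>
        {u t (x \<otimes>\<^bsub>B t\<^esub> x') \<ominus>\<^bsub>F\<^esub> u t x \<otimes>\<^bsub>F\<^esub> u t x' | x x'. x \<in> carrier (B t) \<and> x' \<in> carrier (B t)} \<union>
        {u t (x \<diamondop>\<^bsub>B t\<^esub> x') \<ominus>\<^bsub>F\<^esub> u t x \<diamondop>\<^bsub>F\<^esub> u t x' | x x'. x \<in> carrier (B t) \<and> x' \<in> carrier (B t)})"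

lemma gensI:
  assumes "t \<in> I"
  shows "\<one>\<^bsub>F\<^esub> \<ominus>\<^bsub>F\<^esub> u t \<one>\<^bsub>B t\<^esub> \<in> gens"
    and "x \<in> carrier (B t) \<Longrightarrow> x' \<in> carrier (B t) \<Longrightarrow> u t (x \<otimes>\<^bsub>B t\<^esub> x') \<ominus>\<^bsub>F\<^esub> u t x \<otimes>\<^bsub>F\<^esub> u t x' \<in> gens"
    and "x \<in> carrier (B t) \<Longrightarrow> x' \<in> carrier (B t) \<Longrightarrow> u t (x \<diamondop>\<^bsub>B t\<^esub> x') \<ominus>\<^bsub>F\<^esub> u t x \<diamondop>\<^bsub>F\<^esub> u t x' \<in> gens"
  using assms unfolding gens_def by blast+

lemma J_0: "J 0 = linear_span K F gens"
  and J_Suc: "J (Suc n) = (if odd (Suc n) then genideal F (J n) else genideal (diamond F) (J n))"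
  by (simp_all add: J_def gens_def)

lemma u_mult_closed:
  assumes t: "t \<in> I" and x: "x \<in> carrier (B t)" and y: "y \<in> carrier (B t)"
  shows "u t \<one>\<^bsub>B t\<^esub> \<in> carrier F"
    "u t (x \<otimes>\<^bsub>B t\<^esub> y) \<in> carrier F" "u t x \<otimes>\<^bsub>F\<^esub> u t y \<in> carrier F"
    "u t (x \<diamondop>\<^bsub>B t\<^esub> y) \<in> carrier F" "u t x \<diamondop>\<^bsub>F\<^esub> u t y \<in> carrier F"
  using x y two_algebra_closed[OF B_structure(1)[OF t]] two_algebra_closed[OF F_two_algebra]
      linear_map_closed[OF u_linear[OF t]]
  by auto

lemma gens_closed: "gens \<subseteq> carrier F"
proof -
  interpret F: module K F by (rule F_module)
  have "u t \<one>\<^bsub>B t\<^esub> \<in> carrier F" if "t \<in> I" for t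
    using u_mult_closed(1)[OF that] two_algebra_closed(1)[OF B_structure(1)[OF that]] by blast
  then show ?thesis
    using two_algebra_closed(1)[OF F_two_algebra] by (auto simp: gens_def u_mult_closed)
qed

lemma F_ring: "ring F" "ring (diamond F)"
  using F_two_algebra by (simp_all add: two_algebra_def assoc_algebra_def)

text \<open>The claims are proved together: \<open>genideal\<close> is known to be an ideal only
  when generated by a subset of the carrier, which is the submodule property of the preceding stage.
  The condition n > 0 excludes J_0, which is just a linear span.\<close>

lemma J_submodule: "submodule (J n) K F"
  and J_ideal: "odd n \<Longrightarrow> ideal (J n) F" "even n \<Longrightarrow> n > 0 \<Longrightarrow> ideal (J n) (diamond F)"
proof -
  \<comment> \<open>\<open>ideal_submodule\<close> concerns ideals for the first multiplication, so
    it is applied to \<open>diamond F\<close>, where both multiplications are the second one of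
    F.\<close>
  have c: "submodule N K F" if "ideal N (diamond F)" for N
  proof -
    have "submodule N K (diamond F)"
      by (rule ideal_submodule[OF _ that]) (use F_two_algebra in \<open>simp add: two_algebra_def
          diamond_def\<close>)
    then show ?thesis by (simp add: submodule_cong[of "diamond F" F])
  qed
  have "submodule (J n) K F \<and> (odd n \<longrightarrow> ideal (J n) F) \<and>
      (even n \<longrightarrow> n > 0 \<longrightarrow> ideal (J n) (diamond F))" for n
  proof (induction n)
    case 0
    show ?case using linear_span_submodule[OF F_module gens_closed] by (simp add: J_0)
  next
    case (Suc n)
    then have "J n \<subseteq> carrier F" using submodule_closed(1)[of "J n" K F] by blast
    then have "ideal (genideal F (J n)) F" "ideal (genideal (diamond F) (J n)) (diamond F)"
      using ring.genideal_ideal[OF F_ring(1)] ring.genideal_ideal[OF F_ring(2)] by simp_all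
    then show ?case
      using ideal_submodule[OF F_two_algebra] c by (simp add: J_Suc)
  qed
  then show "submodule (J n) K F" "odd n \<Longrightarrow> ideal (J n) F" "even n \<Longrightarrow> n > 0 \<Longrightarrow> ideal (J n) (diamond F)"
    by blast+
qed

lemma J_mono: "m \<le> n \<Longrightarrow> J m \<subseteq> J n"
proof (rule lift_Suc_mono_le[of J])
  show "J n \<subseteq> J (Suc n)" for n
    using ring.genideal_self[OF F_ring(1), of "J n"] ring.genideal_self[OF F_ring(2), of "J n"]
      submodule_closed(1)[OF J_submodule[of n]]
    by (auto simp: J_Suc)
qed

lemma L_submodule: "submodule L K F"
proof -
  interpret F: module K F by (rule F_module)
  show ?thesis
  proof (rule F.submoduleI)
    fix a b assume "a \<in> L" "b \<in> L"
    then obtain m n where "a \<in> J m" "b \<in> J n" by (auto simp: L_def)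
    then have "a \<in> J (max m n)" "b \<in> J (max m n)"
      using J_mono[of m "max m n"] J_mono[of n "max m n"] by auto
    then show "a \<oplus>\<^bsub>F\<^esub> b \<in> L"
      using submodule_closed(3)[OF J_submodule] by (auto simp: L_def)
  qed (auto simp: L_def dest: submodule_closed(1)[OF J_submodule] intro:
      submodule_closed(2,4,5)[OF J_submodule])
qed

text \<open>The chain increases, and odd stages as well as positive even stages are cofinal in it.
  Every element of L thus lies in some stage that absorbs products of the prescribed kind.\<close>

lemma L_ideal: "ideal L F" "ideal L (diamond F)"
proof -
  have o: "\<exists>n. odd n \<and> a \<in> J n" "\<exists>n>0. even n \<and> a \<in> J n" if a: "a \<in> L" for a
  proof -
    obtain n where n: "a \<in> J n" using a by (auto simp: L_def)
    \<comment> \<open>Both indices are at least n and have the required parities; 2n + 2 rather than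
      2n keeps the even index positive when n = 0.\<close>
    then have "a \<in> J (2 * n + 1)" "a \<in> J (2 * n + 2)"
      using J_mono[of n "2 * n + 1"] J_mono[of n "2 * n + 2"] by auto
    then show "\<exists>n. odd n \<and> a \<in> J n" "\<exists>n>0. even n \<and> a \<in> J n"
      using exI[of "\<lambda>k. odd k \<and> a \<in> J k" "2 * n + 1"] exI[of "\<lambda>k. k > 0 \<and> even k \<and> a \<in> J k"
          "2 * n + 2"]
      by simp_all
  qed
  show "ideal L F"
  proof (rule idealI[OF F_ring(1) submodule.axioms(1)[OF L_submodule]])
    fix a x assume ax: "a \<in> L" "x \<in> carrier F"
    then obtain n where n: "odd n" "a \<in> J n" using o(1) by blast
    then show "x \<otimes>\<^bsub>F\<^esub> a \<in> L" "a \<otimes>\<^bsub>F\<^esub> x \<in> L"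
      using ideal.I_l_closed[OF J_ideal(1)[OF n(1)] n(2) ax(2)]
          ideal.I_r_closed[OF J_ideal(1)[OF n(1)] n(2) ax(2)]
      by (auto simp: L_def)
  qed
  have "submodule L K (diamond F)" using L_submodule by (simp add: submodule_cong[of "diamond F" F])
  then show "ideal L (diamond F)"
  proof (rule idealI[OF F_ring(2) submodule.axioms(1)])
    fix a x assume ax: "a \<in> L" "x \<in> carrier (diamond F)"
    then obtain n where n: "even n" "n > 0" "a \<in> J n" using o(2) by blast
    then show "x \<otimes>\<^bsub>diamond F\<^esub> a \<in> L" "a \<otimes>\<^bsub>diamond F\<^esub> x \<in> L"
      using ideal.I_l_closed[OF J_ideal(2)[OF n(1,2)] n(3) ax(2)]
          ideal.I_r_closed[OF J_ideal(2)[OF n(1,2)] n(3) ax(2)]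
      by (auto simp: L_def)
  qed
qed

text \<open>Applied with three targets: Q (x) Q for the comultiplication, K for the counit, and an
  arbitrary test object C for the universal property.\<close>

lemma hom_vanishes_on_L:
  assumes A: "two_algebra K A" and f: "two_algebra_hom K F A f"
    and fu: "\<And>t. t \<in> I \<Longrightarrow> two_algebra_hom K (B t) A (\<lambda>x. f (u t x))"
    and x: "x \<in> L"
  shows "f x = \<zero>\<^bsub>A\<^esub>"
proof -
  let ?N = "{x \<in> carrier F. f x = \<zero>\<^bsub>A\<^esub>}"
  interpret A: assoc_algebra K A using A by (simp add: two_algebra_def)
  interpret F: module K F by (rule F_module)
  note f' = f[unfolded two_algebra_hom_iff] and fu' = fu[unfolded two_algebra_hom_iff]
  have minus: "x \<ominus>\<^bsub>F\<^esub> y \<in> ?N" if "x \<in> carrier F" "y \<in> carrier F" "f x = f y" for x y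
    using that linear_map_minus[OF F_module two_algebra_module[OF A] two_algebra_hom_linear[OF f]
        that(1,2)]
      linear_map_closed[OF two_algebra_hom_linear[OF f] that(2)]
    by (simp add: a_minus_def A.r_neg)
  have uc: "u t z \<in> carrier F" if "t \<in> I" "z \<in> carrier (B t)" for t z
    using linear_map_closed[OF u_linear[OF that(1)] that(2)] .
  have g: "gens \<subseteq> ?N"
  proof
    fix y assume "y \<in> gens"
    then obtain t where t: "t \<in> I" and y: "y = \<one>\<^bsub>F\<^esub> \<ominus>\<^bsub>F\<^esub> u t \<one>\<^bsub>B t\<^esub> \<or>
        (\<exists>x x'. y = u t (x \<otimes>\<^bsub>B t\<^esub> x') \<ominus>\<^bsub>F\<^esub> u t x \<otimes>\<^bsub>F\<^esub> u t x' \<and> x \<in> carrier (B t) \<and> x' \<in> carrier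
            (B t)) \<or>
        (\<exists>x x'. y = u t (x \<diamondop>\<^bsub>B t\<^esub> x') \<ominus>\<^bsub>F\<^esub> u t x \<diamondop>\<^bsub>F\<^esub> u t x' \<and> x \<in> carrier (B t) \<and> x' \<in> carrier
            (B t))"
      unfolding gens_def by blast
    note one = two_algebra_closed(1)[OF B_structure(1)[OF t]]
    from y show "y \<in> ?N"
    proof (elim disjE exE conjE)
      assume "y = \<one>\<^bsub>F\<^esub> \<ominus>\<^bsub>F\<^esub> u t \<one>\<^bsub>B t\<^esub>"
      then show ?thesis
        using minus[OF two_algebra_closed(1)[OF F_two_algebra] uc[OF t one]] f' fu'[OF t] by simp
    next
      fix a b assume "y = u t (a \<otimes>\<^bsub>B t\<^esub> b) \<ominus>\<^bsub>F\<^esub> u t a \<otimes>\<^bsub>F\<^esub> u t b" and ab: "a \<in> carrier (B t)"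
          "b \<in> carrier (B t)"
      then show ?thesis
        using minus[OF u_mult_closed(2,3)[OF t ab]] f' fu'[OF t] uc[OF t] by simp
    next
      fix a b assume "y = u t (a \<diamondop>\<^bsub>B t\<^esub> b) \<ominus>\<^bsub>F\<^esub> u t a \<diamondop>\<^bsub>F\<^esub> u t b" and ab: "a \<in> carrier (B t)"
          "b \<in> carrier (B t)"
      then show ?thesis
        using minus[OF u_mult_closed(4,5)[OF t ab]] f' fu'[OF t] uc[OF t] by simp
    qed
  qed
  have "J n \<subseteq> ?N" for n
  proof (induction n)
    case 0
    show ?case
      unfolding J_0
          by (rule linear_span_minimal[OF submodule_kernel[OF F_module two_algebra_module[OF A]
              two_algebra_hom_linear[OF f]] g])
  next
    case (Suc n)
    show ?case
      using ring.genideal_minimal[OF F_ring(1) two_algebra_hom_kernel(1)[OF F_two_algebra A f] Suc]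
        ring.genideal_minimal[OF F_ring(2) two_algebra_hom_kernel(2)[OF F_two_algebra A f] Suc]
      by (simp add: J_Suc)
  qed
  then show ?thesis using x by (auto simp: L_def)
qed

section \<open>The quotient Q and the maps out of it\<close>

lemmas F_L = F_two_algebra L_ideal

lemma Q_two_algebra: "two_algebra K Q"
  unfolding Q_def by (rule quotient_two_algebra_two_algebra[OF F_L])

lemma Q_module: "module K Q"
  by (rule two_algebra_module[OF Q_two_algebra])

lemma p_hom: "two_algebra_hom K F Q p"
  using quotient_map_hom[OF F_L] by (simp add: p_def[abs_def] Q_def)

lemmas p_linear = two_algebra_hom_linear[OF p_hom]

lemma q_eq: "q t x = p (u t x)"
  by (simp add: q_def p_def)

lemma Q_carrier: "carrier Q = p ` carrier F"
  by (simp add: Q_def p_def quotient_carrier[OF F_module L_submodule])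

lemma Q_hom_ext:
  assumes A: "two_algebra K A" and f: "two_algebra_hom K Q A f" and g: "two_algebra_hom K Q A g"
    and eq: "\<And>t x. t \<in> I \<Longrightarrow> x \<in> carrier (B t) \<Longrightarrow> f (q t x) = g (q t x)"
    and X: "X \<in> carrier Q"
  shows "f X = g X"
  using F_hom_ext[OF A two_algebra_hom_comp[OF p_hom f] two_algebra_hom_comp[OF p_hom g]
      eq[unfolded q_eq]] X
  by (auto simp: Q_carrier)

text \<open>The lift is written with \<open>the_elem\<close> so that \<open>\<Delta>\<^sub>Q\<close>
  and \<open>\<epsilon>\<^sub>Q\<close> become instances by unfolding.\<close>

lemma Q_hom_lift:
  assumes A: "two_algebra K A" and f: "two_algebra_hom K F A f"
    and fu: "\<And>t. t \<in> I \<Longrightarrow> two_algebra_hom K (B t) A (\<lambda>x. f (u t x))"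
  shows "two_algebra_hom K Q A (\<lambda>X. the_elem (f ` X))"
    and "x \<in> carrier F \<Longrightarrow> the_elem (f ` p x) = f x"
    and "t \<in> I \<Longrightarrow> y \<in> carrier (B t) \<Longrightarrow> the_elem (f ` q t y) = f (u t y)"
proof -
  note L0 = hom_vanishes_on_L[OF A f fu]
  show "two_algebra_hom K Q A (\<lambda>X. the_elem (f ` X))"
    unfolding Q_def by (rule quotient_lift_hom[OF F_L A f L0])
  show e: "the_elem (f ` p x) = f x" if "x \<in> carrier F" for x
    unfolding p_def
    by (rule quotient_lift(1)[OF F_module L_submodule two_algebra_module[OF A]
        two_algebra_hom_linear[OF f] L0 that])
  show "t \<in> I \<Longrightarrow> y \<in> carrier (B t) \<Longrightarrow> the_elem (f ` q t y) = f (u t y)"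
    using e linear_map_closed[OF u_linear] by (simp add: q_eq)
qed

text \<open>The generators lie in J_0 and hence in L, so p identifies the two terms of each
  difference. This is what makes the merely linear u_t multiplicative in the quotient.\<close>

lemma q_hom:
  assumes t: "t \<in> I"
  shows "two_algebra_hom K (B t) Q (q t)"
proof -
  interpret F: module K F by (rule F_module)
  have gL: "x \<in> L" if "x \<in> gens" for x
    using that linear_span_superset[of gens K F] J_0 by (auto simp: L_def)
  have eq: "p x = p y" if "x \<ominus>\<^bsub>F\<^esub> y \<in> gens" "x \<in> carrier F" "y \<in> carrier F" for x y
    using coset_eq_iff[OF F_module L_submodule that(2,3)] gL[OF that(1)] by (simp add: p_def)
  note p' = p_hom[unfolded two_algebra_hom_iff]
  note one = two_algebra_closed(1)[OF B_structure(1)[OF t]]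
  have uc: "u t z \<in> carrier F" if "z \<in> carrier (B t)" for z
    using linear_map_closed[OF u_linear[OF t] that] .
  have "p \<one>\<^bsub>F\<^esub> = p (u t \<one>\<^bsub>B t\<^esub>)"
    by (rule eq[OF gensI(1)[OF t] two_algebra_closed(1)[OF F_two_algebra] uc[OF one]])
  moreover have "p (u t (x \<otimes>\<^bsub>B t\<^esub> y)) = p (u t x \<otimes>\<^bsub>F\<^esub> u t y)"
    if xy: "x \<in> carrier (B t)" "y \<in> carrier (B t)" for x y
    by (rule eq[OF gensI(2)[OF t xy] u_mult_closed(2,3)[OF t xy]])
  moreover have "p (u t (x \<diamondop>\<^bsub>B t\<^esub> y)) = p (u t x \<diamondop>\<^bsub>F\<^esub> u t y)"
    if xy: "x \<in> carrier (B t)" "y \<in> carrier (B t)" for x y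
    by (rule eq[OF gensI(3)[OF t xy] u_mult_closed(4,5)[OF t xy]])
  moreover have "linear_map K (B t) Q (\<lambda>x. p (u t x))"
    by (rule linear_map_comp[OF u_linear[OF t] p_linear])
  ultimately show ?thesis
    using p' by (simp add: two_algebra_hom_iff q_eq[abs_def] uc)
qed

lemmas q_linear = two_algebra_hom_linear[OF q_hom]

lemma QQ_two_algebra: "two_algebra K (tensor_two_algebra K Q Q)"
  by (rule tensor_two_algebra_two_algebra[OF Q_two_algebra Q_two_algebra])

text \<open>The third part makes \<open>hom_vanishes_on_L\<close> applicable although u_t is only
  linear: the composite equals (q_t (x) q_t) o \<Delta>_t, in which \<Delta>_t and q_t are morphisms
  of 2-algebras.\<close>

lemma pp_comult:
  shows "two_algebra_hom K F (tensor_two_algebra K Q Q) (\<lambda>x. tensor_map K Q Q p p (\<Delta>\<^sub>F x))"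
    and "t \<in> I \<Longrightarrow> x \<in> carrier (B t) \<Longrightarrow>
      tensor_map K Q Q p p (\<Delta>\<^sub>F (u t x)) = tensor_map K Q Q (q t) (q t) (\<Delta> t x)"
    and "t \<in> I \<Longrightarrow> two_algebra_hom K (B t) (tensor_two_algebra K Q Q)
        (\<lambda>x. tensor_map K Q Q p p (\<Delta>\<^sub>F (u t x)))"
proof -
  show "two_algebra_hom K F (tensor_two_algebra K Q Q) (\<lambda>x. tensor_map K Q Q p p (\<Delta>\<^sub>F x))"
    by (rule two_algebra_hom_comp[OF comult_F(1)
          tensor_map_hom[OF K F_two_algebra F_two_algebra Q_two_algebra Q_two_algebra p_hom p_hom]])
  show e: "tensor_map K Q Q p p (\<Delta>\<^sub>F (u t x)) = tensor_map K Q Q (q t) (q t) (\<Delta> t x)"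
    if t: "t \<in> I" and x: "x \<in> carrier (B t)" for t x
    using tensor_map_comp[OF K B_structure(5)[OF t] B_structure(5)[OF t] F_module F_module
        Q_module Q_module u_linear[OF t] u_linear[OF t]
        p_linear p_linear linear_map_closed[OF B_linear(1)[OF t] x]]
    by (simp add: comult_F(2)[OF t x] q_eq[abs_def])
  show "two_algebra_hom K (B t) (tensor_two_algebra K Q Q) (\<lambda>x. tensor_map K Q Q p p (\<Delta>\<^sub>F (u t x)))"
    if t: "t \<in> I"
    by (rule two_algebra_hom_cong[OF B_structure(1)[OF t]
        two_algebra_hom_comp[OF B_structure(3)[OF t]
            tensor_map_hom[OF K B_structure(1)[OF t] B_structure(1)[OF t] Q_two_algebra
                Q_two_algebra q_hom[OF t] q_hom[OF t]]]])
      (simp add: e[OF t])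
qed

lemma counit_u_hom: "t \<in> I \<Longrightarrow> two_algebra_hom K (B t) (scalars K) (\<lambda>x. \<epsilon>\<^sub>F (u t x))"
  by (rule two_algebra_hom_cong[OF B_structure(1) B_structure(4)]) (simp_all add: counit_F(2))

lemma L_coideal: "coideal K F \<Delta>\<^sub>F \<epsilon>\<^sub>F L"
  unfolding coideal_def
proof (intro conjI ballI subsetI L_submodule)
  fix y assume "y \<in> \<Delta>\<^sub>F ` L"
  then obtain x where x: "x \<in> L" "y = \<Delta>\<^sub>F x" by blast
  have y: "y \<in> carrier (tensor K F F)"
    using linear_map_closed[OF two_algebra_hom_linear[OF comult_F(1)]
        submodule_closed(1)[OF L_submodule x(1)]] x(2)
    by simp
  have "tensor_map K Q Q p p y = \<zero>\<^bsub>tensor K Q Q\<^esub>"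
    using hom_vanishes_on_L[OF QQ_two_algebra pp_comult(1) pp_comult(3) x(1)] x(2) by simp
  then show "y \<in> linear_span K (tensor K F F)
       ({pure K F F x y |x y. x \<in> L \<and> y \<in> carrier F} \<union> {pure K F F x y |x y. x \<in> carrier F \<and> y \<in>
           L})"
    using tensor_map_quotient_kernel[OF K F_module L_submodule y]
        by (simp add: Q_def p_def[abs_def])
next
  fix x assume "x \<in> L"
  then show "\<epsilon>\<^sub>F x = \<zero>\<^bsub>K\<^esub>"
    using hom_vanishes_on_L[OF scalars_two_algebra[OF K] counit_F(1) counit_u_hom]
        by (simp add: scalars_def)
qed

section \<open>The 2-bialgebra structure of Q\<close>

lemma comult_Q:
  shows "two_algebra_hom K Q (tensor_two_algebra K Q Q) \<Delta>\<^sub>Q"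
    and "t \<in> I \<Longrightarrow> x \<in> carrier (B t) \<Longrightarrow> \<Delta>\<^sub>Q (q t x) = tensor_map K Q Q (q t) (q t) (\<Delta> t x)"
proof -
  have e: "\<Delta>\<^sub>Q = (\<lambda>X. the_elem ((\<lambda>x. tensor_map K Q Q p p (\<Delta>\<^sub>F x)) ` X))"
    by (simp add: fun_eq_iff \<Delta>\<^sub>Q_def quotient_comult_def Q_def p_def[abs_def] Let_def)
  note l = Q_hom_lift[OF QQ_two_algebra pp_comult(1) pp_comult(3), folded e]
  show "two_algebra_hom K Q (tensor_two_algebra K Q Q) \<Delta>\<^sub>Q"
    by (rule l(1))
  show "t \<in> I \<Longrightarrow> x \<in> carrier (B t) \<Longrightarrow> \<Delta>\<^sub>Q (q t x) = tensor_map K Q Q (q t) (q t) (\<Delta> t x)"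
    using l(3)[of t x] by (simp add: pp_comult(2) e)
qed

lemma counit_Q:
  shows "two_algebra_hom K Q (scalars K) \<epsilon>\<^sub>Q"
    and "t \<in> I \<Longrightarrow> x \<in> carrier (B t) \<Longrightarrow> \<epsilon>\<^sub>Q (q t x) = \<epsilon> t x"
proof -
  have e: "\<epsilon>\<^sub>Q = (\<lambda>X. the_elem (\<epsilon>\<^sub>F ` X))"
    by (simp add: fun_eq_iff \<epsilon>\<^sub>Q_def quotient_counit_def)
  note l = Q_hom_lift[OF scalars_two_algebra[OF K] counit_F(1) counit_u_hom, folded e]
  show "two_algebra_hom K Q (scalars K) \<epsilon>\<^sub>Q"
    by (rule l(1))
  show "t \<in> I \<Longrightarrow> x \<in> carrier (B t) \<Longrightarrow> \<epsilon>\<^sub>Q (q t x) = \<epsilon> t x"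
    using l(3)[of t x] by (simp add: counit_F(2) e)
qed

lemma comult_Q_linear: "linear_map K Q (tensor K Q Q) \<Delta>\<^sub>Q"
  using two_algebra_hom_linear[OF comult_Q(1)] by simp

lemma Q_coalgebra: "coalgebra K Q \<Delta>\<^sub>Q \<epsilon>\<^sub>Q"
proof -
  note Q = Q_two_algebra and D = comult_Q(1) and e = two_algebra_hom_linear[OF counit_Q(1)]
  note id = two_algebra_hom_id(2)
  \<comment> \<open>\<open>c1\<close> and \<open>c2\<close> present the two sides of coassociativity
    as morphisms of 2-algebras from Q to Q (x) (Q (x) Q), so \<open>Q_hom_ext\<close> leaves only
    elements q_t x.\<close>
  have c1: "two_algebra_hom K Q (tensor_two_algebra K Q (tensor_two_algebra K Q Q))
      (\<lambda>X. tensor_assoc K Q Q Q (tensor_map K (tensor K Q Q) Q \<Delta>\<^sub>Q id (\<Delta>\<^sub>Q X)))"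
    using two_algebra_hom_comp[OF two_algebra_hom_comp[OF D tensor_map_hom[OF K Q Q QQ_two_algebra
        Q D id]]
        tensor_assoc_hom[OF K Q Q Q]] by simp
  have c2: "two_algebra_hom K Q (tensor_two_algebra K Q (tensor_two_algebra K Q Q))
      (\<lambda>X. tensor_map K Q (tensor K Q Q) id \<Delta>\<^sub>Q (\<Delta>\<^sub>Q X))"
    using two_algebra_hom_comp[OF D tensor_map_hom[OF K Q Q Q QQ_two_algebra id D]] by simp
  have coassoc: "tensor_assoc K Q Q Q (tensor_map K (tensor K Q Q) Q \<Delta>\<^sub>Q id (\<Delta>\<^sub>Q X)) =
      tensor_map K Q (tensor K Q Q) id \<Delta>\<^sub>Q (\<Delta>\<^sub>Q X)" if "X \<in> carrier Q" for X
    by (rule Q_hom_ext[OF tensor_two_algebra_two_algebra[OF Q QQ_two_algebra] c1 c2 _ that])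
      (rule coassoc_transfer[OF B_structure(2) Q_module comult_Q_linear q_linear comult_Q(2)])
  \<comment> \<open>Naturality along q_t turns the counit laws at q_t x into those of B_t at
    x.\<close>
  note cq = counit_map_natural[OF K B_structure(5) Q_module B_linear(2) e q_linear counit_Q(2)
      linear_map_closed[OF B_linear(1)]]
  have counit: "tensor_lift Q (\<lambda>v w. \<epsilon>\<^sub>Q v \<odot>\<^bsub>Q\<^esub> w) (\<Delta>\<^sub>Q X) = X"
    "tensor_lift Q (\<lambda>v w. \<epsilon>\<^sub>Q w \<odot>\<^bsub>Q\<^esub> v) (\<Delta>\<^sub>Q X) = X" if X: "X \<in> carrier Q" for X
  proof -
    note ch = counit_map_hom[OF K Q counit_Q(1)]
    show "tensor_lift Q (\<lambda>v w. \<epsilon>\<^sub>Q v \<odot>\<^bsub>Q\<^esub> w) (\<Delta>\<^sub>Q X) = X"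
      by (rule Q_hom_ext[OF Q two_algebra_hom_comp[OF D ch(1)] two_algebra_hom_id(1) _ X])
        (simp add: comult_Q(2) cq(1) coalgebra.counit_left[OF B_structure(2)])
    show "tensor_lift Q (\<lambda>v w. \<epsilon>\<^sub>Q w \<odot>\<^bsub>Q\<^esub> v) (\<Delta>\<^sub>Q X) = X"
      by (rule Q_hom_ext[OF Q two_algebra_hom_comp[OF D ch(2)] two_algebra_hom_id(1) _ X])
        (simp add: comult_Q(2) cq(2) coalgebra.counit_right[OF B_structure(2)])
  qed
  show ?thesis
    using K Q_module comult_Q_linear e coassoc counit
        by (simp add: coalgebra_def coalgebra_axioms_def)
qed

lemma Q_two_bialgebra: "two_bialgebra K Q \<Delta>\<^sub>Q \<epsilon>\<^sub>Q"
  by (simp add: two_bialgebra_iff[OF K] Q_two_algebra Q_coalgebra comult_Q(1) counit_Q(1))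

lemma q_two_bialgebra_hom: "t \<in> I \<Longrightarrow> two_bialgebra_hom K (B t) (\<Delta> t) (\<epsilon> t) Q \<Delta>\<^sub>Q \<epsilon>\<^sub>Q (q t)"
  by (simp add: two_bialgebra_hom_def coalgebra_hom_def q_hom q_linear comult_Q(2) counit_Q(2))

lemma Q_cocommutative:
  assumes "\<And>t. t \<in> I \<Longrightarrow> cocommutative K (B t) (\<Delta> t)"
  shows "cocommutative K Q \<Delta>\<^sub>Q"
  unfolding cocommutative_def
proof
  fix X assume X: "X \<in> carrier Q"
  note Q = Q_two_algebra
  show "tensor_swap K Q Q (\<Delta>\<^sub>Q X) = \<Delta>\<^sub>Q X"
  proof (rule Q_hom_ext[OF QQ_two_algebra two_algebra_hom_comp[OF comult_Q(1)
      tensor_swap_hom[OF K Q Q]] comult_Q(1) _ X])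
    fix t x assume t: "t \<in> I" and x: "x \<in> carrier (B t)"
    have "tensor_swap K (B t) (B t) (\<Delta> t x) = \<Delta> t x"
      using assms[OF t] x by (simp add: cocommutative_def)
    then show "tensor_swap K Q Q (\<Delta>\<^sub>Q (q t x)) = \<Delta>\<^sub>Q (q t x)"
      using tensor_swap_natural[OF K B_structure(5)[OF t] B_structure(5)[OF t] Q_module Q_module
          q_linear[OF t] q_linear[OF t]
          linear_map_closed[OF B_linear(1)[OF t] x]]
      by (simp add: comult_Q(2) t x)
  qed
qed

section \<open>The universal property\<close>

lemma Q_universal:
  assumes C: "two_bialgebra K C \<Delta>\<^sub>C \<epsilon>\<^sub>C"
    and f: "\<And>t. t \<in> I \<Longrightarrow> two_bialgebra_hom K (B t) (\<Delta> t) (\<epsilon> t) C \<Delta>\<^sub>C \<epsilon>\<^sub>C (f t)"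
  shows "\<exists>!g. g \<in> extensional (carrier Q) \<and> two_bialgebra_hom K Q \<Delta>\<^sub>Q \<epsilon>\<^sub>Q C \<Delta>\<^sub>C \<epsilon>\<^sub>C g \<and>
    (\<forall>t\<in>I. \<forall>x\<in>carrier (B t). g (q t x) = f t x)"
proof -
  have C': "two_algebra K C" "two_algebra_hom K C (tensor_two_algebra K C C) \<Delta>\<^sub>C"
      "two_algebra_hom K C (scalars K) \<epsilon>\<^sub>C"
    using C by (simp_all add: two_bialgebra_iff[OF K])
  note Cm = two_algebra_module[OF C'(1)]
  have f': "two_algebra_hom K (B t) C (f t)" "linear_map K (B t) C (f t)"
    "\<And>x. x \<in> carrier (B t) \<Longrightarrow> \<Delta>\<^sub>C (f t x) = tensor_map K C C (f t) (f t) (\<Delta> t x)"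
    "\<And>x. x \<in> carrier (B t) \<Longrightarrow> \<epsilon>\<^sub>C (f t x) = \<epsilon> t x" if "t \<in> I" for t
    using f[OF that] by (auto simp: two_bialgebra_hom_def coalgebra_hom_def)
  define h where "h = free_lift C (dsum_lift B I C f)"
  have D: "linear_map K V C (dsum_lift B I C f)"
    "\<And>t x. t \<in> I \<Longrightarrow> x \<in> carrier (B t) \<Longrightarrow> dsum_lift B I C f (dsum_inj I B t x) = f t x"
    by (rule V_lift[OF Cm f'(2)]; assumption)+
  have h: "two_algebra_hom K F C h" "\<And>t x. t \<in> I \<Longrightarrow> x \<in> carrier (B t) \<Longrightarrow> h (u t x) = f t x"
    using F_hom_lift[OF C'(1) D(1)] D(2) by (simp_all add: h_def)
  have hu: "two_algebra_hom K (B t) C (\<lambda>x. h (u t x))" if "t \<in> I" for t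
    by (rule two_algebra_hom_cong[OF B_structure(1)[OF that] f'(1)[OF that]])
        (simp add: h(2)[OF that])
  \<comment> \<open>Restricting to the carrier makes \<open>g\<close> extensional, so that
    uniqueness can be asserted as equality of total functions.\<close>
  define g where "g = restrict (\<lambda>X. the_elem (h ` X)) (carrier Q)"
  have gh: "two_algebra_hom K Q C g"
    by (rule two_algebra_hom_cong[OF Q_two_algebra Q_hom_lift(1)[OF C'(1) h(1) hu]])
        (simp_all add: g_def)
  note gl = two_algebra_hom_linear[OF gh]
  have gq: "g (q t x) = f t x" if "t \<in> I" "x \<in> carrier (B t)" for t x
    using Q_hom_lift(3)[OF C'(1) h(1) hu that] h(2)[OF that]
        linear_map_closed[OF q_linear[OF that(1)] that(2)]
    by (simp add: g_def)
  \<comment> \<open>Both sides are morphisms of 2-algebras from Q to C (x) C, the left one because C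
    is a 2-bialgebra. On q_t x both give (f_t (x) f_t)(\<Delta>_t x).\<close>
  have gD: "\<Delta>\<^sub>C (g X) = tensor_map K C C g g (\<Delta>\<^sub>Q X)" if X: "X \<in> carrier Q" for X
  proof (rule Q_hom_ext[OF tensor_two_algebra_two_algebra[OF C'(1) C'(1)]
      two_algebra_hom_comp[OF gh C'(2)]
        two_algebra_hom_comp[OF comult_Q(1) tensor_map_hom[OF K Q_two_algebra Q_two_algebra C'(1)
            C'(1) gh gh]] _ X])
    fix t x assume t: "t \<in> I" and x: "x \<in> carrier (B t)"
    note d = linear_map_closed[OF B_linear(1)[OF t] x] and ql = q_linear[OF t]
    note gql = linear_map_comp[OF ql gl]
    have "tensor_map K C C g g (\<Delta>\<^sub>Q (q t x)) = tensor_map K C C (\<lambda>x. g (q t x)) (\<lambda>x. g (q t x))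
        (\<Delta> t x)"
      unfolding comult_Q(2)[OF t x]
      by (rule tensor_map_comp[OF K B_structure(5)[OF t] B_structure(5)[OF t] Q_module Q_module Cm
          Cm ql ql gl gl d])
    also have "\<dots> = tensor_map K C C (f t) (f t) (\<Delta> t x)"
      by (rule tensor_map_cong[OF K B_structure(5)[OF t] B_structure(5)[OF t] Cm Cm gql gql _ _
          d]) (simp_all add: gq[OF t])
    finally show "\<Delta>\<^sub>C (g (q t x)) = tensor_map K C C g g (\<Delta>\<^sub>Q (q t x))"
      by (simp add: gq[OF t x] f'(3)[OF t x])
  qed
  have ge: "\<epsilon>\<^sub>C (g X) = \<epsilon>\<^sub>Q X" if X: "X \<in> carrier Q" for X
    by (rule Q_hom_ext[OF scalars_two_algebra[OF K] two_algebra_hom_comp[OF gh C'(3)] counit_Q(1)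
        _ X])
      (simp add: gq f'(4) counit_Q(2))
  have "two_bialgebra_hom K Q \<Delta>\<^sub>Q \<epsilon>\<^sub>Q C \<Delta>\<^sub>C \<epsilon>\<^sub>C g"
    by (simp add: two_bialgebra_hom_def coalgebra_hom_def gl gh gD ge)
  moreover have "g \<in> extensional (carrier Q)" by (simp add: g_def)
  moreover have "g' = g" if g': "g' \<in> extensional (carrier Q)"
      "two_bialgebra_hom K Q \<Delta>\<^sub>Q \<epsilon>\<^sub>Q C \<Delta>\<^sub>C \<epsilon>\<^sub>C g'"
    "\<forall>t\<in>I. \<forall>x\<in>carrier (B t). g' (q t x) = f t x" for g'
  proof (rule extensionalityI[OF g'(1)])
    show "g \<in> extensional (carrier Q)" by (simp add: g_def)
    fix X assume X: "X \<in> carrier Q"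
    have "two_algebra_hom K Q C g'" using g'(2) by (simp add: two_bialgebra_hom_def)
    then show "g' X = g X"
      by (rule Q_hom_ext[OF C'(1) _ gh _ X]) (use g'(3) gq in simp)
  qed
  ultimately show ?thesis using gq by blast
qed

lemma Q_coproduct: "two_bialgebra_coproduct TYPE('c) K I B \<Delta> \<epsilon> Q \<Delta>\<^sub>Q \<epsilon>\<^sub>Q q"
  unfolding two_bialgebra_coproduct_def
  by (intro conjI ballI allI impI) (simp_all add: Q_two_bialgebra q_two_bialgebra_hom Q_universal)

text \<open>Cocommutative 2-bialgebras form a full subcategory, so \<open>Q_universal\<close>
  applies as it stands once Q is known to belong to it.\<close>

lemma Q_cocommutative_coproduct:
  assumes "\<And>t. t \<in> I \<Longrightarrow> cocommutative K (B t) (\<Delta> t)"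
  shows "cocommutative_two_bialgebra_coproduct TYPE('c) K I B \<Delta> \<epsilon> Q \<Delta>\<^sub>Q \<epsilon>\<^sub>Q q"
  unfolding cocommutative_two_bialgebra_coproduct_def
  by (intro conjI ballI allI impI)
    (simp_all add: Q_two_bialgebra Q_cocommutative[OF assms] q_two_bialgebra_hom Q_universal)

end

theorem mainTheorem8:
  fixes K :: "('k, 'q) ring_scheme"
    and I :: "'i set"
    and B :: "'i \<Rightarrow> ('k, 'b) two_algebra"
    and \<Delta> :: "'i \<Rightarrow> 'b \<Rightarrow> ('k, 'b, 'b) tensor_term set"
    and \<epsilon> :: "'i \<Rightarrow> 'b \<Rightarrow> 'k"
  assumes "field K"
    and "\<And>l. l \<in> I \<Longrightarrow> two_bialgebra K (B l) (\<Delta> l) (\<epsilon> l)"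
  defines "V \<equiv> dsum I B"
  defines "F \<equiv> free_two_algebra K V"
    and "\<Delta>\<^sub>F \<equiv> free_comult K V (dsum_comult K I B \<Delta>)"
    and "\<epsilon>\<^sub>F \<equiv> free_counit K (dsum_counit K I B \<epsilon>)"
    and "u \<equiv> (\<lambda>t x. free_inj K V (dsum_inj I B t x))"
  defines "L \<equiv> (\<Union>n. ideal_chain K I B F u n)"
  defines "Q \<equiv> quotient_two_algebra F L"
    and "\<Delta>\<^sub>Q \<equiv> quotient_comult K F \<Delta>\<^sub>F L"
    and "\<epsilon>\<^sub>Q \<equiv> quotient_counit \<epsilon>\<^sub>F"
    and "q \<equiv> (\<lambda>t x. L +>\<^bsub>F\<^esub> u t x)"
  shows "coideal K F \<Delta>\<^sub>F \<epsilon>\<^sub>F L \<and> ideal L F \<and> ideal L (diamond F) \<and>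
    two_bialgebra_coproduct TYPE('c) K I B \<Delta> \<epsilon> Q \<Delta>\<^sub>Q \<epsilon>\<^sub>Q q \<and>
    ((\<forall>l\<in>I. cocommutative K (B l) (\<Delta> l)) \<longrightarrow>
      cocommutative_two_bialgebra_coproduct TYPE('c) K I B \<Delta> \<epsilon> Q \<Delta>\<^sub>Q \<epsilon>\<^sub>Q q)"
proof -
  interpret S: two_bialgebra_family K I B \<Delta> \<epsilon>
    by (rule two_bialgebra_family.intro[OF assms(1,2)])
  have V: "V = S.V" by (simp add: V_def S.V_def)
  have F: "F = S.F" by (simp add: F_def S.F_def V)
  have DF: "\<Delta>\<^sub>F = S.\<Delta>\<^sub>F" by (simp add: \<Delta>\<^sub>F_def S.\<Delta>\<^sub>F_def V)
  have eF: "\<epsilon>\<^sub>F = S.\<epsilon>\<^sub>F" by (simp add: \<epsilon>\<^sub>F_def S.\<epsilon>\<^sub>F_def)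
  have u: "u = S.u" by (simp add: u_def S.u_def V)
  have L: "L = S.L" by (simp add: L_def S.L_def S.J_def F u)
  have Q: "Q = S.Q" by (simp add: Q_def S.Q_def F L)
  have DQ: "\<Delta>\<^sub>Q = S.\<Delta>\<^sub>Q" by (simp add: \<Delta>\<^sub>Q_def S.\<Delta>\<^sub>Q_def F L DF)
  have eQ: "\<epsilon>\<^sub>Q = S.\<epsilon>\<^sub>Q" by (simp add: \<epsilon>\<^sub>Q_def S.\<epsilon>\<^sub>Q_def eF)
  have q: "q = S.q" by (simp add: q_def S.q_def F L u)
  show ?thesis
    unfolding F DF eF L Q DQ eQ q
    using S.L_coideal S.L_ideal S.Q_coproduct S.Q_cocommutative_coproduct by blast
qed

end
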